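(* Let $Q_8=\langle i,j,k\mid i^2=j^2=k^2=ijk\rangle$ be the quaternion group of order $8$. Let $\rho_1,\rho_2$ be the one-dimensional complex characters of $Q_8$ with $\rho_1(i)=1$, $\rho_1(j)=-1$ and $\rho_2(i)=-1$, $\rho_2(j)=1$, and let $\Delta$ be the two-dimensional complex representation with $$\Delta(i)=\begin{pmatrix}\sqrt{-1}&0\\0&-\sqrt{-1}\end{pmatrix},\quad \Delta(j)=\begin{pmatrix}0&-1\\1&0\end{pmatrix},\quad \Delta(k)=\begin{pmatrix}0&-\sqrt{-1}\\-\sqrt{-1}&0\end{pmatrix}.$$ Put $x=c_1(\rho_1)$, $y=c_1(\rho_2)$, $u=c_2(\Delta)$, so $|x|=|y|=1$ and $|u|=2$. Then $$R^*_{\mathbb C}(Q_8)=\frac{\mathbb Z[x,y,u]}{(2x,\ 2y,\ 8u,\ x^2,\ y^2,\ xy-4u)},$$ i.e. the homomorphism from the polynomial ring $\mathbb Z[x,y,u]$ to $R^*_{\mathbb C}(Q_8)$ sending the variables to the classes of the same name is surjective with kernel the displayed ideal.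
   Context: Let $G$ be a finite group. $R_{\mathbb C}(G)$ is the ring of virtual complex characters of $G$ (the free abelian group on the irreducible complex characters, with product induced by tensor product), with augmentation $\epsilon:R_{\mathbb C}(G)\to\mathbb Z$ the degree map and $I=\ker\epsilon$. Exterior powers of representations give maps $\lambda^n$ on characters, extended to $R_{\mathbb C}(G)$ by requiring $\lambda^0=1$ and $\lambda^n(x+y)=\sum_{i+j=n}\lambda^i(x)\lambda^j(y)$. Put $\gamma^n(x)=\lambda^n(x+n-1)$. Let $\Gamma^n\subseteq R_{\mathbb C}(G)$ be the additive subgroup generated by all products $\gamma^{i_1}(x_1)\cdots\gamma^{i_r}(x_r)$ with $x_j\in I$ and $\sum_j i_j\ge n$; then $\Gamma^0=R_{\mathbb C}(G)$, $\Gamma^1=I$, $\Gamma^m\Gamma^n\subseteq\Gamma^{m+n}$. The graded character ring is $R^*_{\mathbb C}(G)=\bigoplus_{n\ge0}\Gamma^n/\Gamma^{n+1}$. The $n$-th Chern class of $\rho\in R_{\mathbb C}(G)$ is the class $c_n(\rho)\in\Gamma^n/\Gamma^{n+1}$ of $\gamma^n(\rho-\epsilon(\rho))$. Representations are identified with their characters, and $|x|$ denotes degree. *)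

theory Defs
  imports
    "HOL-Algebra.QuotRing"
    "HOL-Algebra.Generated_Groups"
    "HOL-Library.Poly_Mapping"
    "Jordan_Normal_Form.VS_Connect"
    "Jordan_Normal_Form.DL_Submatrix"
begin

hide_const (open) Multiset.mult

section \<open>Complex representations and characters\<close>

definition representation :: "('g, 'm) monoid_scheme \<Rightarrow> nat \<Rightarrow> ('g \<Rightarrow> complex mat) \<Rightarrow> bool" where
  "representation G n \<rho> \<longleftrightarrow> \<rho> \<in> hom G (units_of (ring_mat TYPE(complex) n ()))"

definition irreducible_rep :: "('g, 'm) monoid_scheme \<Rightarrow> nat \<Rightarrow> ('g \<Rightarrow> complex mat) \<Rightarrow> bool" where
  "irreducible_rep G n \<rho> \<longleftrightarrow> representation G n \<rho> \<and> n > 0 \<and>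
     (\<forall>W. VectorSpace.subspace class_ring W (module_vec TYPE(complex) n) \<and>
          (\<forall>g\<in>carrier G. \<forall>w\<in>W. \<rho> g *\<^sub>v w \<in> W)
        \<longrightarrow> W = {0\<^sub>v n} \<or> W = carrier_vec n)"

definition mat_trace :: "complex mat \<Rightarrow> complex" where
  "mat_trace A = (\<Sum>i<dim_row A. A $$ (i, i))"

definition character :: "('g, 'm) monoid_scheme \<Rightarrow> ('g \<Rightarrow> complex mat) \<Rightarrow> 'g \<Rightarrow> complex" where
  "character G \<rho> = (\<lambda>g\<in>carrier G. mat_trace (\<rho> g))"

definition irr_characters :: "('g, 'm) monoid_scheme \<Rightarrow> ('g \<Rightarrow> complex) set" where
  "irr_characters G = {character G \<rho> | n \<rho>. irreducible_rep G n \<rho>}"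

definition function_ring :: "('g, 'm) monoid_scheme \<Rightarrow> ('g \<Rightarrow> complex) ring" where
  "function_ring G =
    \<lparr>carrier = extensional (carrier G),
     mult = (\<lambda>a b. \<lambda>g\<in>carrier G. a g * b g),
     one = (\<lambda>g\<in>carrier G. 1),
     zero = (\<lambda>g\<in>carrier G. 0),
     add = (\<lambda>a b. \<lambda>g\<in>carrier G. a g + b g)\<rparr>"

text \<open>
  The irreducible characters of a finite group are linearly independent, so the free abelian group
  on them is realised as the group of functions on \<open>G\<close> they generate. The tensor product of
  representations becomes the pointwise product.
\<close>

definition char_ring :: "('g, 'm) monoid_scheme \<Rightarrow> ('g \<Rightarrow> complex) ring" where
  "char_ring G =
     (function_ring G)\<lparr>carrier := generate (add_monoid (function_ring G)) (irr_characters G)\<rparr>"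

text \<open>The trace of the identity matrix is the dimension, so the degree is the value at \<open>1\<close>.\<close>

definition augmentation :: "('g, 'm) monoid_scheme \<Rightarrow> ('g \<Rightarrow> complex) \<Rightarrow> int" where
  "augmentation G a = (THE d. a \<one>\<^bsub>G\<^esub> = of_int d)"

definition augmentation_ideal :: "('g, 'm) monoid_scheme \<Rightarrow> ('g \<Rightarrow> complex) set" where
  "augmentation_ideal G = a_kernel (char_ring G) class_ring (augmentation G)"


section \<open>Exterior powers and the operations \<open>\<lambda>\<^sup>n\<close> and \<open>\<gamma>\<^sup>n\<close>\<close>

text \<open>
  If \<open>A\<close> is the matrix of an endomorphism of \<open>V\<close> in a basis \<open>e\<^sub>0, e\<^sub>1, \<dots>\<close>, then
  \<open>exterior_power n A\<close> is the matrix of the induced endomorphism of the \<open>n\<close>-th exterior power of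
  \<open>V\<close> in the basis of the wedge products of \<open>n\<close> of the \<open>e\<^sub>i\<close> with increasing indices; its
  entries are the \<open>n \<times> n\<close> minors of \<open>A\<close>. The list \<open>S\<close> enumerates the \<open>n\<close>-element sets of indices.
\<close>

definition exterior_power :: "nat \<Rightarrow> complex mat \<Rightarrow> complex mat" where
  "exterior_power n A =
    (let S = map set (filter (\<lambda>s. length s = n) (subseqs [0..<dim_row A]))
     in mat (length S) (length S) (\<lambda>(p, q). det (submatrix A (S ! p) (S ! q))))"

definition exterior_operations ::
    "('g, 'm) monoid_scheme \<Rightarrow> (nat \<Rightarrow> ('g \<Rightarrow> complex) \<Rightarrow> 'g \<Rightarrow> complex) \<Rightarrow> bool" where
  "exterior_operations G l \<longleftrightarrow>
     (\<forall>n. l n \<in> carrier (char_ring G) \<rightarrow>\<^sub>E carrier (char_ring G)) \<and>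
     (\<forall>n d \<rho>. representation G d \<rho> \<longrightarrow>
        l n (character G \<rho>) = character G (\<lambda>g. exterior_power n (\<rho> g))) \<and>
     (\<forall>a\<in>carrier (char_ring G). l 0 a = \<one>\<^bsub>char_ring G\<^esub>) \<and>
     (\<forall>n. \<forall>a\<in>carrier (char_ring G). \<forall>b\<in>carrier (char_ring G).
        l n (a \<oplus>\<^bsub>char_ring G\<^esub> b) =
          (\<Oplus>\<^bsub>char_ring G\<^esub>i\<in>{..n}. l i a \<otimes>\<^bsub>char_ring G\<^esub> l (n - i) b))"

text \<open>
  For a finite group these conditions have exactly one solution; the extensional function space
  fixes the irrelevant values outside the character ring.
\<close>

definition lambda_op :: "('g, 'm) monoid_scheme \<Rightarrow> nat \<Rightarrow> ('g \<Rightarrow> complex) \<Rightarrow> 'g \<Rightarrow> complex" where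
  "lambda_op G = (THE l. exterior_operations G l)"

definition gamma_op :: "('g, 'm) monoid_scheme \<Rightarrow> nat \<Rightarrow> ('g \<Rightarrow> complex) \<Rightarrow> 'g \<Rightarrow> complex" where
  "gamma_op G n a =
     lambda_op G n (a \<oplus>\<^bsub>char_ring G\<^esub> add_pow (char_ring G) (int n - 1) \<one>\<^bsub>char_ring G\<^esub>)"

definition gamma_products :: "('g, 'm) monoid_scheme \<Rightarrow> nat \<Rightarrow> ('g \<Rightarrow> complex) set" where
  "gamma_products G n =
    {foldr (\<lambda>(i, a) b. gamma_op G i a \<otimes>\<^bsub>char_ring G\<^esub> b) ps \<one>\<^bsub>char_ring G\<^esub> | ps.
       snd ` set ps \<subseteq> augmentation_ideal G \<and> n \<le> sum_list (map fst ps)}"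

definition gamma_filtration :: "('g, 'm) monoid_scheme \<Rightarrow> nat \<Rightarrow> ('g \<Rightarrow> complex) set" where
  "gamma_filtration G n = generate (add_monoid (char_ring G)) (gamma_products G n)"


section \<open>The graded character ring\<close>

text \<open>
  The associated graded ring of a descending filtration of a ring by ideals
  \<open>F 0 \<supseteq> F 1 \<supseteq> \<dots>\<close> with \<open>F 0 = R\<close> and \<open>F m F n \<subseteq> F (m + n)\<close>. An element is the sequence of its
  homogeneous components, the \<open>n\<close>-th being a coset of \<open>F (n + 1)\<close> in \<open>F n\<close>.
\<close>

definition assoc_graded :: "('a, 'm) ring_scheme \<Rightarrow> (nat \<Rightarrow> 'a set) \<Rightarrow> (nat \<Rightarrow> 'a set) ring" where
  "assoc_graded R F =
    \<lparr>carrier = {a. (\<forall>n. \<exists>r\<in>F n. a n = F (Suc n) +>\<^bsub>R\<^esub> r) \<and> finite {n. a n \<noteq> F (Suc n)}},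
     mult = (\<lambda>a b n. \<Oplus>\<^bsub>R Quot F (Suc n)\<^esub>i\<in>{..n}. rcoset_mult R (F (Suc n)) (a i) (b (n - i))),
     one = (\<lambda>n. F (Suc n) +>\<^bsub>R\<^esub> (if n = 0 then \<one>\<^bsub>R\<^esub> else \<zero>\<^bsub>R\<^esub>)),
     zero = (\<lambda>n. F (Suc n)),
     add = (\<lambda>a b n. a n <+>\<^bsub>R\<^esub> b n)\<rparr>"

definition homogeneous :: "('a, 'm) ring_scheme \<Rightarrow> (nat \<Rightarrow> 'a set) \<Rightarrow> nat \<Rightarrow> 'a \<Rightarrow> nat \<Rightarrow> 'a set" where
  "homogeneous R F n r = (\<lambda>m. F (Suc m) +>\<^bsub>R\<^esub> (if m = n then r else \<zero>\<^bsub>R\<^esub>))"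

definition graded_char_ring :: "('g, 'm) monoid_scheme \<Rightarrow> (nat \<Rightarrow> ('g \<Rightarrow> complex) set) ring" where
  "graded_char_ring G = assoc_graded (char_ring G) (gamma_filtration G)"

definition chern_class ::
    "('g, 'm) monoid_scheme \<Rightarrow> nat \<Rightarrow> ('g \<Rightarrow> complex) \<Rightarrow> nat \<Rightarrow> ('g \<Rightarrow> complex) set" where
  "chern_class G n a =
     homogeneous (char_ring G) (gamma_filtration G) n
       (gamma_op G n
          (a \<ominus>\<^bsub>char_ring G\<^esub> add_pow (char_ring G) (augmentation G a) \<one>\<^bsub>char_ring G\<^esub>))"


section \<open>Group presentations and the quaternion group\<close>

text \<open>The letter \<open>(s, True)\<close> stands for the generator \<open>s\<close> and \<open>(s, False)\<close> for its inverse.\<close>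

type_synonym 's word = "('s \<times> bool) list"

inductive presentation_eq :: "('s word \<times> 's word) set \<Rightarrow> 's word \<Rightarrow> 's word \<Rightarrow> bool"
  for rels :: "('s word \<times> 's word) set" where
  refl: "presentation_eq rels u u"
| sym: "presentation_eq rels u v \<Longrightarrow> presentation_eq rels v u"
| trans: "presentation_eq rels u v \<Longrightarrow> presentation_eq rels v w \<Longrightarrow> presentation_eq rels u w"
| cong: "presentation_eq rels u v \<Longrightarrow> presentation_eq rels (a @ u @ b) (a @ v @ b)"
| cancel: "presentation_eq rels [(s, e), (s, \<not> e)] []"
| relation: "(u, v) \<in> rels \<Longrightarrow> presentation_eq rels u v"

definition word_class :: "('s word \<times> 's word) set \<Rightarrow> 's word \<Rightarrow> 's word set" where
  "word_class rels u = {v. presentation_eq rels u v}"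

definition presented_group :: "('s word \<times> 's word) set \<Rightarrow> 's word set monoid" where
  "presented_group rels =
    \<lparr>carrier = range (word_class rels),
     mult = (\<lambda>A B. \<Union>u\<in>A. \<Union>v\<in>B. word_class rels (u @ v)),
     one = word_class rels []\<rparr>"

datatype quaternion_gen = Gen_i | Gen_j | Gen_k

definition Q8_relations :: "(quaternion_gen word \<times> quaternion_gen word) set" where
  "Q8_relations =
    (let i = (Gen_i, True); j = (Gen_j, True); k = (Gen_k, True)
     in {([i, i], [j, j]), ([j, j], [k, k]), ([k, k], [i, j, k])})"

definition Q8 :: "quaternion_gen word set monoid" where
  "Q8 = presented_group Q8_relations"

definition Q8_gen :: "quaternion_gen \<Rightarrow> quaternion_gen word set" where
  "Q8_gen s = word_class Q8_relations [(s, True)]"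


section \<open>Integer polynomials in three variables\<close>

datatype variable = Var_x | Var_y | Var_u

type_synonym int_poly_xyu = "(variable \<Rightarrow>\<^sub>0 nat) \<Rightarrow>\<^sub>0 int"

definition poly_var :: "variable \<Rightarrow> int_poly_xyu" where
  "poly_var v = Poly_Mapping.single (Poly_Mapping.single v 1) 1"

definition poly_ring_xyu :: "int_poly_xyu ring" where
  "poly_ring_xyu = class_ring"

end

theory Submission
  imports
    Defs
    "HOL-Computational_Algebra.Polynomial_FPS"
    "Jordan_Normal_Form.Schur_Decomposition"
begin

text \<open>
  Put \<open>a = \<rho>1 - 1\<close>, \<open>b = \<rho>2 - 1\<close> and \<open>w = 2 - \<Delta>\<close>. The character ring is free on \<open>1, a, b, a b, w\<close> with
  \<open>a\<^sup>2 = - 2 a\<close>, \<open>b\<^sup>2 = - 2 b\<close>, \<open>w a = 2 a\<close>, \<open>w b = 2 b\<close>, \<open>w\<^sup>2 = 4 w + 2 a + 2 b + a b\<close>. Since the total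
  \<open>\<gamma>\<close>-operation is multiplicative, with values \<open>1 + a t\<close>, \<open>1 + b t\<close>, \<open>1 + (a + b + a b) t\<close> and \<open>1 - w t + w t\<^sup>2\<close> on
  generators of the augmentation ideal, \<open>\<Gamma>\<^sup>n\<close> is spanned by the monomials in \<open>a, b, w\<close> of weight at least
  \<open>n\<close>, where \<open>a, b\<close> have weight 1 and \<open>w\<close> has weight 2. The relations above then give those of the graded ring, and
  comparing values at the five conjugacy classes shows that there are no others.

  That \<open>\<lambda>\<^sup>n\<close> exists on the character ring follows from Newton's identities: the generating function
  of the traces of the exterior powers of \<open>\<rho> g\<close> is \<open>det (1 + t \<rho> g)\<close>, which depends only on the character
  values at the powers of \<open>g\<close>.
\<close>

section \<open>Traces of exterior powers\<close>

lemma bij_betw_pick: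
  assumes "finite S"
  shows "bij_betw (pick S) {0..<card S} S"
proof -
  have "inj_on (pick S) {0..<card S}"
    by (rule linorder_inj_onI) (auto dest: pick_mono_le[of _ S])
  moreover from this have "pick S ` {0..<card S} = S"
    by (intro card_subset_eq assms) (auto simp: pick_in_set_le card_image)
  ultimately show ?thesis by (simp add: bij_betw_def)
qed

lemma bij_betw_map_permutation:
  assumes "bij_betw f A B"
  shows "bij_betw (map_permutation A f) {p. p permutes A} {p. p permutes B}"
proof (rule bij_betwI[where g = "map_permutation B (inv_into A f)"])
  have inv: "bij_betw (inv_into A f) B A" by (rule bij_betw_inv_into[OF assms])
  show "map_permutation A f \<in> {p. p permutes A} \<rightarrow> {p. p permutes B}"
    using map_permutation_permutes[OF assms] by auto
  show "map_permutation B (inv_into A f) \<in> {p. p permutes B} \<rightarrow> {p. p permutes A}"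
    using map_permutation_permutes[OF inv] by auto
  show "map_permutation B (inv_into A f) (map_permutation A f p) = p" if "p \<in> {p. p permutes A}" for p
    using that assms by (intro map_permutation_compose_inv[OF assms]) (auto simp: bij_betw_inv_into_left)
  show "map_permutation A f (map_permutation B (inv_into A f) p) = p" if "p \<in> {p. p permutes B}" for p
    using that assms by (intro map_permutation_compose_inv[OF inv]) (auto simp: bij_betw_inv_into_right)
qed

lemma det_principal_submatrix:
  fixes A :: "'a :: comm_ring_1 mat"
  assumes A: "A \<in> carrier_mat d d" and S: "S \<subseteq> {0..<d}"
  shows "det (submatrix A S S) = (\<Sum>p | p permutes S. signof p * (\<Prod>i\<in>S. A $$ (i, p i)))"
proof -
  let ?m = "card S"
  have fin: "finite S" using S by (rule finite_subset) simp
  have S': "{i. i < d \<and> i \<in> S} = S" using S by auto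
  note bij = bij_betw_pick[OF fin]
  have B: "submatrix A S S \<in> carrier_mat ?m ?m" by (rule carrier_matI)
      (simp_all add: dim_submatrix carrier_matD[OF A] S')
  have "det (submatrix A S S)
      = (\<Sum>p | p permutes {0..<?m}. signof p * (\<Prod>i=0..<?m. submatrix A S S $$ (i, p i)))"
    by (rule det_def'[OF B])
  also have "\<dots> = (\<Sum>p | p permutes {0..<?m}. signof (map_permutation {0..<?m} (pick S) p) *
      (\<Prod>i\<in>S. A $$ (i, map_permutation {0..<?m} (pick S) p i)))"
  proof (rule sum.cong[OF HOL.refl], clarify)
    fix p assume p: "p permutes {0..<?m}"
    have "(\<Prod>i\<in>S. A $$ (i, map_permutation {0..<?m} (pick S) p i))
        = (\<Prod>i=0..<?m. A $$ (pick S i, map_permutation {0..<?m} (pick S) p (pick S i)))"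
      by (rule prod.reindex_bij_betw[OF bij, symmetric])
    also have "\<dots> = (\<Prod>i=0..<?m. submatrix A S S $$ (i, p i))"
    proof (rule prod.cong[OF HOL.refl])
      fix i assume i: "i \<in> {0..<?m}"
      moreover have "p i \<in> {0..<?m}" using p i permutes_in_image by metis
      ultimately show "A $$ (pick S i, map_permutation {0..<?m} (pick S) p (pick S i))
          = submatrix A S S $$ (i, p i)"
        using A S' bij map_permutation_apply[of "pick S" "{0..<?m}" i p]
        by (simp add: submatrix_index bij_betw_def)
    qed
    finally show "signof p * (\<Prod>i=0..<?m. submatrix A S S $$ (i, p i))
        = signof (map_permutation {0..<?m} (pick S) p) *
          (\<Prod>i\<in>S. A $$ (i, map_permutation {0..<?m} (pick S) p i))"
      using sign_map_permutation[of "pick S" "{0..<?m}" p] p bij by (simp add: bij_betw_def)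
  qed
  also have "\<dots> = (\<Sum>p | p permutes S. signof p * (\<Prod>i\<in>S. A $$ (i, p i)))"
    by (rule sum.reindex_bij_betw[OF bij_betw_map_permutation[OF bij]])
  finally show ?thesis .
qed

lemma mat_trace_exterior_power:
  assumes A: "A \<in> carrier_mat d d"
  shows "mat_trace (exterior_power n A) = (\<Sum>S | S \<subseteq> {0..<d} \<and> card S = n. det (submatrix A S S))"
proof -
  let ?L = "map set (filter (\<lambda>s. length s = n) (subseqs [0..<d]))"
  have dist: "distinct ?L"
    by (rule distinct_map_filter) (simp add: distinct_set_subseqs)
  have len: "length s = card (set s)" if "s \<in> set (subseqs [0..<d])" for s
    using subseqs_distinctD[OF that] by (simp add: distinct_card)
  have "S \<in> set ?L \<longleftrightarrow> S \<subseteq> {0..<d} \<and> card S = n" for S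
  proof -
    have "S \<in> set ?L \<longleftrightarrow> S \<in> set ` set (subseqs [0..<d]) \<and> card S = n"
      using len by auto
    then show ?thesis by (simp add: subseqs_powset)
  qed
  then have set: "set ?L = {S. S \<subseteq> {0..<d} \<and> card S = n}" by blast
  have "mat_trace (exterior_power n A) = (\<Sum>i<length ?L. det (submatrix A (?L ! i) (?L ! i)))"
    using A unfolding mat_trace_def exterior_power_def Let_def by simp
  also have "\<dots> = (\<Sum>S\<leftarrow>?L. det (submatrix A S S))"
    by (simp add: sum_list_sum_nth atLeast0LessThan)
  also have "\<dots> = (\<Sum>S\<in>set ?L. det (submatrix A S S))"
    by (rule sum_list_distinct_conv_sum_set[OF dist])
  finally show ?thesis unfolding set .
qed

text \<open>The Leibniz formula for \<open>det (1 + t A)\<close>: expanding the product over \<open>i\<close>, the choice of the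
  entries of the identity matrix outside \<open>S\<close> forces the permutation to fix the complement of \<open>S\<close>.\<close>

lemma det_one_plus_smult:
  fixes A :: "complex mat"
  assumes A: "A \<in> carrier_mat d d"
  shows "det (1\<^sub>m d + t \<cdot>\<^sub>m A) = (\<Sum>n\<le>d. mat_trace (exterior_power n A) * t ^ n)"
proof -
  let ?D = "{0..<d}"
  have "det (1\<^sub>m d + t \<cdot>\<^sub>m A)
      = (\<Sum>p | p permutes ?D. signof p * (\<Prod>i\<in>?D. (1\<^sub>m d + t \<cdot>\<^sub>m A) $$ (i, p i)))"
    by (rule det_def') (use A in auto)
  also have "\<dots> = (\<Sum>p | p permutes ?D. \<Sum>S\<in>Pow ?D. signof p *
      ((\<Prod>i\<in>S. t * A $$ (i, p i)) * (\<Prod>i\<in>?D - S. if p i = i then 1 else 0)))"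
  proof (rule sum.cong[OF HOL.refl], clarify)
    fix p assume p: "p permutes ?D"
    have "(\<Prod>i\<in>?D. (1\<^sub>m d + t \<cdot>\<^sub>m A) $$ (i, p i))
        = (\<Prod>i\<in>?D. t * A $$ (i, p i) + (if p i = i then 1 else 0))"
    proof (rule prod.cong[OF HOL.refl])
      fix i assume i: "i \<in> ?D"
      moreover have "p i \<in> ?D" using p i permutes_in_image by metis
      ultimately show "(1\<^sub>m d + t \<cdot>\<^sub>m A) $$ (i, p i) = t * A $$ (i, p i) + (if p i = i then 1 else 0)"
        using A by auto
    qed
    then show "signof p * (\<Prod>i\<in>?D. (1\<^sub>m d + t \<cdot>\<^sub>m A) $$ (i, p i))
      = (\<Sum>S\<in>Pow ?D. signof p *
          ((\<Prod>i\<in>S. t * A $$ (i, p i)) * (\<Prod>i\<in>?D - S. if p i = i then 1 else 0)))"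
      by (simp add: prod_add sum_distrib_left)
  qed
  also have "\<dots> = (\<Sum>S\<in>Pow ?D. \<Sum>p | p permutes ?D. signof p *
      ((\<Prod>i\<in>S. t * A $$ (i, p i)) * (\<Prod>i\<in>?D - S. if p i = i then 1 else 0)))"
    by (rule sum.swap)
  also have "\<dots> = (\<Sum>S\<in>Pow ?D. t ^ card S * det (submatrix A S S))"
  proof (rule sum.cong[OF HOL.refl])
    fix S assume "S \<in> Pow ?D"
    then have S: "S \<subseteq> ?D" by simp
    have "(\<Sum>p | p permutes ?D. signof p *
        ((\<Prod>i\<in>S. t * A $$ (i, p i)) * (\<Prod>i\<in>?D - S. if p i = i then 1 else 0)))
      = (\<Sum>p | p permutes S. signof p *
        ((\<Prod>i\<in>S. t * A $$ (i, p i)) * (\<Prod>i\<in>?D - S. if p i = i then 1 else 0)))"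
    proof (rule sum.mono_neutral_right)
      show "finite {p. p permutes ?D}" by (simp add: finite_permutations)
      show "{p. p permutes S} \<subseteq> {p. p permutes ?D}" using S permutes_subset by blast
      show "\<forall>p\<in>{p. p permutes ?D} - {p. p permutes S}. signof p *
        ((\<Prod>i\<in>S. t * A $$ (i, p i)) * (\<Prod>i\<in>?D - S. if p i = i then 1 else 0)) = 0"
      proof
        fix p assume "p \<in> {p. p permutes ?D} - {p. p permutes S}"
        then have "p permutes ?D" "\<not> p permutes S" by auto
        then obtain i where "i \<in> ?D - S" "p i \<noteq> i"
          using permutes_superset by blast
        then have "(\<Prod>i\<in>?D - S. if p i = i then 1 else 0) = (0::complex)"
          by (intro prod_zero) auto
        then show "signof p * ((\<Prod>i\<in>S. t * A $$ (i, p i)) *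
            (\<Prod>i\<in>?D - S. if p i = i then 1 else 0)) = 0" by simp
      qed
    qed
    also have "\<dots> = (\<Sum>p | p permutes S. t ^ card S * (signof p * (\<Prod>i\<in>S. A $$ (i, p i))))"
    proof (rule sum.cong[OF HOL.refl], clarify)
      fix p assume p: "p permutes S"
      have "(\<Prod>i\<in>?D - S. if p i = i then 1 else 0) = (1::complex)"
        using p by (intro prod.neutral) (auto simp: permutes_not_in)
      then show "signof p * ((\<Prod>i\<in>S. t * A $$ (i, p i)) * (\<Prod>i\<in>?D - S. if p i = i then 1 else 0))
          = t ^ card S * (signof p * (\<Prod>i\<in>S. A $$ (i, p i)))"
        by (simp add: prod.distrib mult_ac)
    qed
    finally show "(\<Sum>p | p permutes ?D. signof p *
        ((\<Prod>i\<in>S. t * A $$ (i, p i)) * (\<Prod>i\<in>?D - S. if p i = i then 1 else 0)))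
      = t ^ card S * det (submatrix A S S)"
      by (simp add: det_principal_submatrix[OF A S] sum_distrib_left)
  qed
  also have "\<dots> = (\<Sum>n\<le>d. \<Sum>S | S \<in> Pow ?D \<and> card S = n. t ^ card S * det (submatrix A S S))"
    by (rule sum.group[symmetric]) (auto simp: card_mono[of ?D, simplified])
  also have "\<dots> = (\<Sum>n\<le>d. mat_trace (exterior_power n A) * t ^ n)"
    by (rule sum.cong) (auto simp: mat_trace_exterior_power[OF A] sum_distrib_left mult_ac intro!: sum.cong)
  finally show ?thesis .
qed

lemma mat_trace_exterior_power_eq_0:
  assumes A: "A \<in> carrier_mat d d" and n: "n > d"
  shows "mat_trace (exterior_power n A) = 0"
proof -
  have none: "\<not> (S \<subseteq> {0..<d} \<and> card S = n)" for S
    using card_mono[of "{0..<d}" S] n by auto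
  then show ?thesis by (simp only: mat_trace_exterior_power[OF A] none) simp
qed

section \<open>Traces and eigenvalues\<close>

lemma mat_trace_mult_commute:
  assumes "A \<in> carrier_mat n m" "B \<in> carrier_mat m n"
  shows "mat_trace (A * B) = mat_trace (B * A)"
proof -
  have "mat_trace (A * B) = (\<Sum>i<n. \<Sum>j<m. A $$ (i, j) * B $$ (j, i))"
    using assms by (simp add: mat_trace_def scalar_prod_def atLeast0LessThan)
  also have "\<dots> = (\<Sum>j<m. \<Sum>i<n. B $$ (j, i) * A $$ (i, j))"
    by (subst sum.swap) (simp add: mult.commute)
  also have "\<dots> = mat_trace (B * A)"
    using assms by (simp add: mat_trace_def scalar_prod_def atLeast0LessThan)
  finally show ?thesis .
qed

lemma mat_trace_one: "mat_trace (1\<^sub>m n) = of_nat n"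
  by (simp add: mat_trace_def)

lemma diag_mult_upper_triangular:
  fixes A B :: "'a :: semiring_0 mat"
  assumes A: "A \<in> carrier_mat n n" "upper_triangular A" and B: "B \<in> carrier_mat n n" "upper_triangular B"
    and i: "i < n"
  shows "(A * B) $$ (i, i) = A $$ (i, i) * B $$ (i, i)"
proof -
  have "(A * B) $$ (i, i) = (\<Sum>k=0..<n. A $$ (i, k) * B $$ (k, i))"
    using A B i by (simp add: scalar_prod_def)
  also have "\<dots> = (\<Sum>k=0..<n. if k = i then A $$ (i, i) * B $$ (i, i) else 0)"
  proof (rule sum.cong[OF HOL.refl])
    fix k assume k: "k \<in> {0..<n}"
    show "A $$ (i, k) * B $$ (k, i) = (if k = i then A $$ (i, i) * B $$ (i, i) else 0)"
      using k i A B upper_triangularD[of A k i] upper_triangularD[of B i k]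
      by (cases "k < i"; cases "k = i") auto
  qed
  finally show ?thesis using i by simp
qed

lemma upper_triangular_mult:
  fixes A B :: "'a :: semiring_0 mat"
  assumes A: "A \<in> carrier_mat n n" "upper_triangular A" and B: "B \<in> carrier_mat n n" "upper_triangular B"
  shows "upper_triangular (A * B)"
proof
  fix i j assume ij: "j < i" "i < dim_row (A * B)"
  have "(A * B) $$ (i, j) = (\<Sum>k=0..<n. A $$ (i, k) * B $$ (k, j))"
    using A B ij by (simp add: scalar_prod_def)
  also have "\<dots> = 0"
  proof (rule sum.neutral, clarify)
    fix k assume k: "k \<in> {0..<n}"
    show "A $$ (i, k) * B $$ (k, j) = 0"
      using k ij A B upper_triangularD[of A k i] upper_triangularD[of B j k]
      by (cases "k < i") auto
  qed
  finally show "(A * B) $$ (i, j) = 0" .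
qed

lemma upper_triangular_pow:
  fixes A :: "'a :: semiring_1 mat"
  assumes A: "A \<in> carrier_mat n n" "upper_triangular A"
  shows "upper_triangular (A ^\<^sub>m k) \<and> (\<forall>i<n. (A ^\<^sub>m k) $$ (i, i) = (A $$ (i, i)) ^ k)"
proof (induction k)
  case 0
  then show ?case using A by simp
next
  case (Suc k)
  have Ak: "A ^\<^sub>m k \<in> carrier_mat n n" using A by simp
  show ?case
    using upper_triangular_mult[OF Ak _ A] diag_mult_upper_triangular[OF Ak _ A] Suc
    by (simp add: power_commutes)
qed

lemma mat_eigenvalue_list:
  fixes A :: "complex mat"
  assumes A: "A \<in> carrier_mat n n"
  shows "\<exists>es. (\<forall>e\<in>set es. eigenvalue A e) \<and> (\<forall>k. mat_trace (A ^\<^sub>m k) = (\<Sum>e\<leftarrow>es. e ^ k)) \<and>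
    (\<forall>t. det (1\<^sub>m n + t \<cdot>\<^sub>m A) = (\<Prod>e\<leftarrow>es. 1 + t * e))"
proof -
  obtain es where es: "char_poly A = (\<Prod>a\<leftarrow>es. [:- a, 1:])" "length es = n"
    using char_poly_factorized[OF A] by blast
  obtain T P Q where TPQ: "schur_decomposition A es = (T, P, Q)" by (cases "schur_decomposition A es")
  have sim: "similar_mat_wit A T P Q" and T: "upper_triangular T" and diag: "diag_mat T = es"
    using schur_decomposition[OF A es(1) TPQ] by auto
  note w = similar_mat_witD2[OF A sim]
  have eig: "eigenvalue A e" if "e \<in> set es" for e
    using that by (simp add: eigenvalue_root_char_poly[OF A] es(1) poly_prod_list prod_list_zero_iff)
  have sum_es: "(\<Sum>e\<leftarrow>es. f e) = (\<Sum>i<n. f (T $$ (i, i)))" for f :: "complex \<Rightarrow> complex"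
    unfolding diag[symmetric] diag_mat_def using w by (simp add: sum_list_sum_nth atLeast0LessThan)
  have tr: "mat_trace (A ^\<^sub>m k) = (\<Sum>e\<leftarrow>es. e ^ k)" for k
  proof -
    have Ak: "A ^\<^sub>m k \<in> carrier_mat n n" and Tk: "T ^\<^sub>m k \<in> carrier_mat n n"
      using pow_carrier_mat[OF A] pow_carrier_mat[OF w(5)] by auto
    note wk = similar_mat_witD2[OF Ak similar_mat_wit_pow[OF sim]]
    have "mat_trace (A ^\<^sub>m k) = mat_trace (P * (T ^\<^sub>m k * Q))"
      using wk(3) w Tk by (simp add: assoc_mult_mat[of _ n n _ n _ n])
    also have "\<dots> = mat_trace (T ^\<^sub>m k * Q * P)"
      using w Tk by (intro mat_trace_mult_commute) auto
    also have "\<dots> = mat_trace (T ^\<^sub>m k)"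
      using w Tk by (simp add: assoc_mult_mat[of _ n n _ n _ n])
    also have "\<dots> = (\<Sum>i<n. (T $$ (i, i)) ^ k)"
      using upper_triangular_pow[OF w(5) T, of k] w by (simp add: mat_trace_def)
    finally show ?thesis by (simp add: sum_es)
  qed
  have "det (1\<^sub>m n + t \<cdot>\<^sub>m A) = (\<Prod>e\<leftarrow>es. 1 + t * e)" for t
  proof -
    let ?B = "1\<^sub>m n + t \<cdot>\<^sub>m T"
    have B: "?B \<in> carrier_mat n n" using w by simp
    have "P * ?B = P + t \<cdot>\<^sub>m (P * T)"
      using w(5,6) mult_add_distrib_mat[of P n n "1\<^sub>m n" n "t \<cdot>\<^sub>m T"]
      by (simp add: mult_smult_distrib[of P n n T n])
    then have "P * ?B * Q = P * Q + t \<cdot>\<^sub>m (P * T * Q)"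
      using w(5-7) add_mult_distrib_mat[of P n n "t \<cdot>\<^sub>m (P * T)" Q n]
      by (simp add: mult_smult_assoc_mat[of "P * T" n n Q n])
    then have "1\<^sub>m n + t \<cdot>\<^sub>m A = P * ?B * Q" using w by simp
    moreover have "P * ?B \<in> carrier_mat n n" using w(6) B by simp
    ultimately have "det (1\<^sub>m n + t \<cdot>\<^sub>m A) = det P * det ?B * det Q"
      using det_mult[of "P * ?B" n Q] det_mult[OF w(6) B] w(7) by metis
    moreover have "det P * det Q = 1" using det_mult[OF w(6,7)] w(1) by simp
    ultimately have "det (1\<^sub>m n + t \<cdot>\<^sub>m A) = det ?B" by (simp add: algebra_simps)
    also have "\<dots> = prod_list (diag_mat ?B)"
      by (rule det_upper_triangular[OF _ B]) (use w T in \<open>auto intro!: upper_triangularI dest: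
          upper_triangularD\<close>)
    also have "diag_mat ?B = map (\<lambda>e. 1 + t * e) es"
      unfolding diag[symmetric] diag_mat_def using w by simp
    finally show ?thesis .
  qed
  with eig tr show ?thesis by (intro exI[of _ es]) simp
qed

lemma mat_trace_idempotent:
  fixes A :: "complex mat"
  assumes A: "A \<in> carrier_mat n n" and idem: "A * A = A"
  shows "mat_trace A \<in> \<nat>"
proof -
  from mat_eigenvalue_list[OF A] obtain es where eig: "\<forall>e\<in>set es. eigenvalue A e"
    and tr: "\<forall>k. mat_trace (A ^\<^sub>m k) = (\<Sum>e\<leftarrow>es. e ^ k)"
    by auto
  have "e \<in> \<nat>" if e: "e \<in> set es" for e
  proof -
    obtain v where v: "v \<in> carrier_vec n" "v \<noteq> 0\<^sub>v n" "A *\<^sub>v v = e \<cdot>\<^sub>v v"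
      using eig e A by (auto simp: eigenvalue_def eigenvector_def)
    have "e \<cdot>\<^sub>v v = A *\<^sub>v (A *\<^sub>v v)"
      using v A idem assoc_mult_mat_vec[OF A A v(1)] by metis
    also have "\<dots> = (e * e) \<cdot>\<^sub>v v"
      using v A by (simp add: mult_mat_vec[OF A] smult_smult_assoc)
    finally have *: "e \<cdot>\<^sub>v v = (e * e) \<cdot>\<^sub>v v" .
    obtain i where i: "i < n" "v $ i \<noteq> 0"
      using v by (metis carrier_vecD eq_vecI index_zero_vec)
    have "e * v $ i = e * e * v $ i" using arg_cong[OF *, of "\<lambda>u. u $ i"] i v by simp
    then have "e = 0 \<or> e = 1" using i by auto
    then show ?thesis by auto
  qed
  then have "(\<Sum>e\<leftarrow>es. e) \<in> \<nat>" by (induction es) auto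
  moreover have "A ^\<^sub>m 1 = A" using A by simp
  ultimately show ?thesis using tr[rule_format, of 1] by simp
qed

section \<open>Newton's identities\<close>

lemma fps_deriv_eq_mult_unique:
  fixes F H :: "'a :: field_char_0 fps"
  assumes F: "fps_deriv F = F * P" and H: "fps_deriv H = H * P" and 0: "fps_nth F 0 = fps_nth H 0"
  shows "F = H"
proof (rule fps_ext)
  fix n
  show "fps_nth F n = fps_nth H n"
  proof (induction n rule: less_induct)
    case (less n)
    show ?case
    proof (cases n)
      case (Suc m)
      have "of_nat n * fps_nth F n = fps_nth (fps_deriv F) m" by (simp add: Suc)
      also have "\<dots> = (\<Sum>i=0..m. fps_nth F i * fps_nth P (m - i))" by (simp add: F fps_mult_nth)
      also have "\<dots> = (\<Sum>i=0..m. fps_nth H i * fps_nth P (m - i))"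
        by (rule sum.cong) (simp_all add: less Suc)
      also have "\<dots> = fps_nth (fps_deriv H) m" by (simp add: H fps_mult_nth)
      also have "\<dots> = of_nat n * fps_nth H n" by (simp add: Suc)
      finally show ?thesis by (simp add: Suc del: of_nat_Suc)
    qed (simp add: 0)
  qed
qed

text \<open>The generating function of the elementary symmetric functions with power sums \<open>p 1, p 2, \<dots>\<close>.\<close>

definition elementary_fps :: "(nat \<Rightarrow> complex) \<Rightarrow> complex fps" where
  "elementary_fps p = fps_exp 1 oo Abs_fps (\<lambda>k. if k = 0 then 0 else (-1) ^ (k - 1) * p k / of_nat k)"

lemma elementary_fps_0 [simp]: "fps_nth (elementary_fps p) 0 = 1"
  by (simp add: elementary_fps_def)

lemma fps_deriv_elementary_fps:
  "fps_deriv (elementary_fps p) = elementary_fps p * Abs_fps (\<lambda>k. (-1) ^ k * p (Suc k))"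
proof -
  let ?q = "Abs_fps (\<lambda>k. if k = 0 then 0 else (-1) ^ (k - 1) * p k / of_nat k)"
  have "fps_deriv ?q = Abs_fps (\<lambda>k. (-1) ^ k * p (Suc k))"
    by (simp add: fps_eq_iff add.commute[of 1] del: of_nat_Suc)
  then show ?thesis
    unfolding elementary_fps_def by (subst fps_compose_deriv) simp_all
qed

lemma elementary_fps_1: "fps_nth (elementary_fps p) 1 = p 1"
  using arg_cong[OF fps_deriv_elementary_fps[of p], of "\<lambda>F. fps_nth F 0"] by simp

lemma elementary_fps_2: "fps_nth (elementary_fps p) 2 = (p 1 * p 1 - p 2) / 2"
  using arg_cong[OF fps_deriv_elementary_fps[of p], of "\<lambda>F. fps_nth F 1"] elementary_fps_1[of p]
  by (simp add: fps_mult_nth numeral_2_eq_2 mult.commute[of _ 2])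

lemma elementary_fps_unique:
  assumes "fps_nth F 0 = 1" "fps_deriv F = F * Abs_fps (\<lambda>k. (-1) ^ k * p (Suc k))"
  shows "elementary_fps p = F"
  by (rule fps_deriv_eq_mult_unique[OF fps_deriv_elementary_fps assms(2)]) (simp add: assms(1))

lemma elementary_fps_add:
  "elementary_fps (\<lambda>k. p k + q k) = elementary_fps p * elementary_fps q"
proof (rule elementary_fps_unique)
  have "Abs_fps (\<lambda>k. (-1) ^ k * (p (Suc k) + q (Suc k)))
      = Abs_fps (\<lambda>k. (-1) ^ k * p (Suc k)) + Abs_fps (\<lambda>k. (-1) ^ k * q (Suc k))"
    by (simp add: fps_eq_iff algebra_simps)
  then show "fps_deriv (elementary_fps p * elementary_fps q)
      = elementary_fps p * elementary_fps q * Abs_fps (\<lambda>k. (-1) ^ k * (p (Suc k) + q (Suc k)))"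
    by (simp add: fps_deriv_elementary_fps algebra_simps)
qed simp

lemma elementary_fps_zero: "elementary_fps (\<lambda>k. 0) = 1"
  by (rule elementary_fps_unique) (simp_all add: fps_eq_iff)

lemma elementary_fps_power: "elementary_fps (\<lambda>k. e ^ k) = 1 + fps_const e * fps_X"
proof (rule elementary_fps_unique)
  let ?P = "Abs_fps (\<lambda>k. (-1) ^ k * e ^ Suc k)"
  have "(1 + fps_const e * fps_X) * ?P = fps_const e"
  proof (rule fps_ext)
    fix n show "fps_nth ((1 + fps_const e * fps_X) * ?P) n = fps_nth (fps_const e) n"
      by (cases n) (simp_all add: distrib_right mult.assoc)
  qed
  then show "fps_deriv (1 + fps_const e * fps_X) = (1 + fps_const e * fps_X) * ?P" by simp
qed simp

lemma elementary_fps_power_sum: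
  "elementary_fps (\<lambda>k. \<Sum>e\<leftarrow>es. e ^ k) = (\<Prod>e\<leftarrow>es. 1 + fps_const e * fps_X)"
  by (induction es) (simp_all add: elementary_fps_zero elementary_fps_add elementary_fps_power)

lemma elementary_fps_mat_trace:
  assumes A: "A \<in> carrier_mat d d"
  shows "fps_nth (elementary_fps (\<lambda>k. mat_trace (A ^\<^sub>m k))) n = mat_trace (exterior_power n A)"
proof -
  from mat_eigenvalue_list[OF A] obtain es
    where tr: "\<forall>k. mat_trace (A ^\<^sub>m k) = (\<Sum>e\<leftarrow>es. e ^ k)"
      and det: "\<forall>t. det (1\<^sub>m d + t \<cdot>\<^sub>m A) = (\<Prod>e\<leftarrow>es. 1 + t * e)"
    by auto
  let ?p = "\<Prod>e\<leftarrow>es. [:1, e:]" and ?q = "\<Sum>n\<le>d. monom (mat_trace (exterior_power n A)) n"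
  have lin: "fps_of_poly [:1, e:] = 1 + fps_const e * fps_X" for e :: complex
    by (simp add: fps_of_poly_pCons)
  have p: "fps_of_poly ?p = (\<Prod>e\<leftarrow>es. 1 + fps_const e * fps_X)"
    by (induction es) (simp_all only: list.map prod_list.Nil prod_list.Cons fps_of_poly_mult
        fps_of_poly_1 lin)
  have "poly ?p t = poly ?q t" for t
  proof -
    have "poly ?p t = (\<Prod>e\<leftarrow>es. 1 + t * e)"
      by (induction es) (simp_all add: algebra_simps)
    also have "\<dots> = poly ?q t"
      using det det_one_plus_smult[OF A, of t] by (simp add: poly_sum poly_monom)
    finally show ?thesis .
  qed
  then have "?p = ?q" by (simp add: poly_eq_poly_eq_iff[symmetric] fun_eq_iff)
  then have "fps_nth (elementary_fps (\<lambda>k. mat_trace (A ^\<^sub>m k))) n = coeff ?q n"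
    by (simp add: tr elementary_fps_power_sum flip: p)
  also have "\<dots> = mat_trace (exterior_power n A)"
    using mat_trace_exterior_power_eq_0[OF A, of n] by (auto simp: coeff_sum)
  finally show ?thesis .
qed

section \<open>Representations and characters\<close>

definition lambda_fps :: "('g, 'm) monoid_scheme \<Rightarrow> ('g \<Rightarrow> complex) \<Rightarrow> 'g \<Rightarrow> complex fps" where
  "lambda_fps G f g = elementary_fps (\<lambda>k. f (g [^]\<^bsub>G\<^esub> k))"

lemma representation_mat:
  assumes "representation G n \<rho>" "g \<in> carrier G"
  shows "\<rho> g \<in> carrier_mat n n"
  using assms unfolding representation_def hom_def
  by (auto simp: units_of_def ring_mat_def Units_def)

lemma representation_mult:
  assumes "representation G n \<rho>" "g \<in> carrier G" "h \<in> carrier G"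
  shows "\<rho> (g \<otimes>\<^bsub>G\<^esub> h) = \<rho> g * \<rho> h"
  using assms unfolding representation_def hom_def by (auto simp: units_of_def ring_mat_def)

lemma representationI:
  assumes G: "group G"
    and carr: "\<And>g. g \<in> carrier G \<Longrightarrow> \<rho> g \<in> carrier_mat n n"
    and mult: "\<And>g h. g \<in> carrier G \<Longrightarrow> h \<in> carrier G \<Longrightarrow> \<rho> (g \<otimes>\<^bsub>G\<^esub> h) = \<rho> g * \<rho> h"
    and one: "\<rho> \<one>\<^bsub>G\<^esub> = 1\<^sub>m n"
  shows "representation G n \<rho>"
proof -
  interpret group G by (rule G)
  have "\<rho> g * \<rho> (inv\<^bsub>G\<^esub> g) = 1\<^sub>m n" "\<rho> (inv\<^bsub>G\<^esub> g) * \<rho> g = 1\<^sub>m n" if "g \<in> carrier G" for g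
    using that mult[of g "inv\<^bsub>G\<^esub> g"] mult[of "inv\<^bsub>G\<^esub> g" g] one by simp_all
  then have "\<rho> g \<in> Units (ring_mat TYPE(complex) n ())" if "g \<in> carrier G" for g
    using that carr[of g] carr[of "inv\<^bsub>G\<^esub> g"] unfolding Units_def by (auto simp: ring_mat_def)
  then show ?thesis
    unfolding representation_def hom_def by (auto simp: units_of_def ring_mat_def mult)
qed

lemma representation_one:
  assumes G: "group G" and \<rho>: "representation G n \<rho>"
  shows "\<rho> \<one>\<^bsub>G\<^esub> = 1\<^sub>m n"
proof -
  interpret group G by (rule G)
  interpret R: ring "ring_mat TYPE(complex) n ()" by (rule ring_mat)
  have "\<rho> \<in> hom G (units_of (ring_mat TYPE(complex) n ()))" using \<rho> by (simp add: representation_def)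
  then interpret group_hom G "units_of (ring_mat TYPE(complex) n ())" \<rho>
    by (intro group_hom.intro group_hom_axioms.intro is_group R.units_group)
  show ?thesis using hom_one by (simp add: units_of_def ring_mat_def)
qed

lemma representation_pow:
  assumes G: "group G" and \<rho>: "representation G n \<rho>" and g: "g \<in> carrier G"
  shows "\<rho> (g [^]\<^bsub>G\<^esub> (k::nat)) = \<rho> g ^\<^sub>m k"
proof -
  interpret group G by (rule G)
  note carr = representation_mat[OF \<rho> g]
  show ?thesis
  proof (induction k)
    case 0
    then show ?case using representation_one[OF G \<rho>] carr by simp
  next
    case (Suc k)
    then show ?case using representation_mult[OF \<rho> _ g, of "g [^]\<^bsub>G\<^esub> k"] g by simp
  qed
qed

lemma lambda_fps_character:
  assumes G: "group G" and \<rho>: "representation G d \<rho>" and g: "g \<in> carrier G"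
  shows "fps_nth (lambda_fps G (character G \<rho>) g) n = mat_trace (exterior_power n (\<rho> g))"
proof -
  interpret group G by (rule G)
  have "character G \<rho> (g [^]\<^bsub>G\<^esub> k) = mat_trace (\<rho> g ^\<^sub>m k)" for k :: nat
    using g representation_pow[OF G \<rho> g, of k] by (simp add: character_def)
  then show ?thesis
    by (simp add: lambda_fps_def elementary_fps_mat_trace[OF representation_mat[OF \<rho> g]])
qed

lemma mat_trace_1: "A \<in> carrier_mat 1 1 \<Longrightarrow> mat_trace A = A $$ (0, 0)"
  by (simp add: mat_trace_def)

lemma character_mult_1:
  assumes "representation G 1 \<rho>" "g \<in> carrier G" "h \<in> carrier G" "group G"
  shows "character G \<rho> (g \<otimes>\<^bsub>G\<^esub> h) = character G \<rho> g * character G \<rho> h"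
proof -
  interpret group G by fact
  note carr = representation_mat[OF assms(1)]
  have "mat_trace (\<rho> g * \<rho> h) = \<rho> g $$ (0, 0) * \<rho> h $$ (0, 0)"
    using carr[OF assms(2)] carr[OF assms(3)] by (subst mat_trace_1) (auto simp: scalar_prod_def)
  then show ?thesis using assms carr
    by (simp add: character_def representation_mult[OF assms(1)] mat_trace_1)
qed

lemma character_one:
  assumes "group G" "representation G n \<rho>"
  shows "character G \<rho> \<one>\<^bsub>G\<^esub> = of_nat n"
proof -
  interpret group G by fact
  show ?thesis using representation_one[OF assms] by (simp add: character_def mat_trace_one)
qed

lemma subspace_vec_iff:
  "VectorSpace.subspace class_ring W (module_vec TYPE('a :: field) n) \<longleftrightarrow>
     W \<subseteq> carrier_vec n \<and> 0\<^sub>v n \<in> W \<and> (\<forall>v\<in>W. \<forall>w\<in>W. v + w \<in> W) \<and> (\<forall>c. \<forall>v\<in>W. c \<cdot>\<^sub>v v \<in> W)"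
  unfolding VectorSpace.subspace_def LinearCombinations.submodule_def
  using vec_vs[of n, where ?'a = 'a] vec_module[of n, where ?'a = 'a]
  by (auto simp: module_vec_simps)

lemma irreducible_rep_1:
  assumes "representation G 1 \<rho>"
  shows "irreducible_rep G 1 \<rho>"
proof -
  have "W = {0\<^sub>v 1} \<or> W = carrier_vec 1"
    if W: "VectorSpace.subspace class_ring W (module_vec TYPE(complex) 1)" for W
  proof -
    have sub: "W \<subseteq> carrier_vec 1" "0\<^sub>v 1 \<in> W" "\<And>c v. v \<in> W \<Longrightarrow> c \<cdot>\<^sub>v v \<in> W"
      using W unfolding subspace_vec_iff by auto
    show ?thesis
    proof (cases "W = {0\<^sub>v 1}")
      case False
      then obtain w where w: "w \<in> W" "w \<noteq> 0\<^sub>v 1" using sub by auto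
      then have w0: "w $ 0 \<noteq> 0" using sub(1) by (auto simp: vec_eq_iff subset_eq)
      have "v \<in> W" if v: "v \<in> carrier_vec 1" for v
      proof -
        have "v = (v $ 0 / w $ 0) \<cdot>\<^sub>v w" using v w sub w0 by (auto simp: vec_eq_iff)
        then show ?thesis using sub(3)[OF w(1)] by metis
      qed
      then show ?thesis using sub by auto
    qed simp
  qed
  then show ?thesis using assms by (simp add: irreducible_rep_def)
qed

section \<open>The quaternion group\<close>

lemma word_class_eq_iff: "word_class R u = word_class R v \<longleftrightarrow> presentation_eq R u v"
  unfolding word_class_def using presentation_eq.refl presentation_eq.sym presentation_eq.trans
  by (metis mem_Collect_eq Collect_cong)

lemma presentation_eq_append:
  assumes "presentation_eq R u u'" "presentation_eq R v v'"
  shows "presentation_eq R (u @ v) (u' @ v')"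
  using presentation_eq.cong[OF assms(1), of "[]" v] presentation_eq.cong[OF assms(2), of u' "[]"]
    presentation_eq.trans by fastforce

lemma presented_group_mult:
  "word_class R u \<otimes>\<^bsub>presented_group R\<^esub> word_class R v = word_class R (u @ v)"
proof -
  have "word_class R (u' @ v') = word_class R (u @ v)" if "u' \<in> word_class R u" "v' \<in> word_class R v"
      for u' v'
    using that presentation_eq_append presentation_eq.sym unfolding word_class_eq_iff
    unfolding word_class_def by blast
  then have "(\<Union>u'\<in>word_class R u. \<Union>v'\<in>word_class R v. word_class R (u' @ v'))
      = (\<Union>u'\<in>word_class R u. \<Union>v'\<in>word_class R v. word_class R (u @ v))"
    by (intro SUP_cong HOL.refl)
  moreover have "u \<in> word_class R u" "v \<in> word_class R v"
    by (simp_all add: word_class_def presentation_eq.refl)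
  then have "word_class R u \<noteq> {}" "word_class R v \<noteq> {}" by blast+
  ultimately show ?thesis by (simp add: presented_group_def)
qed

lemma presentation_eq_inverse_word:
  "presentation_eq R (rev (map (\<lambda>(s, e). (s, \<not> e)) u) @ u) []"
proof (induction u)
  case Nil
  then show ?case by (simp add: presentation_eq.refl)
next
  case (Cons a u)
  obtain s e where a: "a = (s, e)" by (cases a)
  let ?r = "rev (map (\<lambda>(s, e). (s, \<not> e)) u)"
  have "presentation_eq R [(s, \<not> e), (s, \<not> \<not> e)] []" by (rule presentation_eq.cancel)
  then have "presentation_eq R (?r @ [(s, \<not> e), (s, e)] @ u) (?r @ [] @ u)"
    by (intro presentation_eq.cong) simp
  then show ?case using Cons presentation_eq.trans a by fastforce
qed

lemma group_presented_group: "group (presented_group R)"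
proof (rule groupI)
  show "\<one>\<^bsub>presented_group R\<^esub> \<in> carrier (presented_group R)" by (simp add: presented_group_def)
next
  fix x y assume "x \<in> carrier (presented_group R)" "y \<in> carrier (presented_group R)"
  then obtain u v where uv: "x = word_class R u" "y = word_class R v" by (auto simp: presented_group_def)
  show "x \<otimes>\<^bsub>presented_group R\<^esub> y \<in> carrier (presented_group R)"
    unfolding uv presented_group_mult by (simp add: presented_group_def)
next
  fix x y w
  assume "x \<in> carrier (presented_group R)" "y \<in> carrier (presented_group R)" "w
      \<in> carrier (presented_group R)"
  then obtain u v t where uv: "x = word_class R u" "y = word_class R v" "w = word_class R t"
    by (auto simp: presented_group_def)
  show "x \<otimes>\<^bsub>presented_group R\<^esub> y \<otimes>\<^bsub>presented_group R\<^esub> w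
      = x \<otimes>\<^bsub>presented_group R\<^esub> (y \<otimes>\<^bsub>presented_group R\<^esub> w)"
    unfolding uv presented_group_mult by simp
next
  fix x assume "x \<in> carrier (presented_group R)"
  then obtain u where u: "x = word_class R u" by (auto simp: presented_group_def)
  have one: "\<one>\<^bsub>presented_group R\<^esub> = word_class R []" by (simp add: presented_group_def)
  show "\<one>\<^bsub>presented_group R\<^esub> \<otimes>\<^bsub>presented_group R\<^esub> x = x"
    unfolding one u presented_group_mult by simp
  show "\<exists>y\<in>carrier (presented_group R). y \<otimes>\<^bsub>presented_group R\<^esub> x = \<one>\<^bsub>presented_group R\<^esub>"
  proof
    let ?y = "word_class R (rev (map (\<lambda>(s, e). (s, \<not> e)) u))"
    show "?y \<otimes>\<^bsub>presented_group R\<^esub> x = \<one>\<^bsub>presented_group R\<^esub>"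
      unfolding one u presented_group_mult word_class_eq_iff by (rule presentation_eq_inverse_word)
    show "?y \<in> carrier (presented_group R)" by (simp add: presented_group_def)
  qed
qed

lemma carrier_presented_group:
  "carrier (presented_group R) = generate (presented_group R) (range (\<lambda>s. word_class R [(s, True)]))"
proof -
  interpret group "presented_group R" by (rule group_presented_group)
  let ?H = "range (\<lambda>s. word_class R [(s, True)])"
  have sub: "?H \<subseteq> carrier (presented_group R)" by (auto simp: presented_group_def)
  have letter: "word_class R [(s, e)] \<in> generate (presented_group R) ?H" for s e
  proof (cases e)
    case False
    have c: "word_class R [(s, b)] \<in> carrier (presented_group R)" for b
      by (simp add: presented_group_def)
    have "word_class R [(s, False)] \<otimes>\<^bsub>presented_group R\<^esub> word_class R [(s, True)] = \<one>\<^bsub>presented_group R\<^esub>"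
      unfolding presented_group_mult
      using presentation_eq.cancel[of R s False] by (simp add: presented_group_def word_class_eq_iff)
    then have "word_class R [(s, e)] = inv\<^bsub>presented_group R\<^esub> word_class R [(s, True)]"
      using False inv_equality c by metis
    then show ?thesis by (auto intro: generate.inv)
  qed (auto intro: generate.incl)
  have "word_class R u \<in> generate (presented_group R) ?H" for u
  proof (induction u)
    case Nil
    then show ?case using generate.one[of "presented_group R" ?H] by (simp add: presented_group_def)
  next
    case (Cons a u)
    have "word_class R (a # u) = word_class R [a] \<otimes>\<^bsub>presented_group R\<^esub> word_class R u"
      by (simp add: presented_group_mult)
    then show ?case using generate.eng[OF letter Cons] by (metis prod.exhaust)
  qed
  then have "carrier (presented_group R) \<subseteq> generate (presented_group R) ?H"
    by (auto simp: presented_group_def)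
  then show ?thesis using generate_incl[OF sub] by blast
qed

locale quaternion_group = group G for G (structure) +
  fixes i j k
  assumes generators: "i \<in> carrier G" "j \<in> carrier G" "k \<in> carrier G"
    and generated: "carrier G = generate G {i, j, k}"
    and relations: "i \<otimes> i = j \<otimes> j" "j \<otimes> j = k \<otimes> k" "k \<otimes> k = i \<otimes> j \<otimes> k"
begin

definition z where "z = i \<otimes> i"

lemma z_carrier [simp]: "z \<in> carrier G"
  by (simp add: z_def generators)

declare generators [simp]

lemma ij: "i \<otimes> j = k"
  using relations(3) by (metis generators m_closed right_cancel)

lemma jk: "j \<otimes> k = i"
  using relations by (metis generators m_closed m_assoc Units_l_cancel Units_eq)

lemma ii: "i \<otimes> i = z" and jj: "j \<otimes> j = z" and kk: "k \<otimes> k = z"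
  using relations by (simp_all add: z_def)

lemma z_i: "i \<otimes> z = z \<otimes> i" and z_j: "j \<otimes> z = z \<otimes> j" and z_k: "k \<otimes> z = z \<otimes> k"
  by (metis ii m_assoc generators, metis jj m_assoc generators, metis kk m_assoc generators)

lemma ki: "k \<otimes> i = j"
proof -
  have "k \<otimes> i \<otimes> j = z" by (simp add: m_assoc ij kk)
  then show ?thesis using jj by (metis generators m_closed right_cancel)
qed

lemma ji: "j \<otimes> i = z \<otimes> k" and kj: "k \<otimes> j = z \<otimes> i" and ik: "i \<otimes> k = z \<otimes> j"
  by (metis jk jj m_assoc generators, metis ki kk m_assoc generators, metis ij ii m_assoc generators)

lemma zz: "z \<otimes> z = \<one>"
proof -
  have "z = i \<otimes> (j \<otimes> i) \<otimes> j" using kk ij by (metis m_assoc generators m_closed)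
  also have "\<dots> = (i \<otimes> z) \<otimes> (k \<otimes> j)" by (simp add: ji m_assoc)
  also have "\<dots> = z \<otimes> (i \<otimes> (z \<otimes> i))" by (simp add: z_i kj m_assoc)
  also have "\<dots> = z \<otimes> (z \<otimes> z)"
    using z_i ii by (metis generators m_assoc z_carrier)
  finally have "z \<otimes> (z \<otimes> z) = z \<otimes> \<one>" by simp
  then show ?thesis by (metis Units_l_cancel Units_eq m_closed one_closed z_carrier)
qed

lemma z_left: "x \<in> carrier G \<Longrightarrow> z \<otimes> (z \<otimes> x) = x"
  by (metis zz m_assoc z_carrier l_one)

lemma z_commute: "g \<in> {i, j, k} \<Longrightarrow> x \<in> carrier G \<Longrightarrow> g \<otimes> (z \<otimes> x) = z \<otimes> (g \<otimes> x)"
  using z_i z_j z_k by (metis insertE empty_iff m_assoc generators z_carrier)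

lemma inverses: "inv i = z \<otimes> i" "inv j = z \<otimes> j" "inv k = z \<otimes> k"
proof -
  show "inv i = z \<otimes> i" by (rule inv_equality) (simp_all add: m_assoc ii zz)
  show "inv j = z \<otimes> j" by (rule inv_equality) (simp_all add: m_assoc jj zz)
  show "inv k = z \<otimes> k" by (rule inv_equality) (simp_all add: m_assoc kk zz)
qed

lemma carrier_eq: "carrier G = {\<one>, z, i, z \<otimes> i, j, z \<otimes> j, k, z \<otimes> k}" (is "_ = ?S")
proof -
  have S: "?S \<subseteq> carrier G" by simp
  have step: "g \<otimes> s \<in> ?S" "z \<otimes> s \<in> ?S" if "g \<in> {i, j, k}" "s \<in> ?S" for g s
    using that by (elim insertE emptyE; simp add: ii jj kk ij jk ki ji kj ik z_i z_j z_k z_commute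
        z_left zz)+
  have "g \<otimes> s \<in> ?S" if "g \<in> generate G {i, j, k}" "s \<in> ?S" for g s
    using that
  proof (induction arbitrary: s rule: generate.induct)
    case one
    then show ?case using S by auto
  next
    case (incl h)
    then show ?case using step(1) by blast
  next
    case (inv h)
    have "inv h = z \<otimes> h" using inv inverses by auto
    moreover have "h \<in> carrier G" "s \<in> carrier G" using inv S by auto
    ultimately have "inv h \<otimes> s = z \<otimes> (h \<otimes> s)" by (simp add: m_assoc)
    then show ?case using step(2)[OF inv(1) step(1)[OF inv]] by simp
  next
    case (eng h1 h2)
    have c: "h1 \<in> carrier G" "h2 \<in> carrier G" using eng generated by auto
    have "s \<in> carrier G" using eng.prems S by blast
    with c have "h1 \<otimes> h2 \<otimes> s = h1 \<otimes> (h2 \<otimes> s)" by (rule m_assoc)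
    then show ?case using eng.IH(1)[OF eng.IH(2)[OF eng.prems]] by simp
  qed
  from this[of _ \<one>] have "carrier G \<subseteq> ?S" using generated by auto
  with S show ?thesis by blast
qed

end

lemma quaternion_group_Q8: "quaternion_group Q8 (Q8_gen Gen_i) (Q8_gen Gen_j) (Q8_gen Gen_k)"
proof -
  interpret group Q8 unfolding Q8_def by (rule group_presented_group)
  have "UNIV = {Gen_i, Gen_j, Gen_k}" using quaternion_gen.exhaust by blast
  then have "range Q8_gen = Q8_gen ` {Gen_i, Gen_j, Gen_k}" by (rule arg_cong)
  then have range: "range Q8_gen = {Q8_gen Gen_i, Q8_gen Gen_j, Q8_gen Gen_k}" by simp
  have rel: "word_class Q8_relations u = word_class Q8_relations v" if "(u, v) \<in> Q8_relations" for u v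
    using presentation_eq.relation[OF that] by (simp add: word_class_eq_iff)
  let ?i = "(Gen_i, True)" and ?j = "(Gen_j, True)" and ?k = "(Gen_k, True)"
  have "([?i, ?i], [?j, ?j]) \<in> Q8_relations" "([?j, ?j], [?k, ?k]) \<in> Q8_relations"
    "([?k, ?k], [?i, ?j, ?k]) \<in> Q8_relations"
    by (simp_all add: Q8_relations_def Let_def)
  note this[THEN rel]
  then show ?thesis
  proof unfold_locales
    show "carrier Q8 = generate Q8 {Q8_gen Gen_i, Q8_gen Gen_j, Q8_gen Gen_k}"
      using carrier_presented_group[of Q8_relations] unfolding range[symmetric]
      by (simp add: Q8_def Q8_gen_def[abs_def])
    show "Q8_gen Gen_i \<in> carrier Q8" "Q8_gen Gen_j \<in> carrier Q8" "Q8_gen Gen_k \<in> carrier Q8"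
      by (simp_all add: Q8_def Q8_gen_def presented_group_def)
  qed (simp_all add: Q8_def Q8_gen_def presented_group_mult)
qed

section \<open>Linear constituents of a representation\<close>

lemma isotypic_projection:
  fixes G (structure)
  assumes G: "group G" and fin: "finite (carrier G)" and \<rho>: "representation G n \<rho>"
    and \<chi>: "\<And>g h. g \<in> carrier G \<Longrightarrow> h \<in> carrier G \<Longrightarrow> \<chi> (g \<otimes> h) = \<chi> g * \<chi> h" "\<chi> \<one> = (1 :: complex)"
  shows "\<exists>P \<in> carrier_mat n n. P * P = P \<and> (\<forall>h\<in>carrier G. \<rho> h * P = \<chi> h \<cdot>\<^sub>m P) \<and>
    mat_trace P = (\<Sum>g\<in>carrier G. \<chi> (inv g) * character G \<rho> g) / of_nat (card (carrier G))"
proof -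
  interpret group G by (rule G)
  define N where "N = (of_nat (card (carrier G)) :: complex)"
  have N: "N \<noteq> 0" unfolding N_def using fin by (auto simp: card_eq_0_iff)
  define P where "P = mat n n (\<lambda>(a, b). (\<Sum>g\<in>carrier G. \<chi> (inv g) * \<rho> g $$ (a, b)) / N)"
  have P: "P \<in> carrier_mat n n" by (simp add: P_def)
  note carr = representation_mat[OF \<rho>]
  have mult: "\<rho> h * P = \<chi> h \<cdot>\<^sub>m P" if h: "h \<in> carrier G" for h
  proof (rule eq_matI)
    fix a b assume "a < dim_row (\<chi> h \<cdot>\<^sub>m P)" "b < dim_col (\<chi> h \<cdot>\<^sub>m P)"
    then have ab: "a < n" "b < n" using P by auto
    have "(\<rho> h * P) $$ (a, b) = (\<Sum>c<n. \<rho> h $$ (a, c) * P $$ (c, b))"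
      using ab P carr[OF h] by (simp add: scalar_prod_def atLeast0LessThan)
    also have "\<dots> = (\<Sum>c<n. \<Sum>g\<in>carrier G. \<chi> (inv g) * (\<rho> h $$ (a, c) * \<rho> g $$ (c, b)) / N)"
      using ab by (simp add: P_def sum_distrib_left sum_divide_distrib mult_ac)
    also have "\<dots> = (\<Sum>g\<in>carrier G. \<Sum>c<n. \<chi> (inv g) * (\<rho> h $$ (a, c) * \<rho> g $$ (c, b)) / N)"
      by (rule sum.swap)
    also have "\<dots> = (\<Sum>g\<in>carrier G. \<chi> h * \<chi> (inv (h \<otimes> g)) * \<rho> (h \<otimes> g) $$ (a, b) / N)"
    proof (rule sum.cong[OF HOL.refl])
      fix g assume g: "g \<in> carrier G"
      have "\<chi> h * \<chi> (inv (h \<otimes> g)) = \<chi> (inv (h \<otimes> g) \<otimes> h)" using g h \<chi> by simp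
      also have "inv (h \<otimes> g) \<otimes> h = inv g"
        using g h by (simp add: inv_mult_group m_assoc)
      finally have "\<chi> h * \<chi> (inv (h \<otimes> g)) = \<chi> (inv g)" .
      moreover have "\<rho> (h \<otimes> g) $$ (a, b) = (\<Sum>c<n. \<rho> h $$ (a, c) * \<rho> g $$ (c, b))"
        using ab carr[OF h] carr[OF g]
        by (simp add: representation_mult[OF \<rho> h g] scalar_prod_def atLeast0LessThan)
      ultimately show "(\<Sum>c<n. \<chi> (inv g) * (\<rho> h $$ (a, c) * \<rho> g $$ (c, b)) / N)
          = \<chi> h * \<chi> (inv (h \<otimes> g)) * \<rho> (h \<otimes> g) $$ (a, b) / N"
        by (simp add: sum_distrib_left sum_divide_distrib)
    qed
    also have "\<dots> = (\<Sum>g\<in>carrier G. \<chi> h * \<chi> (inv g) * \<rho> g $$ (a, b) / N)"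
      by (rule sum.reindex_bij_betw[where h = "\<lambda>g. h \<otimes> g"])
         (rule bij_betwI[where g = "\<lambda>g. inv h \<otimes> g"], use h in \<open>auto simp: m_assoc[symmetric]\<close>)
    also have "\<dots> = (\<chi> h \<cdot>\<^sub>m P) $$ (a, b)"
      using ab by (simp add: P_def sum_distrib_left sum_divide_distrib mult_ac)
    finally show "(\<rho> h * P) $$ (a, b) = (\<chi> h \<cdot>\<^sub>m P) $$ (a, b)" .
  qed (use P carr[OF h] in auto)
  have "P * P = P"
  proof (rule eq_matI)
    fix a b assume "a < dim_row P" "b < dim_col P"
    then have ab: "a < n" "b < n" using P by auto
    have "(P * P) $$ (a, b) = (\<Sum>c<n. P $$ (a, c) * P $$ (c, b))"
      using ab P by (simp add: scalar_prod_def atLeast0LessThan)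
    also have "\<dots> = (\<Sum>c<n. (\<Sum>g\<in>carrier G. \<chi> (inv g) * \<rho> g $$ (a, c)) / N * P $$ (c, b))"
      using ab by (intro sum.cong) (simp_all add: P_def)
    also have "\<dots> = (\<Sum>c<n. \<Sum>g\<in>carrier G. \<chi> (inv g) * (\<rho> g $$ (a, c) * P $$ (c, b)) / N)"
      by (simp add: sum_distrib_left sum_distrib_right sum_divide_distrib mult_ac)
    also have "\<dots> = (\<Sum>g\<in>carrier G. \<Sum>c<n. \<chi> (inv g) * (\<rho> g $$ (a, c) * P $$ (c, b)) / N)"
      by (rule sum.swap)
    also have "\<dots> = (\<Sum>g\<in>carrier G. P $$ (a, b) / N)"
    proof (rule sum.cong[OF HOL.refl])
      fix g assume g: "g \<in> carrier G"
      have "(\<Sum>c<n. \<rho> g $$ (a, c) * P $$ (c, b)) = (\<rho> g * P) $$ (a, b)"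
        using ab P carr[OF g] by (simp add: scalar_prod_def atLeast0LessThan)
      also have "\<dots> = \<chi> g * P $$ (a, b)" using ab P by (simp add: mult[OF g])
      finally have "(\<Sum>c<n. \<rho> g $$ (a, c) * P $$ (c, b)) = \<chi> g * P $$ (a, b)" .
      moreover have "\<chi> (inv g) * \<chi> g = 1" using g \<chi>(1)[of "inv g" g] \<chi>(2) by simp
      ultimately show "(\<Sum>c<n. \<chi> (inv g) * (\<rho> g $$ (a, c) * P $$ (c, b)) / N) = P $$ (a, b) / N"
        by (simp flip: sum_divide_distrib sum_distrib_left)
    qed
    also have "\<dots> = P $$ (a, b)" using N by (simp add: N_def)
    finally show "(P * P) $$ (a, b) = P $$ (a, b)" .
  qed (use P in auto)
  moreover have "mat_trace P = (\<Sum>g\<in>carrier G. \<chi> (inv g) * character G \<rho> g) / N"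
  proof -
    have "mat_trace P = (\<Sum>a<n. \<Sum>g\<in>carrier G. \<chi> (inv g) * \<rho> g $$ (a, a) / N)"
      by (simp add: mat_trace_def P_def sum_divide_distrib)
    also have "\<dots> = (\<Sum>g\<in>carrier G. \<Sum>a<n. \<chi> (inv g) * \<rho> g $$ (a, a) / N)" by (rule sum.swap)
    also have "\<dots> = (\<Sum>g\<in>carrier G. \<chi> (inv g) * character G \<rho> g / N)"
    proof (rule sum.cong[OF HOL.refl])
      fix g assume g: "g \<in> carrier G"
      show "(\<Sum>a<n. \<chi> (inv g) * \<rho> g $$ (a, a) / N) = \<chi> (inv g) * character G \<rho> g / N"
        using g carr[OF g] by (simp add: character_def mat_trace_def sum_distrib_left sum_divide_distrib)
    qed
    finally show ?thesis by (simp add: sum_divide_distrib)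
  qed
  ultimately show ?thesis using P mult by (auto simp: N_def)
qed

lemma linear_multiplicity:
  fixes G (structure)
  assumes G: "group G" and fin: "finite (carrier G)" and \<rho>: "representation G n \<rho>"
    and \<chi>: "\<And>g h. g \<in> carrier G \<Longrightarrow> h \<in> carrier G \<Longrightarrow> \<chi> (g \<otimes> h) = \<chi> g * \<chi> h" "\<chi> \<one> = (1 :: complex)"
  defines "m \<equiv> (\<Sum>g\<in>carrier G. \<chi> (inv g) * character G \<rho> g) / of_nat (card (carrier G))"
  shows "m \<in> \<nat>"
    and "m \<noteq> 0 \<Longrightarrow> \<exists>v\<in>carrier_vec n. v \<noteq> 0\<^sub>v n \<and> (\<forall>h\<in>carrier G. \<rho> h *\<^sub>v v = \<chi> h \<cdot>\<^sub>v v)"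
proof -
  obtain P where P: "P \<in> carrier_mat n n" "P * P = P" "mat_trace P = m"
    and mult: "\<And>h. h \<in> carrier G \<Longrightarrow> \<rho> h * P = \<chi> h \<cdot>\<^sub>m P"
    using isotypic_projection[OF G fin \<rho>, of \<chi>] \<chi> unfolding m_def by auto
  show "m \<in> \<nat>" using mat_trace_idempotent[OF P(1,2)] P(3) by simp
  assume "m \<noteq> 0"
  have "\<exists>a<n. P $$ (a, a) \<noteq> 0"
  proof (rule ccontr)
    assume "\<not> ?thesis"
    then have "mat_trace P = 0" using P(1) by (simp add: mat_trace_def)
    with P(3) \<open>m \<noteq> 0\<close> show False by simp
  qed
  then obtain a where a: "a < n" "P $$ (a, a) \<noteq> 0" by blast
  have "\<rho> h *\<^sub>v col P a = \<chi> h \<cdot>\<^sub>v col P a" if h: "h \<in> carrier G" for h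
  proof -
    have "\<rho> h *\<^sub>v col P a = col (\<rho> h * P) a"
      using a(1) P(1) representation_mat[OF \<rho> h] by (simp add: col_mult2 mult_mat_vec_def)
    also have "\<dots> = \<chi> h \<cdot>\<^sub>v col P a"
      using a(1) P(1) by (simp add: mult[OF h])
    finally show ?thesis .
  qed
  moreover have "col P a \<noteq> 0\<^sub>v n"
  proof
    assume "col P a = 0\<^sub>v n"
    then have "col P a $ a = 0" using a by simp
    then show False using a P(1) by simp
  qed
  moreover have "col P a \<in> carrier_vec n" using a(1) P(1) by simp 
  ultimately show "\<exists>v\<in>carrier_vec n. v \<noteq> 0\<^sub>v n \<and> (\<forall>h\<in>carrier G. \<rho> h *\<^sub>v v = \<chi> h \<cdot>\<^sub>v v)" by blast
qed

lemma dim_le_2_if_spanned: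
  assumes v: "v \<in> carrier_vec n" and u: "u \<in> carrier_vec n"
    and span: "\<And>x. x \<in> carrier_vec n \<Longrightarrow> \<exists>a b. x = a \<cdot>\<^sub>v v + b \<cdot>\<^sub>v (u :: 'a :: field vec)"
  shows "n \<le> card {v, u}"
proof -
  interpret vec_space "TYPE('a)" n .
  have sub: "{v, u} \<subseteq> carrier_vec n" using v u by simp
  have "carrier_vec n \<subseteq> span {v, u}"
  proof
    fix x :: "'a vec" assume "x \<in> carrier_vec n"
    then obtain a b where x: "x = a \<cdot>\<^sub>v v + b \<cdot>\<^sub>v u" using span by blast
    have "v \<in> span {v, u}" "u \<in> span {v, u}" using span_mem[OF sub] by auto
    moreover have "VectorSpace.subspace class_ring (span {v, u}) V" by (rule span_is_subspace)
        (use sub in simp)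
    ultimately show "x \<in> span {v, u}" unfolding x subspace_vec_iff by blast
  qed
  then have "gen_set {v, u}" using span_is_subset2[of "{v, u}"] sub by auto
  then have "dim \<le> card {v, u}" using sub by (intro gen_ge_dim) auto
  then show ?thesis by (simp add: dim_is_n)
qed

lemma irreducible_linear:
  assumes irr: "irreducible_rep G n \<rho>" and v: "v \<in> carrier_vec n" "v \<noteq> 0\<^sub>v n"
    and eig: "\<And>h. h \<in> carrier G \<Longrightarrow> \<rho> h *\<^sub>v v = \<chi> h \<cdot>\<^sub>v v"
  shows "character G \<rho> = (\<lambda>g\<in>carrier G. \<chi> g)"
proof -
  have \<rho>: "representation G n \<rho>" and n: "n > 0" using irr by (auto simp: irreducible_rep_def)
  note carr = representation_mat[OF \<rho>]
  let ?W = "range (\<lambda>c. c \<cdot>\<^sub>v v)"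
  have W: "x \<in> ?W \<longleftrightarrow> (\<exists>c. x = c \<cdot>\<^sub>v v)" for x by auto
  have "VectorSpace.subspace class_ring ?W (module_vec TYPE(complex) n)"
    unfolding subspace_vec_iff
  proof (intro conjI ballI allI)
    show "?W \<subseteq> carrier_vec n" using v by auto
    show "0\<^sub>v n \<in> ?W" unfolding W using v by (intro exI[of _ 0]) auto
  next
    fix x y assume "x \<in> ?W" "y \<in> ?W"
    then obtain a b where "x = a \<cdot>\<^sub>v v" "y = b \<cdot>\<^sub>v v" by auto
    then have "x + y = (a + b) \<cdot>\<^sub>v v" by (simp add: add_smult_distrib_vec)
    then show "x + y \<in> ?W" by auto
  next
    fix c x assume "x \<in> ?W"
    then obtain a where "x = a \<cdot>\<^sub>v v" by auto
    then have "c \<cdot>\<^sub>v x = (c * a) \<cdot>\<^sub>v v" by (simp add: smult_smult_assoc)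
    then show "c \<cdot>\<^sub>v x \<in> ?W" by auto
  qed
  moreover have "\<rho> g *\<^sub>v w \<in> ?W" if "g \<in> carrier G" "w \<in> ?W" for g w
  proof -
    from that(2) obtain a where a: "w = a \<cdot>\<^sub>v v" by auto
    have "\<rho> g *\<^sub>v w = (a * \<chi> g) \<cdot>\<^sub>v v"
      using v eig[OF that(1)] by (simp add: a mult_mat_vec[OF carr[OF that(1)]] smult_smult_assoc)
    then show ?thesis by auto
  qed
  ultimately have "?W = {0\<^sub>v n} \<or> ?W = carrier_vec n"
    using irr unfolding irreducible_rep_def by blast
  moreover have "v \<in> ?W" unfolding W using v by (intro exI[of _ 1]) simp
  ultimately have all: "?W = carrier_vec n" using v by auto
  have "n \<le> card {v, v}"
  proof (rule dim_le_2_if_spanned[OF v(1) v(1)])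
    fix x :: "complex vec" assume "x \<in> carrier_vec n"
    then obtain a where "x = a \<cdot>\<^sub>v v" using all W by auto
    then have "x = a \<cdot>\<^sub>v v + 0 \<cdot>\<^sub>v v" using v by auto
    then show "\<exists>a b. x = a \<cdot>\<^sub>v v + b \<cdot>\<^sub>v v" by blast
  qed
  then have n1: "n = 1" using n by simp
  have v0: "v $ 0 \<noteq> 0" using v n1 by (auto simp: vec_eq_iff)
  show ?thesis
  proof
    fix g show "character G \<rho> g = (\<lambda>g\<in>carrier G. \<chi> g) g"
    proof (cases "g \<in> carrier G")
      case True
      have "(\<rho> g *\<^sub>v v) $ 0 = \<rho> g $$ (0, 0) * v $ 0"
        using carr[OF True] v n1 by (simp add: scalar_prod_def)
      then have "\<rho> g $$ (0, 0) = \<chi> g" using eig[OF True] v v0 n1 by simp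
      then show ?thesis using True carr[OF True] n1 by (simp add: character_def mat_trace_1)
    qed (simp add: character_def)
  qed
qed

lemma character_mult_commute:
  assumes G: "group G" and \<rho>: "representation G n \<rho>" and g: "g \<in> carrier G" "h \<in> carrier G"
  shows "character G \<rho> (g \<otimes>\<^bsub>G\<^esub> h) = character G \<rho> (h \<otimes>\<^bsub>G\<^esub> g)"
proof -
  interpret group G by (rule G)
  show ?thesis using g mat_trace_mult_commute[OF representation_mat[OF \<rho> g(1)] representation_mat[OF \<rho>
      g(2)]]
    by (simp add: character_def representation_mult[OF \<rho>])
qed

section \<open>The characters of the quaternion group\<close>

lemma representation_subset:
  assumes "representation G n \<rho>" "H \<subseteq> carrier G"
  shows "representation (G\<lparr>carrier := H\<rparr>) n \<rho>"
  using assms unfolding representation_def hom_def by (auto simp: subset_iff)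

locale quaternion_reps = quaternion_group +
  fixes \<rho>1 \<rho>2 \<Delta>
  assumes \<rho>1: "representation G 1 \<rho>1" "character G \<rho>1 i = 1" "character G \<rho>1 j = -1"
    and \<rho>2: "representation G 1 \<rho>2" "character G \<rho>2 i = -1" "character G \<rho>2 j = 1"
    and \<Delta>: "representation G 2 \<Delta>" "\<Delta> i = mat_of_rows_list 2 [[\<i>, 0], [0, -\<i>]]"
      "\<Delta> j = mat_of_rows_list 2 [[0, -1], [1, 0]]" "\<Delta> k = mat_of_rows_list 2 [[0, -\<i>], [-\<i>, 0]]"
begin

abbreviation char_carrier ("\<R>") where "\<R> \<equiv> carrier (char_ring G)"
abbreviation char_add (infixl "\<oplus>\<^sub>c" 65) where "x \<oplus>\<^sub>c y \<equiv> x \<oplus>\<^bsub>char_ring G\<^esub> y"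
abbreviation char_mult (infixl "\<otimes>\<^sub>c" 70) where "x \<otimes>\<^sub>c y \<equiv> x \<otimes>\<^bsub>char_ring G\<^esub> y"
abbreviation char_diff (infixl "\<ominus>\<^sub>c" 65) where "x \<ominus>\<^sub>c y \<equiv> x \<ominus>\<^bsub>char_ring G\<^esub> y"

definition a where "a g = character G \<rho>1 g - 1"
definition b where "b g = character G \<rho>2 g - 1"
definition w where "w g = 2 - character G \<Delta> g"

lemma character_coset:
  assumes "representation G n \<rho>"
  shows "character G \<rho> (z \<otimes> i) = character G \<rho> i" "character G \<rho> (z \<otimes> j) = character G \<rho> j"
    "character G \<rho> (z \<otimes> k) = character G \<rho> k"
  using character_mult_commute[OF is_group assms, of k j] character_mult_commute[OF is_group assms, of i k]
    character_mult_commute[OF is_group assms, of j i] by (simp_all add: kj jk ik ki ji ij)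

lemma \<rho>1_values:
  "character G \<rho>1 \<one> = 1" "character G \<rho>1 z = 1" "character G \<rho>1 k = -1"
  using character_one[OF is_group \<rho>1(1)] character_mult_1[OF \<rho>1(1) _ _ is_group, of i i]
    character_mult_1[OF \<rho>1(1) _ _ is_group, of i j] \<rho>1 by (simp_all add: ii ij)

lemma \<rho>2_values:
  "character G \<rho>2 \<one> = 1" "character G \<rho>2 z = 1" "character G \<rho>2 k = -1"
  using character_one[OF is_group \<rho>2(1)] character_mult_1[OF \<rho>2(1) _ _ is_group, of i i]
    character_mult_1[OF \<rho>2(1) _ _ is_group, of i j] \<rho>2 by (simp_all add: ii ij)

lemma \<Delta>_values:
  "character G \<Delta> \<one> = 2" "character G \<Delta> z = -2" "character G \<Delta> i = 0"
  "character G \<Delta> j = 0" "character G \<Delta> k = 0"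
proof -
  show "character G \<Delta> \<one> = 2" using character_one[OF is_group \<Delta>(1)] by simp
  have "character G \<Delta> z = mat_trace (\<Delta> i * \<Delta> i)"
    by (simp add: character_def flip: ii representation_mult[OF \<Delta>(1)])
  also have "\<dots> = -2"
    by (simp add: \<Delta>(2) mat_trace_def mat_of_rows_list_def scalar_prod_def numeral_2_eq_2)
  finally show "character G \<Delta> z = -2" .
qed (simp_all add: character_def \<Delta> mat_trace_def mat_of_rows_list_def numeral_2_eq_2)

lemma values_table:
  assumes "g \<in> carrier G"
  shows "(a g, b g, w g) \<in> {(0, 0, 0), (0, 0, 4), (0, -2, 2), (-2, 0, 2), (-2, -2, 2)}"
  using assms unfolding carrier_eq a_def b_def w_def
  by (elim insertE emptyE; hypsubst; simp only: \<rho>1_values \<rho>2_values \<Delta>_values \<rho>1 \<rho>2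
      character_coset[OF \<rho>1(1)] character_coset[OF \<rho>2(1)] character_coset[OF \<Delta>(1)]) simp_all

lemma values_at:
  "a \<one> = 0" "b \<one> = 0" "w \<one> = 0" "a z = 0" "b z = 0" "w z = 4"
  "a i = 0" "b i = -2" "w i = 2" "a j = -2" "b j = 0" "w j = 2" "a k = -2" "b k = -2" "w k = 2"
  by (simp_all add: a_def b_def w_def \<rho>1_values \<rho>2_values \<Delta>_values \<rho>1 \<rho>2)

lemma basis_relations:
  assumes "g \<in> carrier G"
  shows "a g * a g = - 2 * a g" "b g * b g = - 2 * b g" "w g * a g = 2 * a g" "w g * b g = 2 * b g"
    "w g * w g = 4 * w g + 2 * a g + 2 * b g + a g * b g"
  using values_table[OF assms] by auto

lemma distinct_elements: "distinct [\<one>, z, i, z \<otimes> i, j, z \<otimes> j, k, z \<otimes> k]"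
proof -
  have "x \<noteq> y" if "(character G \<rho>1 x, character G \<rho>2 x) \<noteq> (character G \<rho>1 y, character G \<rho>2 y)" for x y
    using that by auto
  note neq = this[unfolded prod.inject de_Morgan_conj]
  have "z \<noteq> \<one>" using \<Delta>_values(1,2) by auto
  then have "x \<noteq> z \<otimes> x" if "x \<in> carrier G" for x
    using that r_cancel_one'[of x z] by auto
  note this[of \<one>] this[of i] this[of j] this[of k]
  then show ?thesis
    by (simp add: neq \<rho>1_values \<rho>2_values \<rho>1 \<rho>2 character_coset[OF \<rho>1(1)] character_coset[OF \<rho>2(1)])
qed

lemma sum_carrier:
  "(\<Sum>g\<in>carrier G. f g) = f \<one> + f z + f i + f (z \<otimes> i) + f j + f (z \<otimes> j) + f k + (f (z \<otimes> k) :: complex)"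
proof -
  have "(\<Sum>g\<in>carrier G. f g) = (\<Sum>g\<in>set [\<one>, z, i, z \<otimes> i, j, z \<otimes> j, k, z \<otimes> k]. f g)"
    by (simp add: carrier_eq)
  also have "\<dots> = (\<Sum>g\<leftarrow>[\<one>, z, i, z \<otimes> i, j, z \<otimes> j, k, z \<otimes> k]. f g)"
    by (rule sum_list_distinct_conv_sum_set[OF distinct_elements, symmetric])
  finally show ?thesis by (simp add: add_ac)
qed

lemma card_carrier: "card (carrier G) = 8"
proof -
  have "carrier G = set [\<one>, z, i, z \<otimes> i, j, z \<otimes> j, k, z \<otimes> k]" by (simp add: carrier_eq)
  then show ?thesis using distinct_card[OF distinct_elements] by simp
qed

lemma finite_carrier: "finite (carrier G)"
  by (simp add: carrier_eq)

lemma inv_elements: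
  "inv \<one> = \<one>" "inv z = z" "inv (z \<otimes> i) = i" "inv (z \<otimes> j) = j" "inv (z \<otimes> k) = k"
proof -
  show "inv z = z" by (rule inv_equality) (simp_all add: zz)
  show "inv (z \<otimes> i) = i" "inv (z \<otimes> j) = j" "inv (z \<otimes> k) = k"
    by (rule inv_equality; simp add: zz z_commute ii jj kk)+
qed simp

lemma linear_char_sign:
  assumes \<chi>: "\<And>g h. g \<in> carrier G \<Longrightarrow> h \<in> carrier G \<Longrightarrow> \<chi> (g \<otimes> h) = \<chi> g * \<chi> h" "\<chi> \<one> = (1 :: complex)"
    and val: "\<chi> i = s" "\<chi> j = t" "s * s = 1" "t * t = 1"
    and \<rho>: "representation G n \<rho>"
  defines "f \<equiv> character G \<rho>"
  shows "(\<Sum>g\<in>carrier G. \<chi> (inv g) * f g) / of_nat (card (carrier G))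
    = (f \<one> + f z + 2 * (s * f i + t * f j + s * t * f k)) / 8"
proof -
  have z: "\<chi> z = 1" using \<chi>(1)[of i i] val by (simp add: ii)
  have k: "\<chi> k = s * t" using \<chi>(1)[of i j] val by (simp add: ij)
  note co = character_coset[OF \<rho>, folded f_def]
  show ?thesis unfolding card_carrier sum_carrier
    by (simp add: inv_elements inverses \<chi> z k val co field_simps)
qed

definition sign_char where
  "sign_char m n g = (1 + of_nat m * a g) * (1 + of_nat n * (b g :: complex))"

lemma sign_char_mult:
  assumes "m \<le> 1" "n \<le> 1" "g \<in> carrier G" "h \<in> carrier G"
  shows "sign_char m n (g \<otimes> h) = sign_char m n g * sign_char m n h"
proof -
  have "m = 0 \<or> m = 1" "n = 0 \<or> n = 1" using assms(1,2) by auto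
  then have "1 + of_nat m * a (g \<otimes> h) = (1 + of_nat m * a g) * (1 + of_nat m * a h)"
    and "1 + of_nat n * b (g \<otimes> h) = (1 + of_nat n * b g) * (1 + of_nat n * b h)"
    unfolding a_def b_def character_mult_1[OF \<rho>1(1) assms(3,4) is_group]
      character_mult_1[OF \<rho>2(1) assms(3,4) is_group]
    by (elim disjE; simp)+
  then show ?thesis by (simp only: sign_char_def mult_ac)
qed

lemma sign_char_values: "sign_char m n \<one> = 1" "sign_char m n i = 1 - 2 * of_nat n" "sign_char m n j
    = 1 - 2 * of_nat m"
  by (simp_all add: sign_char_def values_at)

text \<open>A faithful character of the cyclic group generated by \<open>i\<close>: among the irreducible characters
  only \<open>\<Delta>\<close> contains it, and only once, so it detects the multiplicity of \<open>\<Delta>\<close>.\<close>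

definition c4_char :: "'a \<Rightarrow> complex" where
  "c4_char g = (if g = \<one> then 1 else if g = z then -1 else if g = i then \<i> else -\<i>)"

lemma subgroup_c4: "subgroup {\<one>, z, i, z \<otimes> i} G"
  by (rule subgroupI) (auto simp: inverses inv_elements m_assoc zz ii z_i z_left z_commute)

lemma c4_multiplicity:
  assumes \<rho>: "representation G n \<rho>"
  shows "(character G \<rho> \<one> - character G \<rho> z) / 4 \<in> \<nat>"
    and "character G \<rho> \<one> \<noteq> character G \<rho> z \<Longrightarrow>
      \<exists>v\<in>carrier_vec n. v \<noteq> 0\<^sub>v n \<and> \<rho> i *\<^sub>v v = \<i> \<cdot>\<^sub>v v \<and> \<rho> z *\<^sub>v v = (-1) \<cdot>\<^sub>v v \<and> \<rho> (z \<otimes> i) *\<^sub>v v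
          = (-\<i>) \<cdot>\<^sub>v v"
proof -
  let ?C = "{\<one>, z, i, z \<otimes> i}"
  let ?H = "G\<lparr>carrier := ?C\<rparr>"
  have H: "group ?H" by (rule subgroup.subgroup_is_group[OF subgroup_c4 is_group])
  have \<rho>H: "representation ?H n \<rho>" by (rule representation_subset[OF \<rho>]) simp
  have inv: "inv\<^bsub>?H\<^esub> g = inv g" if "g \<in> ?C" for g
    by (rule m_inv_consistent[OF subgroup_c4 that])
  note dist = distinct_elements
  have val: "c4_char \<one> = 1" "c4_char z = -1" "c4_char i = \<i>" "c4_char (z \<otimes> i) = -\<i>"
    using dist by (auto simp: c4_char_def)
  have mult: "c4_char (g \<otimes>\<^bsub>?H\<^esub> h) = c4_char g * c4_char h" if "g \<in> carrier ?H" "h \<in> carrier ?H" for g h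
    using that by (auto simp: val m_assoc zz ii z_i z_left z_commute)
  have card: "card ?C = 4" using dist by simp
  let ?f = "character G \<rho>"
  have "(\<Sum>g\<in>carrier ?H. c4_char (inv\<^bsub>?H\<^esub> g) * character ?H \<rho> g) = (\<Sum>g\<in>?C. c4_char (inv g) * ?f g)"
    by (rule sum.cong) (auto simp: inv character_def)
  also have "\<dots> = ?f \<one> - ?f z"
    using dist by (simp add: val inv_elements inverses character_coset[OF \<rho>])
  finally have sum: "(\<Sum>g\<in>carrier ?H. c4_char (inv\<^bsub>?H\<^esub> g) * character ?H \<rho> g) / of_nat (card (carrier ?H))
      = (?f \<one> - ?f z) / 4" by (simp add: card)
  note lm = linear_multiplicity[OF H _ \<rho>H, of c4_char, unfolded sum]
  show "(?f \<one> - ?f z) / 4 \<in> \<nat>" by (rule lm(1)) (use mult val in auto)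
  assume ne: "?f \<one> \<noteq> ?f z"
  have "\<exists>v\<in>carrier_vec n. v \<noteq> 0\<^sub>v n \<and> (\<forall>h\<in>carrier ?H. \<rho> h *\<^sub>v v = c4_char h \<cdot>\<^sub>v v)"
    by (rule lm(2)) (use mult val ne in auto)
  then show "\<exists>v\<in>carrier_vec n. v \<noteq> 0\<^sub>v n \<and> \<rho> i *\<^sub>v v = \<i> \<cdot>\<^sub>v v \<and> \<rho> z *\<^sub>v v = (-1) \<cdot>\<^sub>v v
      \<and> \<rho> (z \<otimes> i) *\<^sub>v v = (-\<i>) \<cdot>\<^sub>v v"
    by (auto simp: val)
qed

end

section \<open>The ring of functions on a group\<close>

lemma function_ring_simps:
  "carrier (function_ring G) = extensional (carrier G)"
  "\<zero>\<^bsub>function_ring G\<^esub> = (\<lambda>g\<in>carrier G. 0)"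
  "\<one>\<^bsub>function_ring G\<^esub> = (\<lambda>g\<in>carrier G. 1)"
  "x \<oplus>\<^bsub>function_ring G\<^esub> y = (\<lambda>g\<in>carrier G. x g + y g)"
  "x \<otimes>\<^bsub>function_ring G\<^esub> y = (\<lambda>g\<in>carrier G. x g * y g)"
  by (simp_all add: function_ring_def)

lemma cring_function_ring: "cring (function_ring G)"
proof (intro cringI abelian_groupI comm_monoidI)
  fix x assume x: "x \<in> carrier (function_ring G)"
  show "\<exists>y\<in>carrier (function_ring G). y \<oplus>\<^bsub>function_ring G\<^esub> x = \<zero>\<^bsub>function_ring G\<^esub>"
    by (rule bexI[of _ "\<lambda>g\<in>carrier G. - x g"]) (auto simp: function_ring_simps)
  show "\<zero>\<^bsub>function_ring G\<^esub> \<oplus>\<^bsub>function_ring G\<^esub> x = x" "\<one>\<^bsub>function_ring G\<^esub> \<otimes>\<^bsub>function_ring G\<^esub> x = x"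
    using x by (auto simp: function_ring_simps extensional_def)
qed (auto simp: function_ring_simps algebra_simps cong: restrict_cong)

lemma char_ring_simps:
  "carrier (char_ring G) = generate (add_monoid (function_ring G)) (irr_characters G)"
  "\<zero>\<^bsub>char_ring G\<^esub> = (\<lambda>g\<in>carrier G. 0)"
  "\<one>\<^bsub>char_ring G\<^esub> = (\<lambda>g\<in>carrier G. 1)"
  "x \<oplus>\<^bsub>char_ring G\<^esub> y = (\<lambda>g\<in>carrier G. x g + y g)"
  "x \<otimes>\<^bsub>char_ring G\<^esub> y = (\<lambda>g\<in>carrier G. x g * y g)"
  by (simp_all add: char_ring_def function_ring_def)

lemma irr_characters_subset: "irr_characters G \<subseteq> carrier (function_ring G)"
  by (auto simp: irr_characters_def function_ring_simps character_def)

lemma additive_subgroup_char_ring: "additive_subgroup (carrier (char_ring G)) (function_ring G)"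
proof -
  interpret cring "function_ring G" by (rule cring_function_ring)
  show ?thesis unfolding char_ring_simps
    by (rule additive_subgroupI, rule add.generate_is_subgroup) (simp add: irr_characters_subset)
qed

lemma char_ring_uminus:
  assumes "x \<in> carrier (char_ring G)"
  shows "(\<lambda>g\<in>carrier G. - x g) \<in> carrier (char_ring G)"
proof -
  interpret cring "function_ring G" by (rule cring_function_ring)
  interpret S: additive_subgroup "carrier (char_ring G)" "function_ring G"
      by (rule additive_subgroup_char_ring)
  have "\<ominus>\<^bsub>function_ring G\<^esub> x = (\<lambda>g\<in>carrier G. - x g)"
    by (rule minus_equality) (use assms S.a_subset in \<open>auto simp: function_ring_simps\<close>)
  then show ?thesis using S.a_inv_closed[OF assms] by simp
qed

lemma char_ring_add:
  assumes "x \<in> carrier (char_ring G)" "y \<in> carrier (char_ring G)"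
  shows "(\<lambda>g\<in>carrier G. x g + y g) \<in> carrier (char_ring G)"
  using additive_subgroup.a_closed[OF additive_subgroup_char_ring assms] by (simp add: function_ring_simps)

lemma char_ring_zero: "(\<lambda>g\<in>carrier G. 0) \<in> carrier (char_ring G)"
  using additive_subgroup.zero_closed[OF additive_subgroup_char_ring] by (simp add: function_ring_simps)

lemma char_ring_extensional: "x \<in> carrier (char_ring G) \<Longrightarrow> x \<in> extensional (carrier G)"
  using additive_subgroup.a_subset[OF additive_subgroup_char_ring[of G]] by (auto simp: function_ring_simps)

lemma int_multiple_induct:
  fixes x :: "'g \<Rightarrow> complex"
  assumes x: "P x" and zero: "P (\<lambda>g\<in>carrier G. 0)"
    and add: "\<And>x y. P x \<Longrightarrow> P y \<Longrightarrow> P (\<lambda>g\<in>carrier G. x g + y g)"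
    and uminus: "\<And>x. P x \<Longrightarrow> P (\<lambda>g\<in>carrier G. - x g)"
  shows "P (\<lambda>g\<in>carrier G. of_int n * x g)"
proof -
  have nat: "P (\<lambda>g\<in>carrier G. of_nat n * x g)" for n
  proof (induction n)
    case 0
    show ?case using zero by (simp only: of_nat_0 mult_zero_left)
  next
    case (Suc n)
    have "(\<lambda>g\<in>carrier G. of_nat (Suc n) * x g)
        = (\<lambda>g\<in>carrier G. (\<lambda>g\<in>carrier G. of_nat n * x g) g + x g)"
      by (rule restrict_ext) (simp add: algebra_simps)
    then show ?case using add[OF Suc x] by (simp only:)
  qed
  show ?thesis
  proof (cases n)
    case (nonneg m)
    then show ?thesis using nat by (simp only: of_int_of_nat_eq)
  next
    case (neg m)
    have "(\<lambda>g\<in>carrier G. of_int n * x g)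
        = (\<lambda>g\<in>carrier G. - (\<lambda>g\<in>carrier G. of_nat (Suc m) * x g) g)"
      unfolding neg by (rule restrict_ext) (simp add: algebra_simps)
    then show ?thesis using uminus[OF nat[of "Suc m"]] by (simp only:)
  qed
qed

lemma char_ring_smult:
  assumes x: "x \<in> carrier (char_ring G)"
  shows "(\<lambda>g\<in>carrier G. of_int n * x g) \<in> carrier (char_ring G)"
  by (rule int_multiple_induct[of "\<lambda>x. x \<in> carrier (char_ring G)", OF x char_ring_zero])
    (rule char_ring_add char_ring_uminus; assumption)+

lemma irr_characters_char_ring: "irr_characters G \<subseteq> carrier (char_ring G)"
  by (auto simp: char_ring_simps intro: generate.incl)

lemma char_ring_induct [consumes 1, case_names zero irr uminus add]:
  assumes "x \<in> carrier (char_ring G)"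
    and "P (\<lambda>g\<in>carrier G. 0)"
    and irr: "\<And>x. x \<in> irr_characters G \<Longrightarrow> P x"
    and uminus: "\<And>x. x \<in> carrier (char_ring G) \<Longrightarrow> P x \<Longrightarrow> P (\<lambda>g\<in>carrier G. - x g)"
    and add: "\<And>x y. x \<in> carrier (char_ring G) \<Longrightarrow> y \<in> carrier (char_ring G) \<Longrightarrow> P x \<Longrightarrow> P y \<Longrightarrow>
      P (\<lambda>g\<in>carrier G. x g + y g)"
  shows "P x"
proof -
  interpret cring "function_ring G" by (rule cring_function_ring)
  have "x \<in> generate (add_monoid (function_ring G)) (irr_characters G)"
    using assms(1) by (simp add: char_ring_simps)
  then show ?thesis
  proof (induction rule: generate.induct)
    case one
    show ?case using assms(2) unfolding function_ring_simps(2)[symmetric] by simp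
  next
    case (incl h)
    then show ?case by (rule irr)
  next
    case (inv h)
    then have h: "h \<in> carrier (function_ring G)" "h \<in> carrier (char_ring G)"
      using irr_characters_subset irr_characters_char_ring by blast+
    have "inv\<^bsub>add_monoid (function_ring G)\<^esub> h = \<ominus>\<^bsub>function_ring G\<^esub> h" by (simp add: a_inv_def)
    also have "\<dots> = (\<lambda>g\<in>carrier G. - h g)"
      by (rule minus_equality) (use h in \<open>auto simp: function_ring_simps\<close>)
    finally show ?case using uminus[OF h(2) irr[OF inv]] by (simp only:)
  next
    case (eng h1 h2)
    then show ?case using add[of h1 h2] unfolding char_ring_simps(1) function_ring_simps(4)[symmetric]
        by simp
  qed
qed

context quaternion_reps
begin

definition ch :: "int \<Rightarrow> int \<Rightarrow> int \<Rightarrow> int \<Rightarrow> int \<Rightarrow> 'a \<Rightarrow> complex" where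
  "ch c0 c1 c2 c3 c4 = (\<lambda>g\<in>carrier G.
     of_int c0 + of_int c1 * a g + of_int c2 * b g + of_int c3 * (a g * b g) + of_int c4 * w g)"

lemma character_eqI:
  assumes \<rho>: "representation G n \<rho>"
    and "character G \<rho> \<one> = ch c0 c1 c2 c3 c4 \<one>" "character G \<rho> z = ch c0 c1 c2 c3 c4 z"
    and "character G \<rho> i = ch c0 c1 c2 c3 c4 i" "character G \<rho> j = ch c0 c1 c2 c3 c4 j"
    and "character G \<rho> k = ch c0 c1 c2 c3 c4 k"
  shows "character G \<rho> = ch c0 c1 c2 c3 c4"
proof
  fix g
  have co: "a (z \<otimes> x) = a x" "b (z \<otimes> x) = b x" "w (z \<otimes> x) = w x" if "x = i \<or> x = j \<or> x = k" for x
    using that character_coset[OF \<rho>1(1)] character_coset[OF \<rho>2(1)] character_coset[OF \<Delta>(1)]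
    unfolding a_def b_def w_def by metis+
  have "character G \<rho> g = ch c0 c1 c2 c3 c4 g" if "g \<in> carrier G"
    using that[unfolded carrier_eq] assms(2-)
    by (elim insertE emptyE) (simp_all add: character_coset[OF \<rho>] ch_def co)
  then show "character G \<rho> g = ch c0 c1 c2 c3 c4 g"
    by (cases "g \<in> carrier G") (simp_all add: character_def ch_def)
qed

lemma sign_multiplicity:
  assumes \<rho>: "representation G d \<rho>" and mn: "m \<le> 1" "n \<le> 1"
  defines "f \<equiv> character G \<rho>" and "s \<equiv> 1 - 2 * of_nat n" and "t \<equiv> 1 - 2 * of_nat m"
  defines "q \<equiv> (f \<one> + f z + 2 * (s * f i + t * f j + s * t * f k)) / 8"
  shows "q \<in> \<nat>"
    and "q \<noteq> 0 \<Longrightarrow> \<exists>v\<in>carrier_vec d. v \<noteq> 0\<^sub>v d \<and> (\<forall>h\<in>carrier G. \<rho> h *\<^sub>v v = sign_char m n h \<cdot>\<^sub>v v)"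
proof -
  have st: "s * s = 1" "t * t = 1" using mn unfolding s_def t_def by (cases m; cases n; simp)+
  note mult = sign_char_mult[OF mn]
  have eq: "(\<Sum>g\<in>carrier G. sign_char m n (inv g) * character G \<rho> g) / of_nat (card (carrier G)) = q"
    using linear_char_sign[of "sign_char m n" s t d \<rho>] mult sign_char_values[of m n] st \<rho>
    unfolding q_def f_def s_def t_def by simp
  note lm = linear_multiplicity[OF is_group finite_carrier \<rho>, of "sign_char m n", unfolded eq]
  show "q \<in> \<nat>" by (rule lm(1)) (use mult sign_char_values in auto)
  show "q \<noteq> 0 \<Longrightarrow> \<exists>v\<in>carrier_vec d. v \<noteq> 0\<^sub>v d \<and> (\<forall>h\<in>carrier G. \<rho> h *\<^sub>v v = sign_char m n h \<cdot>\<^sub>v v)"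
    by (rule lm(2)) (use mult sign_char_values in auto)
qed

lemma character_of_representation:
  assumes \<rho>: "representation G d \<rho>"
  shows "\<exists>c0 c1 c2 c3 c4. character G \<rho> = ch c0 c1 c2 c3 c4"
proof -
  let ?f = "character G \<rho>"
  note q = sign_multiplicity(1)[OF \<rho>]
  obtain p0 where p0: "(?f \<one> + ?f z + 2 * (?f i + ?f j + ?f k)) / 8 = of_nat p0"
    using q[of 0 0] by (auto elim!: Nats_cases)
  obtain p1 where p1: "(?f \<one> + ?f z + 2 * (?f i - ?f j - ?f k)) / 8 = of_nat p1"
    using q[of 1 0] by (auto elim!: Nats_cases)
  obtain p2 where p2: "(?f \<one> + ?f z + 2 * (- ?f i + ?f j - ?f k)) / 8 = of_nat p2"
    using q[of 0 1] by (auto elim!: Nats_cases)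
  obtain p3 where p3: "(?f \<one> + ?f z + 2 * (- ?f i - ?f j + ?f k)) / 8 = of_nat p3"
    using q[of 1 1] by (auto elim!: Nats_cases)
  obtain p4 where p4: "(?f \<one> - ?f z) / 4 = of_nat p4"
    using c4_multiplicity(1)[OF \<rho>] by (auto elim!: Nats_cases)
  have "?f = ch (int (p0 + p1 + p2 + p3 + 2 * p4)) (int (p1 + p3)) (int (p2 + p3)) (int p3) (- int p4)"
    by (rule character_eqI[OF \<rho>]) (simp_all add: ch_def values_at flip: p0 p1 p2 p3 p4, simp_all add:
        field_simps)
  then show ?thesis by blast
qed


lemma sign_char_ch:
  "(\<lambda>g\<in>carrier G. sign_char m n g) = ch 1 (int m) (int n) (int (m * n)) 0"
  unfolding ch_def by (rule restrict_ext) (simp add: sign_char_def algebra_simps)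

lemma sign_char_irr:
  assumes mn: "m \<le> 1" "n \<le> 1"
  shows "ch 1 (int m) (int n) (int (m * n)) 0 \<in> irr_characters G"
proof -
  let ?\<rho> = "\<lambda>g. mat 1 1 (\<lambda>_. sign_char m n g)"
  have rep: "representation G 1 ?\<rho>"
  proof (rule representationI[OF is_group])
    fix g h assume "g \<in> carrier G" "h \<in> carrier G"
    then show "?\<rho> (g \<otimes> h) = ?\<rho> g * ?\<rho> h"
      by (intro eq_matI) (auto simp: sign_char_mult[OF mn] scalar_prod_def)
  next
    show "?\<rho> \<one> = 1\<^sub>m 1" by (rule eq_matI) (auto simp: sign_char_values)
  qed auto
  have "character G ?\<rho> = (\<lambda>g\<in>carrier G. sign_char m n g)"
    unfolding character_def by (rule restrict_ext) (simp add: mat_trace_1)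
  then show ?thesis
    using irreducible_rep_1[OF rep] unfolding irr_characters_def sign_char_ch
        by (metis (mono_tags, lifting) mem_Collect_eq)
qed

lemma \<Delta>_ch: "character G \<Delta> = ch 2 0 0 0 (-1)"
  by (rule character_eqI[OF \<Delta>(1)]) (simp_all add: ch_def values_at \<Delta>_values)

lemma \<rho>1_ch: "character G \<rho>1 = ch 1 1 0 0 0"
  by (rule character_eqI[OF \<rho>1(1)]) (simp_all add: ch_def values_at \<rho>1_values \<rho>1)

lemma \<rho>2_ch: "character G \<rho>2 = ch 1 0 1 0 0"
  by (rule character_eqI[OF \<rho>2(1)]) (simp_all add: ch_def values_at \<rho>2_values \<rho>2)

lemma irreducible_\<Delta>: "irreducible_rep G 2 \<Delta>"
  unfolding irreducible_rep_def
proof (intro conjI allI impI)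
  fix W assume "VectorSpace.subspace class_ring W (module_vec TYPE(complex) 2) \<and>
    (\<forall>g\<in>carrier G. \<forall>w\<in>W. \<Delta> g *\<^sub>v w \<in> W)"
  then have sub: "VectorSpace.subspace class_ring W (module_vec TYPE(complex) 2)"
    and inv: "\<forall>g\<in>carrier G. \<forall>w\<in>W. \<Delta> g *\<^sub>v w \<in> W" by auto
  have W: "W \<subseteq> carrier_vec 2" "0\<^sub>v 2 \<in> W" "\<And>v w. v \<in> W \<Longrightarrow> w \<in> W \<Longrightarrow> v + w \<in> W"
    "\<And>c v. v \<in> W \<Longrightarrow> c \<cdot>\<^sub>v v \<in> W"
    using sub unfolding subspace_vec_iff by auto
  define V where "V x y = vec 2 (\<lambda>n. if n = 0 then x else (y :: complex))" for x y
  have V: "v = V (v $ 0) (v $ 1)" if "v \<in> carrier_vec 2" for v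
    using that by (intro eq_vecI) (auto simp: V_def less_2_cases_iff)
  have Vadd: "V x y + V x' y' = V (x + x') (y + y')" for x y x' y'
    by (intro eq_vecI) (auto simp: V_def)
  have Vsm: "c \<cdot>\<^sub>v V x y = V (c * x) (c * y)" for c x y
    by (intro eq_vecI) (auto simp: V_def)
  have Vi: "\<Delta> i *\<^sub>v V x y = V (\<i> * x) (- \<i> * y)" for x y
    by (intro eq_vecI)
       (auto simp: V_def \<Delta> mat_of_rows_list_def scalar_prod_def less_2_cases_iff numeral_2_eq_2)
  have Vj: "\<Delta> j *\<^sub>v V x y = V (- y) x" for x y
    by (intro eq_vecI)
       (auto simp: V_def \<Delta> mat_of_rows_list_def scalar_prod_def less_2_cases_iff numeral_2_eq_2)
  have i: "V (\<i> * x) (- \<i> * y) \<in> W" and j: "V (- y) x \<in> W" if "V x y \<in> W" for x y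
    using inv that generators unfolding Vi[symmetric] Vj[symmetric] by blast+
  have all: "carrier_vec 2 \<subseteq> W" if p: "V p 0 \<in> W" "p \<noteq> 0" for p
  proof
    fix v :: "complex vec" assume v: "v \<in> carrier_vec 2"
    have "(v $ 0 / p) \<cdot>\<^sub>v V p 0 + (v $ 1 / p) \<cdot>\<^sub>v V (- 0) p \<in> W"
      using W(3,4) p(1) j[OF p(1)] by blast
    then show "v \<in> W" using p(2) V[OF v] by (simp add: Vsm Vadd)
  qed
  show "W = {0\<^sub>v 2} \<or> W = carrier_vec 2"
  proof (cases "W = {0\<^sub>v 2}")
    case False
    then obtain v where v: "v \<in> W" "v \<noteq> 0\<^sub>v 2" using W(2) by blast
    define p q where "p = v $ 0" and "q = v $ 1"
    have vV: "v = V p q" using V v(1) W(1) unfolding p_def q_def by blast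
    have "V 0 0 = 0\<^sub>v 2" by (intro eq_vecI) (auto simp: V_def)
    then have pq: "p \<noteq> 0 \<or> q \<noteq> 0" using vV v(2) by auto
    have Vpq: "V p q \<in> W" using v vV by simp
    have "(1/2) \<cdot>\<^sub>v (V p q + (-\<i>) \<cdot>\<^sub>v V (\<i> * p) (- \<i> * q)) \<in> W"
      "(1/2) \<cdot>\<^sub>v (V p q + \<i> \<cdot>\<^sub>v V (\<i> * p) (- \<i> * q)) \<in> W"
      using W(3,4) Vpq i[OF Vpq] by blast+
    then have "V p 0 \<in> W" "V 0 q \<in> W" by (simp_all add: Vsm Vadd)
    moreover from this(2) have "V (- q) 0 \<in> W" by (rule j)
    ultimately have "carrier_vec 2 \<subseteq> W" using pq all[of p] all[of "- q"] by auto
    then show ?thesis using W(1) by blast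
  qed simp
qed (use \<Delta>(1) in auto)

text \<open>If no linear character occurs in \<open>\<rho>\<close>, an eigenvector \<open>v\<close> of \<open>i\<close> for the eigenvalue
  \<open>\<i>\<close> spans together with \<open>j v\<close> an invariant subspace.\<close>

lemma irreducible_dim_le_2:
  assumes irr: "irreducible_rep G n \<rho>" and v: "v \<in> carrier_vec n" "v \<noteq> 0\<^sub>v n"
    and eig: "\<rho> i *\<^sub>v v = \<i> \<cdot>\<^sub>v v" "\<rho> z *\<^sub>v v = (-1) \<cdot>\<^sub>v v" "\<rho> (z \<otimes> i) *\<^sub>v v = (-\<i>) \<cdot>\<^sub>v v"
  shows "n \<le> 2"
proof -
  have \<rho>: "representation G n \<rho>" using irr by (auto simp: irreducible_rep_def)
  note carr = representation_mat[OF \<rho>]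
  have act: "\<rho> (g \<otimes> h) *\<^sub>v x = \<rho> g *\<^sub>v (\<rho> h *\<^sub>v x)"
    if "g \<in> carrier G" "h \<in> carrier G" "x \<in> carrier_vec n" for g h x
    using that by (simp add: representation_mult[OF \<rho>] assoc_mult_mat_vec[OF carr carr])
  define u where "u = \<rho> j *\<^sub>v v"
  have u: "u \<in> carrier_vec n" unfolding u_def using carr[of j] v by auto
  have iu: "\<rho> i *\<^sub>v u = (-\<i>) \<cdot>\<^sub>v u"
  proof -
    have "i \<otimes> j = j \<otimes> (z \<otimes> i)" by (simp add: z_commute ji z_left ij)
    then have "\<rho> i *\<^sub>v u = \<rho> j *\<^sub>v (\<rho> (z \<otimes> i) *\<^sub>v v)"
      unfolding u_def using act[of i j v] act[of j "z \<otimes> i" v] v by simp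
    then show ?thesis using v by (simp add: eig mult_mat_vec[OF carr] u_def)
  qed
  have ju: "\<rho> j *\<^sub>v u = (-1) \<cdot>\<^sub>v v"
    using act[of j j v] v eig(2) by (simp add: jj u_def)
  define W where "W = {\<alpha> \<cdot>\<^sub>v v + \<beta> \<cdot>\<^sub>v u | \<alpha> \<beta>. True}"
  have lin: "\<rho> g *\<^sub>v (\<alpha> \<cdot>\<^sub>v v + \<beta> \<cdot>\<^sub>v u) = \<alpha> \<cdot>\<^sub>v (\<rho> g *\<^sub>v v) + \<beta> \<cdot>\<^sub>v (\<rho> g *\<^sub>v u)" if "g \<in> carrier G"
      for g \<alpha> \<beta>
    using v u by (simp add: mult_add_distrib_mat_vec[OF carr[OF that]] mult_mat_vec[OF carr[OF that]])
  have Wc: "W \<subseteq> carrier_vec n" unfolding W_def using v u by auto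
  have sub: "VectorSpace.subspace class_ring W (module_vec TYPE(complex) n)"
    unfolding subspace_vec_iff
  proof (intro conjI ballI allI Wc)
    have "0\<^sub>v n = 0 \<cdot>\<^sub>v v + 0 \<cdot>\<^sub>v u" using v u by auto
    then show "0\<^sub>v n \<in> W" unfolding W_def by blast
  next
    fix x y assume "x \<in> W" "y \<in> W"
    then obtain \<alpha> \<beta> \<alpha>' \<beta>' where "x = \<alpha> \<cdot>\<^sub>v v + \<beta> \<cdot>\<^sub>v u" "y = \<alpha>' \<cdot>\<^sub>v v + \<beta>' \<cdot>\<^sub>v u" unfolding W_def by blast
    then have "x + y = (\<alpha> + \<alpha>') \<cdot>\<^sub>v v + (\<beta> + \<beta>') \<cdot>\<^sub>v u"
      using v u by (intro eq_vecI) (auto simp: algebra_simps)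
    then show "x + y \<in> W" unfolding W_def by blast
  next
    fix c x assume "x \<in> W"
    then obtain \<alpha> \<beta> where "x = \<alpha> \<cdot>\<^sub>v v + \<beta> \<cdot>\<^sub>v u" unfolding W_def by blast
    then have "c \<cdot>\<^sub>v x = (c * \<alpha>) \<cdot>\<^sub>v v + (c * \<beta>) \<cdot>\<^sub>v u"
      using v u by (intro eq_vecI) (auto simp: algebra_simps)
    then show "c \<cdot>\<^sub>v x \<in> W" unfolding W_def by blast
  qed
  define S where "S = {g \<in> carrier G. \<forall>x\<in>W. \<rho> g *\<^sub>v x \<in> W}"
  have "\<rho> i *\<^sub>v x \<in> W" "\<rho> j *\<^sub>v x \<in> W" if "x \<in> W" for x
  proof -
    from that obtain \<alpha> \<beta> where x: "x = \<alpha> \<cdot>\<^sub>v v + \<beta> \<cdot>\<^sub>v u" unfolding W_def by blast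
    have "\<rho> i *\<^sub>v x = (\<alpha> * \<i>) \<cdot>\<^sub>v v + (- \<beta> * \<i>) \<cdot>\<^sub>v u"
      unfolding x lin[OF generators(1)] eig iu using v u by (simp add: smult_smult_assoc)
    then show "\<rho> i *\<^sub>v x \<in> W" unfolding W_def by blast
    have "\<rho> j *\<^sub>v x = (- \<beta>) \<cdot>\<^sub>v v + \<alpha> \<cdot>\<^sub>v u"
      unfolding x lin[OF generators(2)] ju u_def[symmetric] using v u
      by (simp add: smult_smult_assoc comm_add_vec[of _ n])
    then show "\<rho> j *\<^sub>v x \<in> W" unfolding W_def by blast
  qed
  then have ij_S: "i \<in> S" "j \<in> S" by (simp_all add: S_def)
  have mult_S: "g \<otimes> h \<in> S" if "g \<in> S" "h \<in> S" for g h
    using that Wc act unfolding S_def by (auto simp: subset_iff)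
  have "z \<in> S" "k \<in> S" using mult_S ij_S ii ij by metis+
  moreover from this have "\<one> \<in> S" using mult_S zz by metis
  ultimately have "carrier G \<subseteq> S" unfolding carrier_eq using mult_S ij_S by blast
  then have "W = {0\<^sub>v n} \<or> W = carrier_vec n"
    using irr sub unfolding irreducible_rep_def S_def by blast
  moreover have "v = 1 \<cdot>\<^sub>v v + 0 \<cdot>\<^sub>v u" using v u by auto
  then have "v \<in> W" unfolding W_def by blast
  ultimately have "W = carrier_vec n" using v by auto
  then have "n \<le> card {v, u}"
    by (intro dim_le_2_if_spanned[OF v(1) u]) (auto simp: W_def)
  also have "\<dots> \<le> 2" by (simp add: card_insert_if)
  finally show ?thesis .
qed

lemma irr_characters_eq:
  "irr_characters G = {ch 1 0 0 0 0, ch 1 1 0 0 0, ch 1 0 1 0 0, ch 1 1 1 1 0, ch 2 0 0 0 (-1)}"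
  (is "_ = ?S")
proof
  have "ch 2 0 0 0 (-1) \<in> irr_characters G"
    using irreducible_\<Delta> unfolding irr_characters_def \<Delta>_ch[symmetric] by blast
  then show "?S \<subseteq> irr_characters G"
    using sign_char_irr[of 0 0] sign_char_irr[of 0 1] sign_char_irr[of 1 0] sign_char_irr[of 1 1] by simp
  show "irr_characters G \<subseteq> ?S"
  proof
    fix f assume "f \<in> irr_characters G"
    then obtain d \<rho> where f: "f = character G \<rho>" and irr: "irreducible_rep G d \<rho>"
      by (auto simp: irr_characters_def)
    then have \<rho>: "representation G d \<rho>" and d: "d > 0" by (auto simp: irreducible_rep_def)
    have linear: "f \<in> ?S" if "v \<in> carrier_vec d" "v \<noteq> 0\<^sub>v d"
      "\<forall>h\<in>carrier G. \<rho> h *\<^sub>v v = sign_char m n h \<cdot>\<^sub>v v" and mn: "m \<le> 1" "n \<le> 1" for v m n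
    proof -
      have "f = ch 1 (int m) (int n) (int (m * n)) 0"
        using irreducible_linear[OF irr that(1,2), of "sign_char m n"] that(3) unfolding f sign_char_ch
            by simp
      moreover have "m = 0 \<or> m = 1" "n = 0 \<or> n = 1" using mn by auto
      ultimately show ?thesis by auto
    qed
    define q where "q m n = (f \<one> + f z + 2 * ((1 - 2 * of_nat n) * f i + (1 - 2 * of_nat m) * f j
        + (1 - 2 * of_nat n) * (1 - 2 * of_nat m) * f k)) / 8" for m n :: nat
    show "f \<in> ?S"
    proof (cases "\<exists>m n. m \<le> 1 \<and> n \<le> 1 \<and> q m n \<noteq> 0")
      case True
      then obtain m n where mn: "m \<le> 1" "n \<le> 1" "q m n \<noteq> 0" by blast
      from sign_multiplicity(2)[OF \<rho> mn(1,2)] mn(3) linear[OF _ _ _ mn(1,2)] show ?thesis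
        unfolding q_def f by blast
    next
      case False
      then have "q 0 0 = 0" "q 0 1 = 0" "q 1 0 = 0" "q 1 1 = 0" by auto
      then have e: "f \<one> + f z + 2 * (f i + f j + f k) = 0" "f \<one> + f z + 2 * (- f i + f j - f k) = 0"
        "f \<one> + f z + 2 * (f i - f j - f k) = 0" "f \<one> + f z + 2 * (- f i - f j + f k) = 0"
        by (simp_all add: q_def)
      have f1: "f \<one> = of_nat d" unfolding f by (rule character_one[OF is_group \<rho>])
      have "4 * (f \<one> + f z) = (f \<one> + f z + 2 * (f i + f j + f k)) + (f \<one> + f z + 2 * (- f i + f j - f k))
          + (f \<one> + f z + 2 * (f i - f j - f k)) + (f \<one> + f z + 2 * (- f i - f j + f k))" by simp
      also have "\<dots> = 0" unfolding e by simp
      finally have s0: "f \<one> + f z = 0" by (simp del: distrib_left_numeral)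
      then have fz: "f z = - of_nat d" using f1 by (simp add: add_eq_0_iff)
      have s: "f i + f j + f k = 0" "- f i + f j - f k = 0" "f i - f j - f k = 0"
        using e unfolding s0 add_0 mult_eq_0_iff by simp_all
      have "2 * f j = (- f i + f j - f k) + (f i + f j + f k)" "2 * f i = (f i - f j - f k) + (f i + f j
          + f k)"
        by simp_all
      then have "f j = 0" "f i = 0" unfolding s by simp_all
      with s have "f k = 0" by simp
      have "f \<one> \<noteq> f z" using d by (simp add: f1 fz eq_neg_iff_add_eq_0 flip: of_nat_add)
      then have "d \<le> 2"
        using c4_multiplicity(2)[OF \<rho>] irreducible_dim_le_2[OF irr] unfolding f by blast
      moreover have "(of_nat d / 2 :: complex) \<in> \<nat>"
        using c4_multiplicity(1)[OF \<rho>, folded f] by (simp add: f1 fz)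
      then obtain e where "(of_nat d / 2 :: complex) = of_nat e" by (auto elim: Nats_cases)
      then have "(of_nat d :: complex) = of_nat (2 * e)" by (simp add: field_simps)
      then have "d = 2 * e" by (simp only: of_nat_eq_iff)
      ultimately have d2: "d = 2" using d by auto
      have "f = ch 2 0 0 0 (-1)" unfolding f
        by (rule character_eqI[OF \<rho>])
           (simp_all add: f[symmetric] ch_def values_at f1 fz d2 \<open>f i = 0\<close> \<open>f j = 0\<close> \<open>f k = 0\<close>)
      then show ?thesis by simp
    qed
  qed
qed

end

context quaternion_reps
begin

section \<open>The character ring\<close>

lemma ch_add: "(\<lambda>g\<in>carrier G. ch c0 c1 c2 c3 c4 g + ch d0 d1 d2 d3 d4 g)
    = ch (c0 + d0) (c1 + d1) (c2 + d2) (c3 + d3) (c4 + d4)"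
  unfolding ch_def by (rule restrict_ext) (simp add: algebra_simps)

lemma ch_uminus: "(\<lambda>g\<in>carrier G. - ch c0 c1 c2 c3 c4 g) = ch (- c0) (- c1) (- c2) (- c3) (- c4)"
  unfolding ch_def by (rule restrict_ext) simp

lemma ch_zero: "(\<lambda>g\<in>carrier G. 0) = ch 0 0 0 0 0"
  unfolding ch_def by (rule restrict_ext) simp

lemma ch_one: "(\<lambda>g\<in>carrier G. 1) = ch 1 0 0 0 0"
  unfolding ch_def by (rule restrict_ext) simp

lemma ch_mult: "\<exists>e0 e1 e2 e3 e4.
   (\<lambda>g\<in>carrier G. ch c0 c1 c2 c3 c4 g * ch d0 d1 d2 d3 d4 g) = ch e0 e1 e2 e3 e4"
proof -
  have "(of_int c0 + of_int c1 * A + of_int c2 * B + of_int c3 * (A * B) + of_int c4 * W) *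
      (of_int d0 + of_int d1 * A + of_int d2 * B + of_int d3 * (A * B) + of_int d4 * W)
    = of_int (c0 * d0)
      + of_int (c0 * d1 + c1 * d0 - 2 * c1 * d1 + 2 * c1 * d4 + 2 * c4 * d1 + 2 * c4 * d4) * A
      + of_int (c0 * d2 + c2 * d0 - 2 * c2 * d2 + 2 * c2 * d4 + 2 * c4 * d2 + 2 * c4 * d4) * B
      + of_int (c0 * d3 + c3 * d0 + c1 * d2 + c2 * d1 - 2 * c1 * d3 - 2 * c3 * d1 - 2 * c2 * d3 - 2 * c3
          * d2
          + 4 * c3 * d3 + 2 * c3 * d4 + 2 * c4 * d3 + c4 * d4) * (A * B)
      + of_int (c0 * d4 + c4 * d0 + 4 * c4 * d4) * (W :: complex)"
    if "(A, B, W) \<in> {(0, 0, 0), (0, 0, 4), (0, -2, 2), (-2, 0, 2), (-2, -2, 2)}" for A B W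
    using that by (elim insertE emptyE) (simp_all add: algebra_simps)
  from this[OF values_table] have "(\<lambda>g\<in>carrier G. ch c0 c1 c2 c3 c4 g * ch d0 d1 d2 d3 d4 g)
    = ch (c0 * d0)
      (c0 * d1 + c1 * d0 - 2 * c1 * d1 + 2 * c1 * d4 + 2 * c4 * d1 + 2 * c4 * d4)
      (c0 * d2 + c2 * d0 - 2 * c2 * d2 + 2 * c2 * d4 + 2 * c4 * d2 + 2 * c4 * d4)
      (c0 * d3 + c3 * d0 + c1 * d2 + c2 * d1 - 2 * c1 * d3 - 2 * c3 * d1 - 2 * c2 * d3 - 2 * c3 * d2
          + 4 * c3 * d3 + 2 * c3 * d4 + 2 * c4 * d3 + c4 * d4)
      (c0 * d4 + c4 * d0 + 4 * c4 * d4)"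
    unfolding ch_def by (intro restrict_ext) simp
  then show ?thesis by blast
qed

lemma carrier_char_ring: "\<R> = {ch c0 c1 c2 c3 c4 | c0 c1 c2 c3 c4. True}" (is "_ = ?C")
proof
  show "\<R> \<subseteq> ?C"
  proof
    fix x assume "x \<in> \<R>"
    then show "x \<in> ?C"
    proof (induction rule: char_ring_induct)
      case zero
      show ?case unfolding ch_zero by blast
    next
      case (irr x)
      then show ?case unfolding irr_characters_eq by blast
    next
      case (uminus x)
      then obtain c0 c1 c2 c3 c4 where x: "x = ch c0 c1 c2 c3 c4" by blast
      show ?case unfolding x ch_uminus by blast
    next
      case (add x y)
      then obtain c0 c1 c2 c3 c4 d0 d1 d2 d3 d4 where xy: "x = ch c0 c1 c2 c3 c4" "y = ch d0 d1 d2 d3 d4"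
        by blast
      show ?case unfolding xy ch_add by blast
    qed
  qed
  show "?C \<subseteq> \<R>"
  proof clarify
    fix c0 c1 c2 c3 c4
    have "ch 1 0 0 0 0 \<in> \<R>" "ch 1 1 0 0 0 \<in> \<R>"
      "ch 1 0 1 0 0 \<in> \<R>" "ch 1 1 1 1 0 \<in> \<R>"
      "ch 2 0 0 0 (-1) \<in> \<R>"
      using irr_characters_char_ring[of G] unfolding irr_characters_eq by blast+
    note mem = this[THEN char_ring_smult]
    let ?s = "\<lambda>n x. \<lambda>g\<in>carrier G. of_int n * x g"
    let ?p = "\<lambda>x y. \<lambda>g\<in>carrier G. x g + y g"
    have "?p (?s (c0 - c1 - c2 + c3 + 2 * c4) (ch 1 0 0 0 0)) (?p (?s (c1 - c3) (ch 1 1 0 0 0))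
      (?p (?s (c2 - c3) (ch 1 0 1 0 0)) (?p (?s c3 (ch 1 1 1 1 0)) (?s (- c4) (ch 2 0 0 0 (-1))))))
      \<in> \<R>"
      by (intro char_ring_add mem)
    also have "?p (?s (c0 - c1 - c2 + c3 + 2 * c4) (ch 1 0 0 0 0)) (?p (?s (c1 - c3) (ch 1 1 0 0 0))
      (?p (?s (c2 - c3) (ch 1 0 1 0 0)) (?p (?s c3 (ch 1 1 1 1 0)) (?s (- c4) (ch 2 0 0 0 (-1))))))
      = ch c0 c1 c2 c3 c4"
      unfolding ch_def by (rule restrict_ext) (simp add: algebra_simps)
    finally show "ch c0 c1 c2 c3 c4 \<in> \<R>" .
  qed
qed

lemma ch_carrier [simp]: "ch c0 c1 c2 c3 c4 \<in> \<R>"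
  unfolding carrier_char_ring by blast

lemma char_ring_mult:
  assumes "x \<in> \<R>" "y \<in> \<R>"
  shows "(\<lambda>g\<in>carrier G. x g * y g) \<in> \<R>"
proof -
  obtain c0 c1 c2 c3 c4 d0 d1 d2 d3 d4 where xy: "x = ch c0 c1 c2 c3 c4" "y = ch d0 d1 d2 d3 d4"
    using assms unfolding carrier_char_ring by blast
  show ?thesis using ch_mult[of c0 c1 c2 c3 c4 d0 d1 d2 d3 d4] unfolding xy by (elim exE) simp
qed

lemma char_ring_one: "(\<lambda>g\<in>carrier G. 1) \<in> \<R>"
  unfolding ch_one by simp

lemma cring_char_ring: "cring (char_ring G)"
proof (intro cringI abelian_groupI comm_monoidI)
  fix x assume x: "x \<in> \<R>"
  have "(\<lambda>g\<in>carrier G. (\<lambda>g\<in>carrier G. - x g) g + x g) = (\<lambda>g\<in>carrier G. 0)"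
    by (rule restrict_ext) simp
  then show "\<exists>y\<in>\<R>. y \<oplus>\<^sub>c x = \<zero>\<^bsub>char_ring G\<^esub>"
    using char_ring_uminus[OF x] unfolding char_ring_simps(2-) by blast
  show "\<zero>\<^bsub>char_ring G\<^esub> \<oplus>\<^sub>c x = x" "\<one>\<^bsub>char_ring G\<^esub> \<otimes>\<^sub>c x = x"
    using char_ring_extensional[OF x] by (auto simp: char_ring_simps(2-) extensional_def)
qed (auto simp: char_ring_simps(2-) algebra_simps intro!: char_ring_add char_ring_mult char_ring_zero[of
    G] char_ring_one cong: restrict_cong)

sublocale R: cring "char_ring G"
  by (rule cring_char_ring)

lemma R_uminus:
  assumes "x \<in> \<R>"
  shows "\<ominus>\<^bsub>char_ring G\<^esub> x = (\<lambda>g\<in>carrier G. - x g)"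
proof (rule R.minus_equality[OF _ assms char_ring_uminus[OF assms]])
  show "(\<lambda>g\<in>carrier G. - x g) \<oplus>\<^sub>c x = \<zero>\<^bsub>char_ring G\<^esub>"
    unfolding char_ring_simps(2-) by (rule restrict_ext) simp
qed

lemma R_minus:
  assumes "x \<in> \<R>" "y \<in> \<R>"
  shows "x \<ominus>\<^sub>c y = (\<lambda>g\<in>carrier G. x g - y g)"
  unfolding a_minus_def R_uminus[OF assms(2)] char_ring_simps(4) by (rule restrict_ext) simp

lemma R_finsum:
  assumes "finite A" "\<And>n. n \<in> A \<Longrightarrow> x n \<in> \<R>"
  shows "(\<Oplus>\<^bsub>char_ring G\<^esub>n\<in>A. x n) = (\<lambda>g\<in>carrier G. \<Sum>n\<in>A. x n g)"
  using assms
proof (induction A rule: finite_induct)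
  case empty
  then show ?case by (simp add: char_ring_simps(2-))
next
  case (insert n A)
  then have "(\<Oplus>\<^bsub>char_ring G\<^esub>n\<in>insert n A. x n) = x n \<oplus>\<^sub>c (\<Oplus>\<^bsub>char_ring G\<^esub>n\<in>A. x n)"
    by (intro R.finsum_insert) auto
  with insert show ?case by (simp add: char_ring_simps(4) cong: restrict_cong)
qed

lemma R_add_pow_nat: "x \<in> \<R> \<Longrightarrow> add_pow (char_ring G) (n :: nat) x = (\<lambda>g\<in>carrier G. of_nat n * x g)"
proof (induction n)
  case 0
  then show ?case by (simp add: char_ring_simps(2-))
next
  case (Suc n)
  then show ?case by (simp add: char_ring_simps(4) algebra_simps cong: restrict_cong)
qed

lemma R_add_pow:
  assumes "x \<in> \<R>"
  shows "add_pow (char_ring G) (n :: int) x = (\<lambda>g\<in>carrier G. of_int n * x g)"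
proof (cases n)
  case (nonneg m)
  then show ?thesis using R_add_pow_nat[OF assms, of m] by (simp add: add_pow_int_ge)
next
  case (neg m)
  have c: "(\<lambda>g\<in>carrier G. of_nat (Suc m) * x g) \<in> \<R>"
    using R.add.nat_pow_closed[OF assms, of "Suc m"] unfolding R_add_pow_nat[OF assms] .
  have "add_pow (char_ring G) n x = \<ominus>\<^bsub>char_ring G\<^esub> (add_pow (char_ring G) (Suc m) x)"
    using neg add_pow_int_lt[of n "char_ring G" x] by (simp only: nat_int minus_minus)
  also have "\<dots> = (\<lambda>g\<in>carrier G. - (\<lambda>g\<in>carrier G. of_nat (Suc m) * x g) g)"
    unfolding R_add_pow_nat[OF assms]
  proof (rule R.minus_equality[OF _ c char_ring_uminus[OF c]])
    show "(\<lambda>g\<in>carrier G. - (\<lambda>g\<in>carrier G. of_nat (Suc m) * x g) g) \<oplus>\<^sub>c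
        (\<lambda>g\<in>carrier G. of_nat (Suc m) * x g) = \<zero>\<^bsub>char_ring G\<^esub>"
      unfolding char_ring_simps(2-) by (rule restrict_ext) simp
  qed
  also have "\<dots> = (\<lambda>g\<in>carrier G. of_int n * x g)" unfolding neg by (rule restrict_ext)
      (simp add: algebra_simps)
  finally show ?thesis .
qed

end

lemma lambda_fps_add:
  assumes "group G" "g \<in> carrier G"
  shows "lambda_fps G (\<lambda>g\<in>carrier G. x g + y g) g = lambda_fps G x g * lambda_fps G y g"
proof -
  interpret group G by fact
  show ?thesis using assms(2) by (simp add: lambda_fps_def elementary_fps_add)
qed

lemma lambda_fps_zero:
  assumes "group G" "g \<in> carrier G"
  shows "lambda_fps G (\<lambda>g\<in>carrier G. 0) g = 1"
proof -
  interpret group G by fact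
  show ?thesis using assms(2) by (simp add: lambda_fps_def elementary_fps_zero)
qed

lemma lambda_fps_uminus:
  assumes "group G" "g \<in> carrier G"
  shows "lambda_fps G x g * lambda_fps G (\<lambda>g\<in>carrier G. - x g) g = 1"
proof -
  have "(\<lambda>g\<in>carrier G. x g + (\<lambda>g\<in>carrier G. - x g) g) = (\<lambda>g\<in>carrier G. 0)"
    by (rule restrict_ext) simp
  then show ?thesis
    using lambda_fps_add[OF assms, of x "\<lambda>g\<in>carrier G. - x g"] lambda_fps_zero[OF assms] by simp
qed

lemma lambda_fps_0 [simp]: "fps_nth (lambda_fps G x g) 0 = 1"
  by (simp add: lambda_fps_def)

lemma lambda_fps_1:
  assumes "group G" "g \<in> carrier G"
  shows "fps_nth (lambda_fps G x g) (Suc 0) = x g"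
proof -
  interpret group G by fact
  show ?thesis using assms(2) elementary_fps_1[of "\<lambda>k. x (g [^]\<^bsub>G\<^esub> k)"] by (simp add: lambda_fps_def)
qed

lemma fps_inverse_coefficients:
  fixes F H :: "'g \<Rightarrow> complex fps"
  assumes inverse: "\<And>g. g \<in> carrier G \<Longrightarrow> F g * H g = 1"
    and F: "\<And>g. fps_nth (F g) 0 = 1" "\<And>n. (\<lambda>g\<in>carrier G. fps_nth (F g) n) \<in> C n"
    and one: "(\<lambda>g\<in>carrier G. 1) \<in> C 0" and uminus: "\<And>n x. x \<in> C n \<Longrightarrow> (\<lambda>g\<in>carrier G. - x g) \<in> C n"
    and conv: "\<And>n x y. (\<And>m. m \<in> {1..n} \<Longrightarrow> x m \<in> C m) \<Longrightarrow> (\<And>m. m \<in> {1..n} \<Longrightarrow> y m \<in> C (n - m)) \<Longrightarrow>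
      (\<lambda>g\<in>carrier G. \<Sum>m\<in>{1..n}. x m g * y m g) \<in> C n"
  shows "(\<lambda>g\<in>carrier G. fps_nth (H g) n) \<in> C n"
proof (induction n rule: less_induct)
  case (less n)
  define f h where "f m = (\<lambda>g\<in>carrier G. fps_nth (F g) m)" and "h m = (\<lambda>g\<in>carrier G. fps_nth (H g) m)" for m
  have rec: "fps_nth (H g) n + (\<Sum>m=1..n. f m g * h (n - m) g) = (if n = 0 then 1 else 0)" if g: "g
      \<in> carrier G" for g
  proof -
    have "(if n = 0 then 1 else 0) = fps_nth (F g * H g) n" by (simp add: inverse[OF g])
    also have "\<dots> = (\<Sum>m=0..n. f m g * h (n - m) g)" using g by (simp add: fps_mult_nth f_def h_def)
    also have "\<dots> = fps_nth (H g) n + (\<Sum>m=1..n. f m g * h (n - m) g)"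
      using g by (simp add: sum.atLeast_Suc_atMost F(1) f_def[of 0] h_def[of n])
    finally show ?thesis by (rule HOL.sym)
  qed
  show ?case
  proof (cases "n = 0")
    case True
    have "(\<lambda>g\<in>carrier G. fps_nth (H g) n) = (\<lambda>g\<in>carrier G. 1)"
      by (rule restrict_ext) (use rec True in auto)
    then show ?thesis using one True by (simp only:)
  next
    case False
    have "(\<lambda>g\<in>carrier G. fps_nth (H g) n) = (\<lambda>g\<in>carrier G. - (\<lambda>g\<in>carrier G. \<Sum>m\<in>{1..n}. f m g * h (n - m)
        g) g)"
      by (rule restrict_ext) (use rec False in \<open>simp add: eq_neg_iff_add_eq_0\<close>)
    moreover have "(\<lambda>g\<in>carrier G. \<Sum>m\<in>{1..n}. f m g * h (n - m) g) \<in> C n"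
    proof (rule conv)
      show "f m \<in> C m" for m unfolding f_def by (rule F(2))
      show "h (n - m) \<in> C (n - m)" if "m \<in> {1..n}" for m
        unfolding h_def by (rule less) (use that False in auto)
    qed
    ultimately show ?thesis using uminus by (simp only:)
  qed
qed

context quaternion_reps
begin

section \<open>The operations \<open>\<lambda>\<^sup>n\<close>\<close>

lemma lambda_fps_sign_char:
  assumes mn: "m \<le> 1" "n \<le> 1" and g: "g \<in> carrier G"
  shows "lambda_fps G (\<lambda>g\<in>carrier G. sign_char m n g) g = 1 + fps_const (sign_char m n g) * fps_X"
proof -
  have "sign_char m n (g [^] k) = sign_char m n g ^ k" for k :: nat
    by (induction k) (use g in \<open>simp_all add: sign_char_values sign_char_mult[OF mn] mult.commute\<close>)
  then show ?thesis using g by (simp add: lambda_fps_def elementary_fps_power)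
qed

lemma lambda_fps_\<Delta>:
  assumes g: "g \<in> carrier G"
  shows "lambda_fps G (character G \<Delta>) g = 1 + fps_const (character G \<Delta> g) * fps_X + fps_X ^ 2"
proof (rule fps_ext)
  fix n
  let ?F = "lambda_fps G (character G \<Delta>) g"
  have g2: "g [^] (2 :: nat) = g \<otimes> g" using g by (simp add: numeral_2_eq_2)
  have "character G \<Delta> g * character G \<Delta> g - character G \<Delta> (g \<otimes> g) = 2"
    using g unfolding carrier_eq
    by (elim insertE emptyE)
       (simp_all add: \<Delta>_values character_coset[OF \<Delta>(1)] zz z_left m_assoc z_commute ii jj kk)
  then have 2: "fps_nth ?F 2 = 1"
    using elementary_fps_2[of "\<lambda>k. character G \<Delta> (g [^] k)"] g by (simp add: lambda_fps_def g2)
  have 3: "fps_nth ?F n = 0" if "n > 2"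
    using lambda_fps_character[OF is_group \<Delta>(1) g] mat_trace_exterior_power_eq_0[OF
        representation_mat[OF \<Delta>(1) g] that]
    by simp
  consider "n = 0" | "n = 1" | "n = 2" | "n > 2" by linarith
  then show "fps_nth ?F n = fps_nth (1 + fps_const (character G \<Delta> g) * fps_X + fps_X ^ 2) n"
  proof cases
    case 2
    then show ?thesis using lambda_fps_1[OF is_group g] by (simp add: fps_X_power_nth)
  qed (simp_all add: 2 3 fps_X_power_nth)
qed

definition lam :: "nat \<Rightarrow> ('a \<Rightarrow> complex) \<Rightarrow> 'a \<Rightarrow> complex" where
  "lam n x = (\<lambda>g\<in>carrier G. fps_nth (lambda_fps G x g) n)"

lemma lam_0: "lam 0 x = (\<lambda>g\<in>carrier G. 1)"
  by (simp add: lam_def)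

lemma lam_add: "lam n (\<lambda>g\<in>carrier G. x g + y g) = (\<lambda>g\<in>carrier G. \<Sum>m\<le>n. lam m x g * lam (n - m) y g)"
  unfolding lam_def
  by (rule restrict_ext) (simp add: lambda_fps_add[OF is_group] fps_mult_nth atMost_atLeast0)

lemma char_ring_sum:
  assumes "finite A" "\<And>n. n \<in> A \<Longrightarrow> x n \<in> \<R>"
  shows "(\<lambda>g\<in>carrier G. \<Sum>n\<in>A. x n g) \<in> \<R>"
proof -
  have "(\<Oplus>\<^bsub>char_ring G\<^esub>n\<in>A. x n) \<in> \<R>"
    by (rule R.finsum_closed) (use assms in auto)
  then show ?thesis by (simp only: R_finsum[OF assms])
qed

lemma char_ring_conv:
  assumes "finite A" "\<And>n. n \<in> A \<Longrightarrow> x n \<in> \<R>" "\<And>n. n \<in> A \<Longrightarrow> y n \<in> \<R>"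
  shows "(\<lambda>g\<in>carrier G. \<Sum>n\<in>A. x n g * y n g) \<in> \<R>"
proof -
  have "(\<lambda>g\<in>carrier G. \<Sum>n\<in>A. (\<lambda>g\<in>carrier G. x n g * y n g) g) \<in> \<R>"
    using assms by (intro char_ring_sum char_ring_mult) auto
  also have "(\<lambda>g\<in>carrier G. \<Sum>n\<in>A. (\<lambda>g\<in>carrier G. x n g * y n g) g) = (\<lambda>g\<in>carrier G. \<Sum>n\<in>A. x n g * y n g)"
    by (rule restrict_ext) simp
  finally show ?thesis .
qed

lemma lam_closed: "x \<in> \<R> \<Longrightarrow> lam n x \<in> \<R>"
proof (induction x arbitrary: n rule: char_ring_induct)
  case zero
  have "lam n (\<lambda>g\<in>carrier G. 0) = (if n = 0 then (\<lambda>g\<in>carrier G. 1) else (\<lambda>g\<in>carrier G. 0))"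
    unfolding lam_def by (auto intro!: restrict_ext simp: lambda_fps_zero[OF is_group])
  then show ?case using char_ring_one char_ring_zero by metis
next
  case (irr x)
  then have x: "x \<in> \<R>" using irr_characters_char_ring by blast
  have sign: "lam n (ch 1 (int m) (int l) (int (m * l)) 0) \<in> \<R>"
    if ml: "m \<le> 1" "l \<le> 1" for m l
  proof -
    have "lam n (ch 1 (int m) (int l) (int (m * l)) 0) = (if n = 0 then (\<lambda>g\<in>carrier G. 1) else
        if n = 1 then ch 1 (int m) (int l) (int (m * l)) 0 else (\<lambda>g\<in>carrier G. 0))"
      unfolding lam_def sign_char_ch[symmetric] 
      by (auto intro!: restrict_ext simp: lambda_fps_sign_char[OF ml])
    then show ?thesis using char_ring_one char_ring_zero ch_carrier by metis
  qed
  have "lam n (ch 2 0 0 0 (-1)) = (if n = 0 \<or> n = 2 then (\<lambda>g\<in>carrier G. 1) else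
      if n = 1 then ch 2 0 0 0 (-1) else (\<lambda>g\<in>carrier G. 0))"
    unfolding lam_def \<Delta>_ch[symmetric] character_def
    by (auto intro!: restrict_ext simp: lambda_fps_\<Delta>[unfolded character_def] fps_X_power_nth)
  then have \<Delta>: "lam n (ch 2 0 0 0 (-1)) \<in> \<R>"
    using char_ring_one char_ring_zero ch_carrier by metis
  show ?case
    using irr sign[of 0 0] sign[of 0 1] sign[of 1 0] sign[of 1 1] \<Delta> unfolding irr_characters_eq by auto
next
  case (uminus x)
  show ?case unfolding lam_def
  proof (rule fps_inverse_coefficients[where F = "lambda_fps G x"])
    show "lambda_fps G x g * lambda_fps G (\<lambda>g\<in>carrier G. - x g) g = 1" if "g \<in> carrier G" for g
      by (rule lambda_fps_uminus[OF is_group that])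
    show "(\<lambda>g\<in>carrier G. fps_nth (lambda_fps G x g) n) \<in> \<R>" for n
      using uminus(2)[of n] by (simp only: lam_def)
  qed (auto intro!: char_ring_one char_ring_uminus char_ring_conv simp del: restrict_apply)
next
  case (add x y)
  show ?case unfolding lam_add by (rule char_ring_conv) (use add in auto)
qed

lemma character_closed: "representation G d \<rho> \<Longrightarrow> character G \<rho> \<in> \<R>"
  using character_of_representation unfolding carrier_char_ring by blast

lemma lam_character:
  assumes "representation G d \<rho>"
  shows "lam n (character G \<rho>) = character G (\<lambda>g. exterior_power n (\<rho> g))"
  unfolding lam_def character_def[of G "\<lambda>g. exterior_power n (\<rho> g)"]
  by (rule restrict_ext) (rule lambda_fps_character[OF is_group assms])

lemma exterior_operations_lam: "exterior_operations G (\<lambda>n. \<lambda>x\<in>\<R>. lam n x)"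
  unfolding exterior_operations_def
proof (intro conjI allI ballI impI)
  show "(\<lambda>x\<in>\<R>. lam n x) \<in> \<R> \<rightarrow>\<^sub>E \<R>" for n
    by (simp add: lam_closed)
  show "(\<lambda>x\<in>\<R>. lam n x) (character G \<rho>) = character G (\<lambda>g. exterior_power n (\<rho> g))"
    if "representation G d \<rho>" for n d \<rho>
    using lam_character[OF that] character_closed[OF that] by simp
  show "(\<lambda>x\<in>\<R>. lam 0 x) x = \<one>\<^bsub>char_ring G\<^esub>" if "x \<in> \<R>" for x
    using that unfolding char_ring_simps(3) lam_0 by simp
  fix n x y assume xy: "x \<in> \<R>" "y \<in> \<R>"
  let ?l = "\<lambda>n. \<lambda>x\<in>\<R>. lam n x"
  have "?l n (x \<oplus>\<^sub>c y) = lam n (x \<oplus>\<^sub>c y)" using xy by simp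
  also have "\<dots> = (\<lambda>g\<in>carrier G. \<Sum>m\<le>n. lam m x g * lam (n - m) y g)"
    unfolding char_ring_simps(4) by (rule lam_add)
  also have "\<dots> = (\<lambda>g\<in>carrier G. \<Sum>m\<le>n. (?l m x \<otimes>\<^sub>c ?l (n - m) y) g)"
    by (rule restrict_ext) (simp add: char_ring_simps(5) xy)
  also have "\<dots> = (\<Oplus>\<^bsub>char_ring G\<^esub>m\<in>{..n}. ?l m x \<otimes>\<^sub>c ?l (n - m) y)"
    by (rule R_finsum[symmetric]) (use xy lam_closed in auto)
  finally show "?l n (x \<oplus>\<^sub>c y) = (\<Oplus>\<^bsub>char_ring G\<^esub>m\<in>{..n}. ?l m x \<otimes>\<^sub>c ?l (n - m) y)" .
qed

lemma exterior_operations_unique: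
  assumes l: "exterior_operations G l" and x: "x \<in> \<R>"
  shows "l n x = lam n x"
proof -
  have closed: "l n x \<in> \<R>" if "x \<in> \<R>" for n x
    using l that unfolding exterior_operations_def by blast
  define L where "L x g = Abs_fps (\<lambda>n. l n x g)" for x g
  have char: "L (character G \<rho>) g = lambda_fps G (character G \<rho>) g"
    if "representation G d \<rho>" "g \<in> carrier G" for d \<rho> g
  proof (rule fps_ext)
    fix n
    have "l n (character G \<rho>) = lam n (character G \<rho>)"
      using l that(1) lam_character[OF that(1)] unfolding exterior_operations_def by metis
    then show "fps_nth (L (character G \<rho>) g) n = fps_nth (lambda_fps G (character G \<rho>) g) n"
      using that(2) by (simp add: L_def lam_def)
  qed
  have L_add: "L (\<lambda>g\<in>carrier G. x g + y g) g = L x g * L y g"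
    if xy: "x \<in> \<R>" "y \<in> \<R>" and g: "g \<in> carrier G" for x y g
  proof (rule fps_ext)
    fix n
    have "l n (\<lambda>g\<in>carrier G. x g + y g) = (\<Oplus>\<^bsub>char_ring G\<^esub>m\<in>{..n}. l m x \<otimes>\<^sub>c l (n - m) y)"
      using l xy unfolding exterior_operations_def char_ring_simps(4)[symmetric] by blast
    also have "\<dots> = (\<lambda>g\<in>carrier G. \<Sum>m\<le>n. (l m x \<otimes>\<^sub>c l (n - m) y) g)"
      by (rule R_finsum) (use xy closed in auto)
    finally have "l n (\<lambda>g\<in>carrier G. x g + y g) g = (\<Sum>m\<le>n. (l m x \<otimes>\<^sub>c l (n - m) y) g)"
      using g by (simp only: restrict_apply if_True)
    then show "fps_nth (L (\<lambda>g\<in>carrier G. x g + y g) g) n = fps_nth (L x g * L y g) n"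
      using g unfolding L_def fps_mult_nth fps_nth_Abs_fps char_ring_simps(5) atMost_atLeast0 by simp
  qed
  have null: "L (\<lambda>g\<in>carrier G. 0) g = lambda_fps G (\<lambda>g\<in>carrier G. 0) g" if "g \<in> carrier G" for g
  proof -
    have "representation G 0 (\<lambda>_. 1\<^sub>m 0)" by (rule representationI[OF is_group]) auto
    moreover have "character G (\<lambda>_. 1\<^sub>m 0) = (\<lambda>g\<in>carrier G. 0)"
      unfolding character_def by (rule restrict_ext) (simp add: mat_trace_def)
    ultimately show ?thesis using char that by metis
  qed
  have eq: "L x g = lambda_fps G x g" if g: "g \<in> carrier G" for g
    using x
  proof (induction x rule: char_ring_induct)
    case zero
    show ?case by (rule null[OF g])
  next
    case (irr x)
    then obtain d \<rho> where "x = character G \<rho>" "irreducible_rep G d \<rho>" by (auto simp: irr_characters_def)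
    then show ?case using char[OF _ g] by (auto simp: irreducible_rep_def)
  next
    case (uminus x)
    let ?y = "\<lambda>g\<in>carrier G. - x g"
    have sum0: "(\<lambda>g\<in>carrier G. x g + ?y g) = (\<lambda>g\<in>carrier G. 0)" by (rule restrict_ext) simp
    have "lambda_fps G x g * L ?y g = lambda_fps G x g * lambda_fps G ?y g"
      using L_add[OF uminus(1) char_ring_uminus[OF uminus(1)] g] lambda_fps_add[OF is_group g, of x ?y]
      unfolding sum0 null[OF g] uminus(2) by (simp only:)
    moreover have "lambda_fps G x g \<noteq> 0" using lambda_fps_0[of G x g] by (metis fps_zero_nth zero_neq_one)
    ultimately show ?case by (rule mult_left_cancel[THEN iffD1, rotated])
  next
    case (add x y)
    then show ?case by (simp only: L_add[OF add(1,2) g] lambda_fps_add[OF is_group g])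
  qed
  show ?thesis
  proof (rule extensionalityI[of _ "carrier G"])
    show "l n x \<in> extensional (carrier G)" "lam n x \<in> extensional (carrier G)"
      using closed[OF x] lam_closed[OF x] char_ring_extensional by blast+
    show "l n x g = lam n x g" if "g \<in> carrier G" for g
      using arg_cong[OF eq[OF that], of "\<lambda>F. fps_nth F n"] that by (simp add: L_def lam_def)
  qed
qed

lemma lambda_op_eq:
  assumes "x \<in> \<R>"
  shows "lambda_op G n x = lam n x"
proof -
  let ?l = "\<lambda>n. \<lambda>x\<in>\<R>. lam n x"
  have "lambda_op G = ?l" unfolding lambda_op_def
  proof (rule the_equality)
    show "exterior_operations G ?l" by (rule exterior_operations_lam)
  next
    fix l assume l: "exterior_operations G l"
    show "l = ?l"
    proof
      fix n
      have "l n \<in> \<R> \<rightarrow>\<^sub>E \<R>" using l by (simp add: exterior_operations_def)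
      then show "l n = ?l n"
        by (intro extensionalityI[of _ "\<R>"])
          (auto simp: PiE_def exterior_operations_unique[OF l])
    qed
  qed
  then show ?thesis using assms by simp
qed

end

section \<open>The operations \<open>\<gamma>\<^sup>n\<close>\<close>

lemma fps_nth_one_plus_X_power: "fps_nth ((1 + fps_X) ^ m :: complex fps) n = of_nat (m choose n)"
proof (induction m arbitrary: n)
  case 0
  then show ?case by (cases n) auto
next
  case (Suc m)
  then show ?case by (cases n) (simp_all add: algebra_simps)
qed

definition gamma_subst :: "complex fps" where
  "gamma_subst = fps_X * inverse (1 - fps_X)"

lemma gamma_subst_0 [simp]: "fps_nth gamma_subst 0 = 0"
  by (simp add: gamma_subst_def)

lemma gamma_subst_eq: "gamma_subst * (1 - fps_X) = fps_X"
  unfolding gamma_subst_def by (simp add: mult.assoc inverse_mult_eq_1)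

lemma gamma_subst_power: "fps_nth (gamma_subst ^ Suc i) (Suc m) = of_nat (m choose i)"
proof -
  have "gamma_subst ^ Suc i * (1 - fps_X) = gamma_subst ^ i * (gamma_subst * (1 - fps_X))" for i
    by (simp add: mult_ac)
  then have rec: "gamma_subst ^ Suc i = fps_X * gamma_subst ^ i + fps_X * gamma_subst ^ Suc i" for i
    unfolding gamma_subst_eq by (simp add: algebra_simps)
  have step: "fps_nth (gamma_subst ^ Suc i) (Suc m) = fps_nth (gamma_subst ^ i) m
      + fps_nth (gamma_subst ^ Suc i) m" for i m
    by (subst rec) simp
  have zero: "fps_nth (gamma_subst ^ Suc i) 0 = 0" for i by simp
  show ?thesis
  proof (induction m arbitrary: i)
    case 0
    show ?case using step[of i 0] zero by (cases i) (simp_all del: power_Suc)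
  next
    case (Suc m)
    show ?case
    proof (cases i)
      case 0
      then show ?thesis using step[of 0 "Suc m"] Suc[of 0] by (simp del: power_Suc)
    next
      case (Suc i')
      then show ?thesis using step[of i "Suc m"] Suc.IH[of i'] Suc.IH[of i] by (simp del: power_Suc)
    qed
  qed
qed

text \<open>The substitution \<open>t = s / (1 - s)\<close> turns \<open>\<lambda>\<close> into \<open>\<gamma>\<close>; it is multiplicative, so that
  \<open>\<gamma>\<close> inherits the addition formula of \<open>\<lambda>\<close>.\<close>

lemma fps_nth_mult_one_plus_X_power:
  "fps_nth (F * (1 + fps_X) ^ m) (Suc m) = fps_nth (F oo gamma_subst) (Suc m)"
proof -
  have "fps_nth (F * (1 + fps_X) ^ m) (Suc m) = (\<Sum>i=0..Suc m. fps_nth F i * of_nat (m choose (Suc m - i)))"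
    by (simp add: fps_mult_nth fps_nth_one_plus_X_power)
  also have "\<dots> = (\<Sum>i=0..Suc m. fps_nth F i * fps_nth (gamma_subst ^ i) (Suc m))"
  proof (rule sum.cong[OF HOL.refl])
    fix i assume i: "i \<in> {0..Suc m}"
    show "fps_nth F i * of_nat (m choose (Suc m - i)) = fps_nth F i * fps_nth (gamma_subst ^ i) (Suc m)"
    proof (cases i)
      case (Suc l)
      then have "m choose (Suc m - i) = m choose l" using i binomial_symmetric[of l m] by simp
      then show ?thesis unfolding Suc gamma_subst_power by simp
    qed simp
  qed
  finally show ?thesis by (simp add: fps_compose_nth)
qed

definition gamma_fps :: "('g, 'm) monoid_scheme \<Rightarrow> ('g \<Rightarrow> complex) \<Rightarrow> 'g \<Rightarrow> complex fps" where
  "gamma_fps G x g = lambda_fps G x g oo gamma_subst"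

lemma gamma_fps_add:
  assumes "group G" "g \<in> carrier G"
  shows "gamma_fps G (\<lambda>g\<in>carrier G. x g + y g) g = gamma_fps G x g * gamma_fps G y g"
  by (simp only: gamma_fps_def lambda_fps_add[OF assms] fps_compose_mult_distrib[OF gamma_subst_0])

lemma lambda_fps_of_nat:
  assumes "group G" "g \<in> carrier G"
  shows "lambda_fps G (\<lambda>g\<in>carrier G. of_nat m) g = (1 + fps_X) ^ m"
proof -
  interpret group G by fact
  have "elementary_fps (\<lambda>_. of_nat m) = (1 + fps_X) ^ m"
    using elementary_fps_power_sum[of "replicate m 1"] by (simp add: sum_list_replicate)
  then show ?thesis using assms(2) by (simp add: lambda_fps_def)
qed

lemma gamma_fps_0 [simp]: "fps_nth (gamma_fps G x g) 0 = 1"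
  by (simp add: gamma_fps_def)

lemma gamma_fps_shift:
  assumes "group G" "g \<in> carrier G"
  shows "gamma_fps G (\<lambda>g\<in>carrier G. x g - of_nat m) g = (lambda_fps G x g oo gamma_subst) * (1 - fps_X) ^ m"
proof -
  define y where "y = (\<lambda>g\<in>carrier G. x g - of_nat m)"
  have "lambda_fps G x g = lambda_fps G (\<lambda>g\<in>carrier G. y g + (\<lambda>g\<in>carrier G. of_nat m) g) g"
  proof -
    interpret group G by fact
    show ?thesis using assms(2) unfolding lambda_fps_def y_def by (simp cong: restrict_cong)
  qed
  also have "\<dots> = lambda_fps G y g * (1 + fps_X) ^ m"
    by (simp only: lambda_fps_add[OF assms] lambda_fps_of_nat[OF assms])
  finally have "lambda_fps G x g oo gamma_subst = gamma_fps G y g * (1 + gamma_subst) ^ m"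
    by (simp add: gamma_fps_def fps_compose_mult_distrib[OF gamma_subst_0] fps_compose_power[OF
        gamma_subst_0, symmetric]
        fps_compose_add_distrib)
  then have "(lambda_fps G x g oo gamma_subst) * (1 - fps_X) ^ m
      = gamma_fps G y g * ((1 + gamma_subst) * (1 - fps_X)) ^ m"
    by (simp add: power_mult_distrib mult_ac)
  also have "(1 + gamma_subst) * (1 - fps_X) = 1"
    by (simp add: distrib_right gamma_subst_eq)
  finally show ?thesis unfolding y_def by (simp only: power_one mult_1_right)
qed

context quaternion_reps
begin

lemma gamma_op_eq:
  assumes x: "x \<in> \<R>"
  shows "gamma_op G n x = (\<lambda>g\<in>carrier G. fps_nth (gamma_fps G x g) n)"
proof -
  have one: "add_pow (char_ring G) (int n - 1) \<one>\<^bsub>char_ring G\<^esub> = (\<lambda>g\<in>carrier G. of_int (int n - 1))"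
    unfolding R_add_pow[OF R.one_closed] by (rule restrict_ext) (simp add: char_ring_simps(3))
  have c: "(\<lambda>g\<in>carrier G. of_int (int n - 1)) \<in> \<R>"
    unfolding one[symmetric] using R.add.int_pow_closed by blast
  have "gamma_op G n x = lam n (\<lambda>g\<in>carrier G. x g + (\<lambda>g\<in>carrier G. of_int (int n - 1)) g)"
    unfolding gamma_op_def one char_ring_simps(4)
    by (rule lambda_op_eq) (rule char_ring_add[OF x c])
  also have "\<dots> = (\<lambda>g\<in>carrier G. fps_nth (gamma_fps G x g) n)"
    unfolding lam_def
  proof (rule restrict_ext)
    fix g assume g: "g \<in> carrier G"
    show "fps_nth (lambda_fps G (\<lambda>g\<in>carrier G. x g + (\<lambda>g\<in>carrier G. of_int (int n - 1)) g) g) n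
      = fps_nth (gamma_fps G x g) n"
    proof (cases n)
      case (Suc m)
      have e: "(\<lambda>g\<in>carrier G. of_int (int (Suc m) - 1)) = (\<lambda>g\<in>carrier G. of_nat m :: complex)" by simp
      show ?thesis
        unfolding Suc lambda_fps_add[OF is_group g] e lambda_fps_of_nat[OF is_group g]
          fps_nth_mult_one_plus_X_power gamma_fps_def ..
    qed simp
  qed
  finally show ?thesis .
qed

lemma gamma_fps_sign_char:
  assumes mn: "m \<le> 1" "n \<le> 1" and g: "g \<in> carrier G"
  shows "gamma_fps G (\<lambda>g\<in>carrier G. sign_char m n g - 1) g = 1 + fps_const (sign_char m n g - 1) * fps_X"
proof -
  let ?s = "fps_const (sign_char m n g)"
  have "gamma_fps G (\<lambda>g\<in>carrier G. (\<lambda>g\<in>carrier G. sign_char m n g) g - of_nat 1) g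
      = (1 + ?s * gamma_subst) * (1 - fps_X)"
    unfolding gamma_fps_shift[OF is_group g] lambda_fps_sign_char[OF assms]
    by (simp add: fps_compose_add_distrib fps_compose_mult_distrib[OF gamma_subst_0])
  also have "\<dots> = 1 - fps_X + ?s * (gamma_subst * (1 - fps_X))" by (simp add: algebra_simps)
  also have "\<dots> = 1 + fps_const (sign_char m n g - 1) * fps_X"
    unfolding gamma_subst_eq by (simp add: algebra_simps flip: fps_const_sub)
  finally show ?thesis by (simp cong: restrict_cong)
qed

lemma gamma_fps_\<Delta>:
  assumes g: "g \<in> carrier G"
  shows "gamma_fps G (\<lambda>g\<in>carrier G. - w g) g = 1 - fps_const (w g) * fps_X + fps_const (w g) * fps_X ^ 2"
proof -
  let ?d = "fps_const (character G \<Delta> g)"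
  have eq: "(\<lambda>g\<in>carrier G. - w g) = (\<lambda>g\<in>carrier G. character G \<Delta> g - of_nat 2)"
    by (rule restrict_ext) (simp add: w_def)
  have "gamma_fps G (\<lambda>g\<in>carrier G. - w g) g = (1 + ?d * gamma_subst + gamma_subst ^ 2) * (1 - fps_X) ^ 2"
    unfolding eq gamma_fps_shift[OF is_group g] lambda_fps_\<Delta>[OF assms]
    by (simp add: fps_compose_add_distrib
        fps_compose_mult_distrib[OF gamma_subst_0] fps_compose_power[OF gamma_subst_0, symmetric])
  also have "\<dots> = (1 - fps_X) ^ 2 + ?d * (gamma_subst * (1 - fps_X)) * (1 - fps_X)
      + (gamma_subst * (1 - fps_X)) ^ 2"
    by (simp add: algebra_simps power2_eq_square)
  also have "\<dots> = 1 - fps_const (w g) * fps_X + fps_const (w g) * fps_X ^ 2"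
    unfolding gamma_subst_eq w_def by (simp add: algebra_simps power2_eq_square flip: fps_const_sub)
  finally show ?thesis .
qed

end

section \<open>Weighted polynomials in three variables\<close>

abbreviation "single \<equiv> Poly_Mapping.single"
abbreviation "lookup \<equiv> Poly_Mapping.lookup"
abbreviation "keys \<equiv> Poly_Mapping.keys"

lemma poly_mapping_add_induct [consumes 1, case_names zero add]:
  assumes "keys p \<subseteq> S" and zero: "P 0"
    and add: "\<And>m c q. m \<in> S \<Longrightarrow> keys q \<subseteq> S \<Longrightarrow> P q \<Longrightarrow> P (single m c + q)"
  shows "P (p :: 'a \<Rightarrow>\<^sub>0 'b :: monoid_add)"
  using assms(1)
proof (induction p rule: update_induct)
  case const
  show ?case by (rule zero)
next
  case (update f m c)
  have eq: "Poly_Mapping.update m c f = single m c + f"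
    using update(1) by (intro poly_mapping_eqI)
      (auto simp: lookup_update lookup_add lookup_single when_def in_keys_iff)
  have keys: "keys (Poly_Mapping.update m c f) = insert m (keys f)"
    using update(2) by (simp add: Poly_Mapping.keys_update)
  show ?case using update(3,4) add[of m f c] unfolding eq[symmetric] keys by simp
qed

definition mono_value :: "'a :: comm_ring_1 \<Rightarrow> 'a \<Rightarrow> 'a \<Rightarrow> (variable \<Rightarrow>\<^sub>0 nat) \<Rightarrow> 'a" where
  "mono_value A B W m = A ^ lookup m Var_x * B ^ lookup m Var_y * W ^ lookup m Var_u"

definition poly_value :: "'a :: comm_ring_1 \<Rightarrow> 'a \<Rightarrow> 'a \<Rightarrow> int_poly_xyu \<Rightarrow> 'a" where
  "poly_value A B W p = (\<Sum>m\<in>keys p. of_int (lookup p m) * mono_value A B W m)"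

lemma mono_value_add: "mono_value A B W (m + n) = mono_value A B W m * mono_value A B W n"
  by (simp add: mono_value_def lookup_add power_add mult_ac)

lemma poly_value_superset:
  assumes "finite S" "keys p \<subseteq> S"
  shows "poly_value A B W p = (\<Sum>m\<in>S. of_int (lookup p m) * mono_value A B W m)"
  unfolding poly_value_def using assms by (intro sum.mono_neutral_left)
      (auto simp: not_in_keys_iff_lookup_eq_zero)

lemma poly_value_0 [simp]: "poly_value A B W 0 = 0"
  by (simp add: poly_value_def)

lemma poly_value_single: "poly_value A B W (single m c) = of_int c * mono_value A B W m"
  by (simp add: poly_value_def)

lemma poly_value_add: "poly_value A B W (p + q) = poly_value A B W p + poly_value A B W q"
proof -
  let ?S = "keys p \<union> keys q"
  have "poly_value A B W (p + q) = (\<Sum>m\<in>?S. of_int (lookup (p + q) m) * mono_value A B W m)"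
    using keys_add[of p q] by (intro poly_value_superset) auto
  also have "\<dots> = (\<Sum>m\<in>?S. of_int (lookup p m) * mono_value A B W m)
      + (\<Sum>m\<in>?S. of_int (lookup q m) * mono_value A B W m)"
    by (simp add: lookup_add algebra_simps sum.distrib)
  finally show ?thesis by (simp add: poly_value_superset[of ?S])
qed

lemma poly_value_uminus: "poly_value A B W (- p) = - poly_value A B W p"
  using poly_value_add[of A B W p "- p"] by (simp add: eq_neg_iff_add_eq_0 add.commute)

lemma poly_value_diff: "poly_value A B W (p - q) = poly_value A B W p - poly_value A B W q"
  using poly_value_add[of A B W p "- q"] by (simp add: poly_value_uminus)

lemma poly_value_single_mult:
  "poly_value A B W (single m c * q) = of_int c * mono_value A B W m * poly_value A B W q"
proof (induction q rule: poly_mapping_add_induct[OF subset_UNIV])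
  case 2
  then show ?case
    by (simp add: distrib_left poly_value_add mult_single poly_value_single mono_value_add algebra_simps)
qed simp

lemma poly_value_mult: "poly_value A B W (p * q) = poly_value A B W p * poly_value A B W q"
proof (induction p rule: poly_mapping_add_induct[OF subset_UNIV])
  case 2
  then show ?case by (simp add: distrib_right poly_value_add poly_value_single_mult poly_value_single)
qed simp

lemma poly_value_1: "poly_value A B W 1 = 1"
  unfolding single_one[symmetric] poly_value_single by (simp add: mono_value_def)

lemma poly_value_numeral: "poly_value A B W (numeral n) = numeral n"
  unfolding single_numeral[symmetric] poly_value_single by (simp add: mono_value_def)

lemma poly_value_power: "poly_value A B W (p ^ n) = poly_value A B W p ^ n"
  by (induction n) (simp_all add: poly_value_1 poly_value_mult)

lemma poly_value_var:
  "poly_value A B W (poly_var Var_x) = A" "poly_value A B W (poly_var Var_y)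
      = B" "poly_value A B W (poly_var Var_u) = W"
  by (simp_all add: poly_var_def poly_value_single mono_value_def lookup_single)

definition weight :: "(variable \<Rightarrow>\<^sub>0 nat) \<Rightarrow> nat" where
  "weight m = lookup m Var_x + lookup m Var_y + 2 * lookup m Var_u"

lemma weight_add: "weight (m + n) = weight m + weight n"
  by (simp add: weight_def lookup_add)

text \<open>The value of the homogeneous component of weight \<open>n\<close> is read off as the coefficient of
  \<open>t\<^sup>n\<close> in the value at \<open>(A t, B t, W t\<^sup>2)\<close>, which is visibly a ring homomorphism in \<open>p\<close>.\<close>

definition graded_value :: "complex \<Rightarrow> complex \<Rightarrow> complex \<Rightarrow> int_poly_xyu \<Rightarrow> complex fps" where
  "graded_value A B W = poly_value (fps_const A * fps_X) (fps_const B * fps_X) (fps_const W * fps_X ^ 2)"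

lemma graded_value_single:
  "graded_value A B W (single m c) = fps_const (of_int c * mono_value A B W m) * fps_X ^ weight m"
  by (simp add: graded_value_def poly_value_single mono_value_def weight_def power_mult_distrib power_add
      power_mult fps_const_power fps_of_int[symmetric] flip: fps_const_mult) 

lemma graded_value_nth:
  "fps_nth (graded_value A B W p) n = (\<Sum>m\<in>{m \<in> keys p. weight m
      = n}. of_int (lookup p m) * mono_value A B W m)"
proof -
  have "fps_nth (graded_value A B W p) n
      = (\<Sum>m\<in>keys p. fps_nth (graded_value A B W (single m (lookup p m))) n)"
    unfolding graded_value_def by (simp add: poly_value_def[of _ _ _ p] poly_value_single fps_sum_nth)
  also have "\<dots> = (\<Sum>m\<in>keys p. if weight m = n then of_int (lookup p m) * mono_value A B W m else 0)"
    by (rule sum.cong) (auto simp: graded_value_single fps_X_power_nth)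
  also have "\<dots> = (\<Sum>m\<in>{m \<in> keys p. weight m = n}. of_int (lookup p m) * mono_value A B W m)"
    by (simp add: sum.If_cases Int_def)
  finally show ?thesis .
qed

definition xyu :: "nat \<Rightarrow> nat \<Rightarrow> nat \<Rightarrow> (variable \<Rightarrow>\<^sub>0 nat)" where
  "xyu i j k = single Var_x i + single Var_y j + single Var_u k"

lemma lookup_xyu [simp]: "lookup (xyu i j k) Var_x = i" "lookup (xyu i j k) Var_y
    = j" "lookup (xyu i j k) Var_u = k"
  by (simp_all add: xyu_def lookup_add lookup_single)

lemma eq_xyu: "m = xyu (lookup m Var_x) (lookup m Var_y) (lookup m Var_u)"
proof (rule poly_mapping_eqI)
  fix v show "lookup m v = lookup (xyu (lookup m Var_x) (lookup m Var_y) (lookup m Var_u)) v"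
    by (cases v) simp_all
qed

lemma xyu_eq_iff: "xyu i j k = xyu i' j' k' \<longleftrightarrow> i = i' \<and> j = j' \<and> k = k'"
  by (metis lookup_xyu)

lemma xyu_add: "xyu i j k + xyu i' j' k' = xyu (i + i') (j + j') (k + k')"
  by (rule poly_mapping_eqI, rename_tac v, case_tac v) (simp_all add: lookup_add)

lemma weight_xyu: "weight (xyu i j k) = i + j + 2 * k"
  by (simp add: weight_def)

lemma mono_value_xyu: "mono_value A B W (xyu i j k) = A ^ i * B ^ j * W ^ k"
  by (simp add: mono_value_def)

lemma poly_var_xyu:
  "poly_var Var_x = single (xyu 1 0 0) 1" "poly_var Var_y = single (xyu 0 1 0) 1"
  "poly_var Var_u = single (xyu 0 0 1) 1"
  by (simp_all add: poly_var_def xyu_def)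

definition order_ge :: "nat \<Rightarrow> int_poly_xyu set" where
  "order_ge n = {p. \<forall>m\<in>keys p. n \<le> weight m}"

lemma order_ge_0: "0 \<in> order_ge n"
  by (simp add: order_ge_def)

lemma order_ge_add: "p \<in> order_ge n \<Longrightarrow> q \<in> order_ge n \<Longrightarrow> p + q \<in> order_ge n"
  using keys_add[of p q] by (auto simp: order_ge_def)

lemma order_ge_uminus: "p \<in> order_ge n \<Longrightarrow> - p \<in> order_ge n"
  by (simp add: order_ge_def)

lemma order_ge_mult: "p \<in> order_ge m \<Longrightarrow> q \<in> order_ge n \<Longrightarrow> p * q \<in> order_ge (m + n)"
  using keys_mult[of p q] by (fastforce simp: order_ge_def weight_add intro: add_mono)

lemma order_ge_mono: "m \<le> n \<Longrightarrow> p \<in> order_ge n \<Longrightarrow> p \<in> order_ge m"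
  by (auto simp: order_ge_def)

lemma order_ge_zero: "p \<in> order_ge 0"
  by (simp add: order_ge_def)

lemma order_ge_var: "poly_var Var_x \<in> order_ge 1" "poly_var Var_y \<in> order_ge 1" "poly_var Var_u
    \<in> order_ge 2"
  by (simp_all add: order_ge_def poly_var_xyu weight_xyu)

context quaternion_reps
begin

section \<open>The \<open>\<gamma>\<close>-filtration\<close>

definition ev :: "int_poly_xyu \<Rightarrow> 'a \<Rightarrow> complex" where
  "ev p = (\<lambda>g\<in>carrier G. poly_value (a g) (b g) (w g) p)"

definition EF :: "nat \<Rightarrow> ('a \<Rightarrow> complex) set" where
  "EF n = ev ` order_ge n"

lemma ev_add: "(\<lambda>g\<in>carrier G. ev p g + ev q g) = ev (p + q)"
  unfolding ev_def by (rule restrict_ext) (simp add: poly_value_add)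

lemma ev_mult: "(\<lambda>g\<in>carrier G. ev p g * ev q g) = ev (p * q)"
  unfolding ev_def by (rule restrict_ext) (simp add: poly_value_mult)

lemma ev_uminus: "(\<lambda>g\<in>carrier G. - ev p g) = ev (- p)"
  unfolding ev_def by (rule restrict_ext) (simp add: poly_value_uminus)

lemma ev_0: "(\<lambda>g\<in>carrier G. 0) = ev 0"
  unfolding ev_def by (rule restrict_ext) simp

lemma ev_1: "(\<lambda>g\<in>carrier G. 1) = ev 1"
  unfolding ev_def by (rule restrict_ext) (simp add: poly_value_1)

lemma ev_var:
  "ev (poly_var Var_x) = ch 0 1 0 0 0" "ev (poly_var Var_y) = ch 0 0 1 0 0" "ev (poly_var Var_u)
      = ch 0 0 0 0 1"
  unfolding ev_def ch_def by (rule restrict_ext, simp add: poly_value_var)+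

lemma char_ring_power:
  assumes "x \<in> \<R>"
  shows "(\<lambda>g\<in>carrier G. x g ^ n) \<in> \<R>"
proof (induction n)
  case 0
  show ?case unfolding power_0 by (rule char_ring_one)
next
  case (Suc n)
  have "(\<lambda>g\<in>carrier G. x g ^ Suc n) = (\<lambda>g\<in>carrier G. x g * (\<lambda>g\<in>carrier G. x g ^ n) g)"
    by (rule restrict_ext) simp
  then show ?case using char_ring_mult[OF assms Suc] by (simp only:)
qed

lemma ev_closed: "ev p \<in> \<R>"
proof (induction p rule: poly_mapping_add_induct[OF subset_UNIV])
  case 1
  show ?case unfolding ev_0[symmetric] by (rule char_ring_zero)
next
  case (2 m c q)
  let ?p = "\<lambda>x n. \<lambda>g\<in>carrier G. x g ^ n"
  let ?m = "\<lambda>x y. \<lambda>g\<in>carrier G. x g * y g"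
  have "(\<lambda>g\<in>carrier G. of_int c * (?m (?m (?p (ch 0 1 0 0 0) (lookup m Var_x))
      (?p (ch 0 0 1 0 0) (lookup m Var_y))) (?p (ch 0 0 0 0 1) (lookup m Var_u))) g)
      \<in> \<R>"
    by (intro char_ring_smult char_ring_mult char_ring_power ch_carrier)
  also have "(\<lambda>g\<in>carrier G. of_int c * (?m (?m (?p (ch 0 1 0 0 0) (lookup m Var_x))
      (?p (ch 0 0 1 0 0) (lookup m Var_y))) (?p (ch 0 0 0 0 1) (lookup m Var_u))) g)
      = ev (single m c)"
    unfolding ev_def by (rule restrict_ext) (simp add: poly_value_single mono_value_def ch_def)
  finally show ?case unfolding ev_add[symmetric] using 2 by (intro char_ring_add)
qed

lemma EF_subset: "EF n \<subseteq> \<R>"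
  using ev_closed by (auto simp: EF_def)

lemma EF_zero: "(\<lambda>g\<in>carrier G. 0) \<in> EF n"
  unfolding EF_def ev_0 using order_ge_0 by blast

lemma EF_add: "x \<in> EF n \<Longrightarrow> y \<in> EF n \<Longrightarrow> (\<lambda>g\<in>carrier G. x g + y g) \<in> EF n"
  unfolding EF_def using order_ge_add by (auto simp: ev_add)

lemma EF_uminus: "x \<in> EF n \<Longrightarrow> (\<lambda>g\<in>carrier G. - x g) \<in> EF n"
  unfolding EF_def using order_ge_uminus by (auto simp: ev_uminus)

lemma EF_mult: "x \<in> EF m \<Longrightarrow> y \<in> EF n \<Longrightarrow> (\<lambda>g\<in>carrier G. x g * y g) \<in> EF (m + n)"
  unfolding EF_def using order_ge_mult by (auto simp: ev_mult)

lemma EF_mono: "m \<le> n \<Longrightarrow> EF n \<subseteq> EF m"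
  unfolding EF_def using order_ge_mono by blast

lemma EF_one: "(\<lambda>g\<in>carrier G. 1) \<in> EF 0"
  unfolding EF_def ev_1 using order_ge_zero by blast

lemma EF_generators: "ch 0 1 0 0 0 \<in> EF 1" "ch 0 0 1 0 0 \<in> EF 1" "ch 0 0 0 0 1 \<in> EF 2"
  unfolding EF_def ev_var[symmetric] using order_ge_var by blast+

lemma EF_0: "EF 0 = \<R>"
proof
  show "\<R> \<subseteq> EF 0"
  proof
    fix x assume "x \<in> \<R>"
    then obtain c0 c1 c2 c3 c4 where x: "x = ch c0 c1 c2 c3 c4" unfolding carrier_char_ring by blast
    have of_int: "poly_value A B W (single 0 c) = of_int c" for A B W :: complex and c
      by (simp add: poly_value_single mono_value_def)
    have "x = ev (single 0 c0 + single 0 c1 * poly_var Var_x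
        + single 0 c2 * poly_var Var_y + single 0 c3 * (poly_var Var_x * poly_var Var_y)
        + single 0 c4 * poly_var Var_u)"
      unfolding x ch_def ev_def
      by (rule restrict_ext) (simp add: poly_value_add poly_value_mult poly_value_var of_int)
    then show "x \<in> EF 0" unfolding EF_def using order_ge_zero by blast
  qed
qed (rule EF_subset)

lemma EF_sum:
  assumes "finite A" "\<And>m. m \<in> A \<Longrightarrow> x m \<in> EF n"
  shows "(\<lambda>g\<in>carrier G. \<Sum>m\<in>A. x m g) \<in> EF n"
  using assms
proof (induction A rule: finite_induct)
  case empty
  then show ?case unfolding sum.empty by (intro EF_zero)
next
  case (insert m A)
  have "(\<lambda>g\<in>carrier G. \<Sum>m\<in>insert m A. x m g) = (\<lambda>g\<in>carrier G. x m g + (\<lambda>g\<in>carrier G. \<Sum>m\<in>A. x m g) g)"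
    using insert by (intro restrict_ext) simp
  moreover have "(\<lambda>g\<in>carrier G. x m g + (\<lambda>g\<in>carrier G. \<Sum>m\<in>A. x m g) g) \<in> EF n"
    using insert by (intro EF_add) auto
  ultimately show ?case by (simp only:)
qed

lemma EF_conv:
  assumes "finite A" "\<And>m. m \<in> A \<Longrightarrow> m \<le> n" "\<And>m. m \<in> A \<Longrightarrow> x m \<in> EF m" "\<And>m. m \<in> A \<Longrightarrow> y m \<in> EF (n - m)"
  shows "(\<lambda>g\<in>carrier G. \<Sum>m\<in>A. x m g * y m g) \<in> EF n"
proof -
  have "(\<lambda>g\<in>carrier G. \<Sum>m\<in>A. (\<lambda>g\<in>carrier G. x m g * y m g) g) \<in> EF n"
  proof (rule EF_sum[OF assms(1)])
    fix m assume m: "m \<in> A"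
    from EF_mult[OF assms(3)[OF m] assms(4)[OF m]] show "(\<lambda>g\<in>carrier G. x m g * y m g) \<in> EF n"
      using assms(2)[OF m] by (simp only: le_add_diff_inverse)
  qed
  moreover have "(\<lambda>g\<in>carrier G. \<Sum>m\<in>A. (\<lambda>g\<in>carrier G. x m g * y m g) g)
      = (\<lambda>g\<in>carrier G. \<Sum>m\<in>A. x m g * y m g)"
    by (rule restrict_ext) simp
  ultimately show ?thesis by (simp only:)
qed

definition gam :: "nat \<Rightarrow> ('a \<Rightarrow> complex) \<Rightarrow> 'a \<Rightarrow> complex" where
  "gam n x = (\<lambda>g\<in>carrier G. fps_nth (gamma_fps G x g) n)"

definition gamma_adapted :: "('a \<Rightarrow> complex) \<Rightarrow> bool" where
  "gamma_adapted x \<longleftrightarrow> (\<forall>n. gam n x \<in> EF n)"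

lemma gamma_adapted_add:
  assumes "gamma_adapted x" "gamma_adapted y"
  shows "gamma_adapted (\<lambda>g\<in>carrier G. x g + y g)"
  unfolding gamma_adapted_def
proof
  fix n
  have "gam n (\<lambda>g\<in>carrier G. x g + y g) = (\<lambda>g\<in>carrier G. \<Sum>m\<in>{0..n}. gam m x g * gam (n - m) y g)"
    unfolding gam_def by (rule restrict_ext) (simp only: gamma_fps_add[OF is_group] fps_mult_nth
        restrict_apply if_True)
  moreover have "(\<lambda>g\<in>carrier G. \<Sum>m\<in>{0..n}. gam m x g * gam (n - m) y g) \<in> EF n"
    by (rule EF_conv) (use assms in \<open>auto simp: gamma_adapted_def\<close>)
  ultimately show "gam n (\<lambda>g\<in>carrier G. x g + y g) \<in> EF n" by (simp only:)
qed

lemma gamma_adapted_zero: "gamma_adapted (\<lambda>g\<in>carrier G. 0)"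
  unfolding gamma_adapted_def
proof
  fix n
  have "gam n (\<lambda>g\<in>carrier G. 0) = (if n = 0 then (\<lambda>g\<in>carrier G. 1) else (\<lambda>g\<in>carrier G. 0))"
    unfolding gam_def gamma_fps_def
    by (auto intro!: restrict_ext simp: lambda_fps_zero[OF is_group])
  then show "gam n (\<lambda>g\<in>carrier G. 0) \<in> EF n" using EF_one EF_zero by metis
qed

lemma gamma_adapted_uminus:
  assumes x: "gamma_adapted x"
  shows "gamma_adapted (\<lambda>g\<in>carrier G. - x g)"
  unfolding gamma_adapted_def gam_def
proof (rule allI, rule fps_inverse_coefficients[where F = "gamma_fps G x"])
  show "gamma_fps G x g * gamma_fps G (\<lambda>g\<in>carrier G. - x g) g = 1" if "g \<in> carrier G" for g
    unfolding gamma_fps_def fps_compose_mult_distrib[OF gamma_subst_0, symmetric]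
      lambda_fps_uminus[OF is_group that] by simp
  show "(\<lambda>g\<in>carrier G. fps_nth (gamma_fps G x g) n) \<in> EF n" for n
    using x by (simp only: gamma_adapted_def gam_def)
  show "(\<lambda>g\<in>carrier G. \<Sum>m\<in>{1..n}. y m g * z m g) \<in> EF n"
    if "\<And>m. m \<in> {1..n} \<Longrightarrow> y m \<in> EF m" "\<And>m. m \<in> {1..n} \<Longrightarrow> z m \<in> EF (n - m)" for n y z
    by (rule EF_conv) (use that in auto)
qed (rule gamma_fps_0 EF_one EF_uminus; assumption?)+

lemma gamma_adapted_smult: "gamma_adapted x \<Longrightarrow> gamma_adapted (\<lambda>g\<in>carrier G. of_int n * x g)"
  by (rule int_multiple_induct[of gamma_adapted, OF _ gamma_adapted_zero]) (assumption | rule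
      gamma_adapted_add gamma_adapted_uminus)+

lemma gam_sign_char:
  assumes ml: "m \<le> 1" "l \<le> 1"
  shows "gam n (ch 0 (int m) (int l) (int (m * l)) 0)
    = (if n = 0 then (\<lambda>g\<in>carrier G. 1) else if n = 1 then ch 0 (int m) (int l) (int (m * l)) 0 else
        (\<lambda>g\<in>carrier G. 0))"
proof -
  have ch: "ch 0 (int m) (int l) (int (m * l)) 0 = (\<lambda>g\<in>carrier G. sign_char m l g - 1)"
    unfolding ch_def by (rule restrict_ext) (simp add: sign_char_def algebra_simps)
  show ?thesis unfolding gam_def ch
    by (auto intro!: restrict_ext simp: gamma_fps_sign_char[OF ml])
qed

lemma gam_\<Delta>:
  "gam n (ch 0 0 0 0 (-1))
    = (if n = 0 then (\<lambda>g\<in>carrier G. 1) else if n = 1 then ch 0 0 0 0 (-1) else if n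
        = 2 then ch 0 0 0 0 1 else (\<lambda>g\<in>carrier G. 0))"
proof -
  have ch: "ch 0 0 0 0 (-1) = (\<lambda>g\<in>carrier G. - w g)" "ch 0 0 0 0 1 = (\<lambda>g\<in>carrier G. w g)"
    unfolding ch_def by (rule restrict_ext, simp)+
  show ?thesis unfolding gam_def ch
    by (auto intro!: restrict_ext simp: gamma_fps_\<Delta> fps_X_power_nth)
qed

lemma gamma_adapted_generators:
  "gamma_adapted (ch 0 1 0 0 0)" "gamma_adapted (ch 0 0 1 0 0)" "gamma_adapted (ch 0 1 1 1 0)"
      "gamma_adapted (ch 0 0 0 0 (-1))"
proof -
  have sign: "gamma_adapted (ch 0 (int m) (int l) (int (m * l)) 0)"
    if "m \<le> 1" "l \<le> 1" and 1: "ch 0 (int m) (int l) (int (m * l)) 0 \<in> EF 1" for m l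
    unfolding gamma_adapted_def gam_sign_char[OF that(1,2)] using EF_one EF_zero 1 by simp
  show "gamma_adapted (ch 0 1 0 0 0)" using sign[of 1 0] EF_generators by simp
  show "gamma_adapted (ch 0 0 1 0 0)" using sign[of 0 1] EF_generators by simp
  have "(\<lambda>g\<in>carrier G. ch 0 1 0 0 0 g * ch 0 0 1 0 0 g) = ch 0 0 0 1 0"
    unfolding ch_def by (rule restrict_ext) simp
  then have "ch 0 0 0 1 0 \<in> EF 1"
    using EF_mult[OF EF_generators(1,2)] EF_mono[of 1 "1 + 1"] by auto
  from EF_add[OF this EF_add[OF EF_generators(1,2)]] have "ch 0 1 1 1 0 \<in> EF 1"
    by (simp only: ch_add) simp
  then show "gamma_adapted (ch 0 1 1 1 0)" using sign[of 1 1] by simp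
  have "ch 0 0 0 0 (-1) \<in> EF 2" using EF_uminus[OF EF_generators(3)] by (simp only: ch_uminus) simp
  then have "ch 0 0 0 0 (-1) \<in> EF 1" using EF_mono[of 1 2] by auto
  then show "gamma_adapted (ch 0 0 0 0 (-1))"
    unfolding gamma_adapted_def gam_\<Delta> using EF_one EF_zero EF_generators(3) by simp
qed

lemma augmentation_ch: "augmentation G (ch c0 c1 c2 c3 c4) = c0"
  unfolding augmentation_def by (rule the_equality) (simp_all add: ch_def values_at)

lemma augmentation_ideal_eq: "augmentation_ideal G = {ch 0 c1 c2 c3 c4 | c1 c2 c3 c4. True}"
proof -
  have "augmentation_ideal G = {x \<in> \<R>. augmentation G x = 0}"
    unfolding augmentation_ideal_def a_kernel_def' by simp
  also have "\<dots> = {ch 0 c1 c2 c3 c4 | c1 c2 c3 c4. True}"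
    unfolding carrier_char_ring by (auto simp: augmentation_ch) blast+
  finally show ?thesis .
qed

lemma ch_augmentation_ideal: "ch 0 c1 c2 c3 c4 \<in> augmentation_ideal G"
  unfolding augmentation_ideal_eq by blast

lemma gamma_adapted_augmentation_ideal:
  assumes "x \<in> augmentation_ideal G"
  shows "gamma_adapted x"
proof -
  obtain c1 c2 c3 c4 where x: "x = ch 0 c1 c2 c3 c4" using assms unfolding augmentation_ideal_eq by blast
  let ?s = "\<lambda>n x. \<lambda>g\<in>carrier G. of_int n * x g"
  let ?p = "\<lambda>x y. \<lambda>g\<in>carrier G. x g + y g"
  have "gamma_adapted (?p (?s (c1 - c3) (ch 0 1 0 0 0)) (?p (?s (c2 - c3) (ch 0 0 1 0 0))
    (?p (?s c3 (ch 0 1 1 1 0)) (?s (- c4) (ch 0 0 0 0 (-1))))))"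
    by (intro gamma_adapted_add gamma_adapted_smult gamma_adapted_generators)
  moreover have "?p (?s (c1 - c3) (ch 0 1 0 0 0)) (?p (?s (c2 - c3) (ch 0 0 1 0 0))
    (?p (?s c3 (ch 0 1 1 1 0)) (?s (- c4) (ch 0 0 0 0 (-1))))) = x"
    unfolding x ch_def by (rule restrict_ext) (simp add: algebra_simps)
  ultimately show ?thesis by (simp only:)
qed

lemma subgroup_EF: "subgroup (EF n) (add_monoid (char_ring G))"
proof (rule R.add.subgroupI)
  show "EF n \<subseteq> \<R>" by (rule EF_subset)
  show "EF n \<noteq> {}" using EF_zero by blast
  show "\<ominus>\<^bsub>char_ring G\<^esub> x \<in> EF n" if "x \<in> EF n" for x
  proof -
    have "x \<in> \<R>" using that EF_subset by blast
    then show ?thesis using EF_uminus[OF that] by (simp only: R_uminus)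
  qed
  show "x \<oplus>\<^sub>c y \<in> EF n" if "x \<in> EF n" "y \<in> EF n" for x y
    using EF_add[OF that] by (simp only: char_ring_simps(4))
qed

abbreviation "gamma_step \<equiv> (\<lambda>(i, a) b. gamma_op G i a \<otimes>\<^sub>c b)"

lemma gamma_products_subset: "gamma_products G n \<subseteq> EF n"
proof -
  have *: "foldr gamma_step ps \<one>\<^bsub>char_ring G\<^esub> \<in> EF (sum_list (map fst ps))"
    if "snd ` set ps \<subseteq> augmentation_ideal G" for ps
    using that
  proof (induction ps)
    case Nil
    show ?case using EF_one by (simp only: foldr.simps id_apply list.map sum_list.Nil char_ring_simps(3))
  next
    case (Cons p ps)
    obtain i x where p: "p = (i, x)" by (cases p)
    have x: "x \<in> augmentation_ideal G" using Cons.prems p by auto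
    then have "x \<in> \<R>" unfolding augmentation_ideal_eq by auto
    then have "gamma_op G i x = gam i x" by (simp only: gamma_op_eq gam_def)
    then have "gamma_op G i x \<in> EF i" using gamma_adapted_augmentation_ideal[OF x] by
        (simp add: gamma_adapted_def)
    from EF_mult[OF this Cons.IH] Cons.prems show ?case
      by (simp add: p char_ring_simps(5) del: restrict_apply)
  qed
  show ?thesis unfolding gamma_products_def
  proof clarify
    fix ps assume ps: "snd ` set ps \<subseteq> augmentation_ideal G" "n \<le> sum_list (map fst ps)"
    from *[OF ps(1)] EF_mono[OF ps(2)]
    show "foldr gamma_step ps \<one>\<^bsub>char_ring G\<^esub> \<in> EF n" by blast
  qed
qed

lemma gamma_op_1:
  assumes "x \<in> {ch 0 1 0 0 0, ch 0 0 1 0 0}"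
  shows "gamma_op G 1 x = x"
proof -
  have x: "x \<in> \<R>" using assms by auto
  have "gamma_op G 1 x = gam 1 x" using gamma_op_eq[OF x] by (simp only: gam_def)
  also have "\<dots> = x" using assms gam_sign_char[of 1 0 1] gam_sign_char[of 0 1 1] by auto
  finally show ?thesis .
qed

lemma gamma_op_2: "gamma_op G 2 (ch 0 0 0 0 (-1)) = ch 0 0 0 0 1"
  using gamma_op_eq[OF ch_carrier, of 2 0 0 0 0 "-1"] gam_\<Delta>[of 2] by (simp only: gam_def) simp

lemma foldr_gamma_replicate:
  assumes "gamma_op G n x = y"
  shows "foldr gamma_step (replicate m (n, x)) (\<lambda>g\<in>carrier G. f g)
    = (\<lambda>g\<in>carrier G. y g ^ m * f g)"
proof (induction m)
  case (Suc m)
  have "foldr gamma_step (replicate (Suc m) (n, x)) (\<lambda>g\<in>carrier G. f g)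
    = (\<lambda>g\<in>carrier G. y g * (\<lambda>g\<in>carrier G. y g ^ m * f g) g)"
    unfolding replicate_Suc foldr.simps comp_apply Suc by (simp only: prod.case assms char_ring_simps(5))
  also have "\<dots> = (\<lambda>g\<in>carrier G. y g ^ Suc m * f g)" by (rule restrict_ext) simp
  finally show ?case .
qed simp

lemma monomial_gamma_product:
  assumes "n \<le> weight m"
  shows "ev (single m 1) \<in> gamma_products G n"
proof -
  let ?i = "lookup m Var_x" and ?j = "lookup m Var_y" and ?k = "lookup m Var_u"
  let ?a = "ch 0 1 0 0 0" and ?b = "ch 0 0 1 0 0" and ?w = "ch 0 0 0 0 (-1)"
  let ?ps = "replicate ?i (1, ?a) @ replicate ?j (1, ?b) @ replicate ?k (2, ?w)"
  have "foldr gamma_step ?ps \<one>\<^bsub>char_ring G\<^esub>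
    = (\<lambda>g\<in>carrier G. ch 0 1 0 0 0 g ^ ?i * (ch 0 0 1 0 0 g ^ ?j * (ch 0 0 0 0 1 g ^ ?k * 1)))"
    unfolding foldr_append char_ring_simps(3) foldr_gamma_replicate[OF gamma_op_2]
      foldr_gamma_replicate[OF gamma_op_1[OF insertI1]]
      foldr_gamma_replicate[OF gamma_op_1[OF insertI2[OF insertI1]]] ..
  also have "\<dots> = ev (single m 1)"
    unfolding ev_def by (rule restrict_ext) (simp add: poly_value_single mono_value_def ch_def)
  finally have foldr_eq: "ev (single m 1) = foldr gamma_step ?ps \<one>\<^bsub>char_ring G\<^esub>"
    by (rule HOL.sym)
  have ideal: "snd ` set ?ps \<subseteq> augmentation_ideal G" by (auto simp: ch_augmentation_ideal)
  have "sum_list (map fst ?ps) = weight m"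
    by (simp add: weight_def sum_list_replicate)
  then have "n \<le> sum_list (map fst ?ps)" using assms by (simp only:)
  then show ?thesis unfolding gamma_products_def
    by (intro CollectI exI[of _ ?ps] conjI foldr_eq ideal)
qed

lemma gamma_filtration_eq: "gamma_filtration G n = EF n"
proof
  show "gamma_filtration G n \<subseteq> EF n"
    unfolding gamma_filtration_def by (rule R.add.generate_subgroup_incl[OF gamma_products_subset
        subgroup_EF])
  have "gamma_products G n \<subseteq> \<R>"
    using gamma_products_subset EF_subset by blast
  then have sub: "subgroup (gamma_filtration G n) (add_monoid (char_ring G))"
    unfolding gamma_filtration_def by (rule R.add.generate_is_subgroup)
  show "EF n \<subseteq> gamma_filtration G n"
  proof
    fix x assume "x \<in> EF n"
    then obtain p where x: "x = ev p" and p: "p \<in> order_ge n" by (auto simp: EF_def)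
    have "keys p \<subseteq> {m. n \<le> weight m}" using p by (auto simp: order_ge_def)
    then have "ev p \<in> gamma_filtration G n"
    proof (induction p rule: poly_mapping_add_induct)
      case zero
      show ?case using subgroup.one_closed[OF sub] by (simp add: char_ring_simps(2) ev_0[symmetric] del:
          restrict_apply)
    next
      case (add m c q)
      have "ev (single m 1) \<in> gamma_filtration G n"
        using monomial_gamma_product add(1) unfolding gamma_filtration_def by (auto intro: generate.incl)
      then have "add_pow (char_ring G) c (ev (single m 1)) \<in> gamma_filtration G n"
        by (rule R.add.subgroup_int_pow_closed[OF sub])
      also have "add_pow (char_ring G) c (ev (single m 1)) = ev (single m c)"
        unfolding R_add_pow[OF ev_closed] unfolding ev_def by (rule restrict_ext)
            (simp add: poly_value_single)
      finally have "ev (single m c) \<oplus>\<^sub>c ev q \<in> gamma_filtration G n"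
        using subgroup.m_closed[OF sub _ add(3)] by simp
      then show ?case by (simp only: char_ring_simps(4) ev_add)
    qed
    then show "x \<in> gamma_filtration G n" unfolding x .
  qed
qed

end

section \<open>Associated graded rings\<close>

lemma (in cring) rcoset_mult_cosets:
  assumes I: "ideal I R" and AB: "A \<subseteq> carrier R" "B \<subseteq> carrier R" "\<zero> \<in> A" "\<zero> \<in> B"
    and xy: "x \<in> carrier R" "y \<in> carrier R"
    and A: "\<And>h. h \<in> A \<Longrightarrow> h \<otimes> y \<in> I" and B: "\<And>h. h \<in> B \<Longrightarrow> x \<otimes> h \<in> I"
    and prod: "\<And>h h'. h \<in> A \<Longrightarrow> h' \<in> B \<Longrightarrow> h \<otimes> h' \<in> I"
  shows "rcoset_mult R I (A +> x) (B +> y) = I +> (x \<otimes> y)"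
proof -
  interpret I: ideal I R by (rule I)
  have eq: "I +> (a \<otimes> b) = I +> (x \<otimes> y)" if a: "a \<in> A +> x" and b: "b \<in> B +> y" for a b
  proof -
    obtain h h' where h: "h \<in> A" "a = h \<oplus> x" and h': "h' \<in> B" "b = h' \<oplus> y"
      using a b by (auto simp: a_r_coset_def' )
    have c: "h \<in> carrier R" "h' \<in> carrier R" using h h' AB by auto
    have "a \<otimes> b = (h \<otimes> h' \<oplus> h \<otimes> y \<oplus> x \<otimes> h') \<oplus> x \<otimes> y"
      unfolding h h' using c xy by algebra
    then have "a \<otimes> b \<ominus> x \<otimes> y = h \<otimes> h' \<oplus> h \<otimes> y \<oplus> x \<otimes> h'"
      using c xy by (simp add: a_minus_def a_assoc r_neg)
    also have "\<dots> \<in> I" using A[OF h(1)] B[OF h'(1)] prod[OF h(1) h'(1)] by simp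
    finally show ?thesis
      using quotient_eq_iff_same_a_r_cos[OF I, of "a \<otimes> b" "x \<otimes> y"] c xy by (simp add: h h')
  qed
  have "x \<in> A +> x" "y \<in> B +> y" using AB xy by (force simp: a_r_coset_def')+
  then show ?thesis unfolding rcoset_mult_def using eq by blast
qed

locale filtered_ring = cring R for R (structure) +
  fixes F :: "nat \<Rightarrow> 'a set"
  assumes ideal_F: "ideal (F n) R"
    and F_mult: "x \<in> F m \<Longrightarrow> y \<in> F n \<Longrightarrow> x \<otimes> y \<in> F (m + n)"
    and F_Suc: "F (Suc n) \<subseteq> F n"
begin

lemma F_subset: "F n \<subseteq> carrier R"
  by (rule ideal.Icarr[OF ideal_F, THEN subsetI])

lemma assoc_graded_mult:
  assumes x: "\<And>n. x n \<in> F n" and y: "\<And>n. y n \<in> F n"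
  shows "(\<lambda>n. F (Suc n) +> x n) \<otimes>\<^bsub>assoc_graded R F\<^esub> (\<lambda>n. F (Suc n) +> y n)
    = (\<lambda>n. F (Suc n) +> (\<Oplus>i\<in>{..n}. x i \<otimes> y (n - i)))"
proof
  fix n
  have c: "x n \<in> carrier R" "y n \<in> carrier R" for n
    using x[of n] y[of n] F_subset[of n] by blast+
  have coset: "rcoset_mult R (F (Suc n)) (F (Suc i) +> x i) (F (Suc (n - i)) +> y (n - i))
      = F (Suc n) +> (x i \<otimes> y (n - i))" if i: "i \<le> n" for i
  proof (rule rcoset_mult_cosets[OF ideal_F F_subset F_subset])
    show "\<zero> \<in> F m" for m using ideal_F[of m] additive_subgroup.zero_closed ideal.axioms(1) by blast
    then show "\<zero> \<in> F (Suc (n - i))" by blast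
    show "h \<otimes> y (n - i) \<in> F (Suc n)" if "h \<in> F (Suc i)" for h
      using F_mult[OF that y[of "n - i"]] i by simp
    show "x i \<otimes> h \<in> F (Suc n)" if "h \<in> F (Suc (n - i))" for h
      using F_mult[OF x[of i] that] i by simp
    show "h \<otimes> h' \<in> F (Suc n)" if "h \<in> F (Suc i)" "h' \<in> F (Suc (n - i))" for h h'
      using F_mult[OF that] F_Suc[of "Suc n"] i by (simp add: subset_iff)
  qed (simp_all add: c)
  interpret I: ideal "F (Suc n)" R by (rule ideal_F)
  interpret Q: ring_hom_cring R "R Quot F (Suc n)" "(+>) (F (Suc n))"
    by (rule I.rcos_ring_hom_cring) (rule cring_axioms)
  have "((\<lambda>n. F (Suc n) +> x n) \<otimes>\<^bsub>assoc_graded R F\<^esub> (\<lambda>n. F (Suc n) +> y n)) n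
    = (\<Oplus>\<^bsub>R Quot F (Suc n)\<^esub>i\<in>{..n}. rcoset_mult R (F (Suc n)) (F (Suc i) +> x i) (F (Suc (n - i))
        +> y (n - i)))"
    by (simp add: assoc_graded_def)
  also have "\<dots> = (\<Oplus>\<^bsub>R Quot F (Suc n)\<^esub>i\<in>{..n}. ((+>) (F (Suc n)) \<circ> (\<lambda>i. x i \<otimes> y (n - i))) i)"
    by (rule Q.S.finsum_cong') (use coset c in \<open>auto intro!: Q.hom_closed m_closed\<close>)
  also have "\<dots> = F (Suc n) +> (\<Oplus>i\<in>{..n}. x i \<otimes> y (n - i))"
    by (rule Q.hom_finsum[symmetric]) (use c in auto)
  finally show "((\<lambda>n. F (Suc n) +> x n) \<otimes>\<^bsub>assoc_graded R F\<^esub> (\<lambda>n. F (Suc n) +> y n)) n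
    = F (Suc n) +> (\<Oplus>i\<in>{..n}. x i \<otimes> y (n - i))" .
qed

lemma assoc_graded_add:
  assumes x: "\<And>n. x n \<in> F n" and y: "\<And>n. y n \<in> F n"
  shows "(\<lambda>n. F (Suc n) +> x n) \<oplus>\<^bsub>assoc_graded R F\<^esub> (\<lambda>n. F (Suc n) +> y n) = (\<lambda>n. F (Suc n) +> (x n \<oplus> y n))"
proof
  fix n
  interpret I: ideal "F (Suc n)" R by (rule ideal_F)
  show "((\<lambda>n. F (Suc n) +> x n) \<oplus>\<^bsub>assoc_graded R F\<^esub> (\<lambda>n. F (Suc n) +> y n)) n = F (Suc n) +> (x n \<oplus> y n)"
    using x[of n] y[of n] F_subset[of n] by (simp add: assoc_graded_def I.a_rcos_sum subset_iff)
qed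

lemma coset_eq_iff: "x \<in> carrier R \<Longrightarrow> y \<in> carrier R \<Longrightarrow> F n +> x = F n +> y \<longleftrightarrow> x \<ominus> y \<in> F n"
  using quotient_eq_iff_same_a_r_cos[OF ideal_F] by blast

lemma coset_eq_zero_iff: "x \<in> carrier R \<Longrightarrow> F n +> x = F n \<longleftrightarrow> x \<in> F n"
proof -
  assume x: "x \<in> carrier R"
  interpret I: ideal "F n" R by (rule ideal_F)
  show ?thesis using x I.a_rcos_self[OF x] I.a_rcos_const by auto
qed

end

section \<open>Restricting a polynomial to a set of monomials\<close>

definition poly_cut :: "(variable \<Rightarrow>\<^sub>0 nat) set \<Rightarrow> int_poly_xyu \<Rightarrow> int_poly_xyu" where
  "poly_cut S p = (\<Sum>m\<in>{m \<in> keys p. m \<in> S}. single m (lookup p m))"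

lemma lookup_poly_cut: "lookup (poly_cut S p) m = (if m \<in> S then lookup p m else 0)"
proof -
  have "lookup (poly_cut S p) m
      = (\<Sum>m'\<in>{m \<in> keys p. m \<in> S}. if m' = m then lookup p m' else 0)"
    by (simp add: poly_cut_def lookup_sum lookup_single when_def)
  also have "\<dots> = (if m \<in> S then lookup p m else 0)"
    by (auto simp: sum.delta not_in_keys_iff_lookup_eq_zero)
  finally show ?thesis .
qed

lemma keys_poly_cut: "keys (poly_cut S p) = keys p \<inter> S"
proof -
  have "m \<notin> keys (poly_cut S p) \<longleftrightarrow> m \<notin> keys p \<inter> S" for m
    by (simp add: not_in_keys_iff_lookup_eq_zero lookup_poly_cut)
  then show ?thesis by blast
qed

lemma poly_cut_split: "p = poly_cut S p + poly_cut (- S) p"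
  by (rule poly_mapping_eqI) (simp add: lookup_add lookup_poly_cut)

lemma poly_cut_UNIV: "poly_cut UNIV p = p"
  by (rule poly_mapping_eqI) (simp add: lookup_poly_cut)

lemma graded_value_homogeneous:
  assumes "\<And>m. m \<in> keys p \<Longrightarrow> weight m = d"
  shows "graded_value A B W p = fps_const (poly_value A B W p) * fps_X ^ d"
proof (rule fps_ext)
  fix n
  have "{m \<in> keys p. weight m = n} = (if n = d then keys p else {})"
    using assms by auto
  then show "fps_nth (graded_value A B W p) n = fps_nth (fps_const (poly_value A B W p) * fps_X ^ d) n"
    by (simp add: graded_value_nth fps_X_power_nth poly_value_def)
qed

lemma graded_value_cut:
  "fps_nth (graded_value A B W p) n = poly_value A B W (poly_cut {m. weight m = n} p)"
  unfolding graded_value_nth poly_value_def keys_poly_cut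
  by (rule sum.cong) (auto simp: lookup_poly_cut)

context quaternion_reps
begin

lemma EF_mult': "x \<in> EF m \<Longrightarrow> y \<in> EF n \<Longrightarrow> x \<otimes>\<^sub>c y \<in> EF (m + n)"
  using EF_mult by (simp only: char_ring_simps(5))

lemma ideal_EF: "ideal (EF n) (char_ring G)"
proof (rule idealI)
  show "ring (char_ring G)" by (rule R.ring_axioms)
  show "subgroup (EF n) (add_monoid (char_ring G))" by (rule subgroup_EF)
  fix x y assume "x \<in> EF n" "y \<in> \<R>"
  then show "y \<otimes>\<^sub>c x \<in> EF n" "x \<otimes>\<^sub>c y \<in> EF n"
    using EF_mult'[of y 0 x n] EF_mult'[of x n y 0] by (simp_all add: EF_0)
qed

sublocale E: filtered_ring "char_ring G" EF
  by (rule filtered_ring.intro[OF cring_char_ring], rule filtered_ring_axioms.intro)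
    (rule ideal_EF, erule (1) EF_mult', rule EF_mono, simp)

definition comp :: "nat \<Rightarrow> int_poly_xyu \<Rightarrow> 'a \<Rightarrow> complex" where
  "comp n p = (\<lambda>g\<in>carrier G. fps_nth (graded_value (a g) (b g) (w g) p) n)"

lemma comp_eq_ev: "comp n p = ev (poly_cut {m. weight m = n} p)"
  unfolding comp_def ev_def graded_value_cut ..

lemma comp_EF: "comp n p \<in> EF n"
  unfolding comp_eq_ev EF_def by (rule imageI) (simp add: order_ge_def keys_poly_cut)

lemma comp_closed: "comp n p \<in> \<R>"
  using comp_EF EF_subset by blast

lemma comp_add: "comp n (p + q) = comp n p \<oplus>\<^sub>c comp n q"
  unfolding char_ring_simps(4) comp_def
  by (rule restrict_ext) (simp add: graded_value_def poly_value_add)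

lemma comp_mult: "comp n (p * q) = (\<Oplus>\<^bsub>char_ring G\<^esub>i\<in>{..n}. comp i p \<otimes>\<^sub>c comp (n - i) q)"
proof -
  have "(\<Oplus>\<^bsub>char_ring G\<^esub>i\<in>{..n}. comp i p \<otimes>\<^sub>c comp (n - i) q)
      = (\<lambda>g\<in>carrier G. \<Sum>i\<in>{..n}. (comp i p \<otimes>\<^sub>c comp (n - i) q) g)"
    by (rule R_finsum) (use comp_closed in auto)
  also have "\<dots> = comp n (p * q)"
    unfolding comp_def[of n]
    by (rule restrict_ext)
      (simp add: char_ring_simps(5) comp_def graded_value_def poly_value_mult fps_mult_nth atMost_atLeast0)
  finally show ?thesis by (rule HOL.sym)
qed

lemma comp_homogeneous:
  assumes "\<And>m. m \<in> keys p \<Longrightarrow> weight m = d"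
  shows "comp n p = (if n = d then ev p else (\<lambda>g\<in>carrier G. 0))"
proof -
  have "graded_value A B W p = fps_const (poly_value A B W p) * fps_X ^ d" for A B W
    using assms by (rule graded_value_homogeneous)
  then show ?thesis unfolding comp_def ev_def by (auto intro!: restrict_ext simp: fps_X_power_nth)
qed

definition phi :: "int_poly_xyu \<Rightarrow> nat \<Rightarrow> ('a \<Rightarrow> complex) set" where
  "phi p = (\<lambda>n. EF (Suc n) +>\<^bsub>char_ring G\<^esub> comp n p)"

lemma graded_char_ring_eq: "graded_char_ring G = assoc_graded (char_ring G) EF"
proof -
  have "gamma_filtration G = EF" by (rule ext) (rule gamma_filtration_eq)
  then show ?thesis by (simp add: graded_char_ring_def)
qed

lemma phi_add: "phi (p + q) = phi p \<oplus>\<^bsub>graded_char_ring G\<^esub> phi q"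
  unfolding phi_def graded_char_ring_eq comp_add by (rule E.assoc_graded_add[symmetric]) (rule comp_EF)+

lemma phi_mult: "phi (p * q) = phi p \<otimes>\<^bsub>graded_char_ring G\<^esub> phi q"
  unfolding phi_def graded_char_ring_eq comp_mult by (rule E.assoc_graded_mult[symmetric]) (rule comp_EF)+

lemma phi_homogeneous:
  assumes "\<And>m. m \<in> keys p \<Longrightarrow> weight m = d"
  shows "phi p = homogeneous (char_ring G) EF d (ev p)"
proof -
  have "comp n p = (if n = d then ev p else \<zero>\<^bsub>char_ring G\<^esub>)" for n
    unfolding char_ring_simps(2) using assms by (rule comp_homogeneous)
  then show ?thesis unfolding phi_def homogeneous_def by (simp only:)
qed

lemma phi_one: "phi 1 = \<one>\<^bsub>graded_char_ring G\<^esub>"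
proof -
  have "phi 1 = homogeneous (char_ring G) EF 0 (ev 1)"
    by (rule phi_homogeneous) (simp add: weight_def flip: single_one)
  then show ?thesis
    unfolding graded_char_ring_eq assoc_graded_def homogeneous_def char_ring_simps(2,3) ev_1 by simp
qed

lemma phi_eq_zero_iff: "phi p = \<zero>\<^bsub>graded_char_ring G\<^esub> \<longleftrightarrow> (\<forall>n. comp n p \<in> EF (Suc n))"
  unfolding graded_char_ring_eq assoc_graded_def phi_def fun_eq_iff
  by (simp add: E.coset_eq_zero_iff comp_closed)

lemma phi_closed: "phi p \<in> carrier (graded_char_ring G)"
proof -
  have "{n. phi p n \<noteq> EF (Suc n)} \<subseteq> weight ` keys p"
  proof clarify
    fix n assume n: "phi p n \<noteq> EF (Suc n)"
    show "n \<in> weight ` keys p"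
    proof (rule ccontr)
      assume "n \<notin> weight ` keys p"
      then have empty: "{m \<in> keys p. weight m = n} = {}" by auto
      have "comp n p \<in> EF (Suc n)" unfolding comp_def graded_value_nth empty sum.empty by (rule EF_zero)
      then show False using n E.coset_eq_zero_iff[OF comp_closed] by (simp add: phi_def)
    qed
  qed
  then have "finite {n. phi p n \<noteq> EF (Suc n)}" by (rule finite_subset) simp
  then show ?thesis unfolding graded_char_ring_eq assoc_graded_def using comp_EF by (auto simp: phi_def)
qed

lemma EF_homogeneous:
  assumes "x \<in> EF n"
  shows "\<exists>h. (\<forall>m\<in>keys h. weight m = n) \<and> EF (Suc n) +>\<^bsub>char_ring G\<^esub> x = EF (Suc n) +>\<^bsub>char_ring G\<^esub> ev h"
proof -
  obtain p where x: "x = ev p" and p: "p \<in> order_ge n" using assms by (auto simp: EF_def)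
  let ?h = "poly_cut {m. weight m = n} p" and ?q = "poly_cut (- {m. weight m = n}) p"
  have "?q \<in> order_ge (Suc n)" using p by (auto simp: order_ge_def keys_poly_cut Suc_le_eq order_less_le)
  then have "ev ?q \<in> EF (Suc n)" by (auto simp: EF_def)
  moreover have "x \<ominus>\<^sub>c ev ?h = ev ?q"
  proof -
    have "x = ev (?h + ?q)" unfolding x by (subst poly_cut_split) (rule HOL.refl)
    then show ?thesis unfolding R_minus[OF _ ev_closed] using ev_closed
      by (simp add: R_minus) (simp add: ev_def poly_value_add cong: restrict_cong)
  qed
  ultimately have "EF (Suc n) +>\<^bsub>char_ring G\<^esub> x = EF (Suc n) +>\<^bsub>char_ring G\<^esub> ev ?h"
    using E.coset_eq_iff[of x "ev ?h" "Suc n"] ev_closed x by simp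
  then show ?thesis by (intro exI[of _ ?h]) (simp add: keys_poly_cut)
qed

lemma phi_surj: "phi ` UNIV = carrier (graded_char_ring G)"
proof
  show "phi ` UNIV \<subseteq> carrier (graded_char_ring G)" using phi_closed by blast
  show "carrier (graded_char_ring G) \<subseteq> phi ` UNIV"
  proof
    fix s assume s: "s \<in> carrier (graded_char_ring G)"
    let ?D = "{n. s n \<noteq> EF (Suc n)}"
    have fin: "finite ?D" and ex: "\<exists>r\<in>EF n. s n = EF (Suc n) +>\<^bsub>char_ring G\<^esub> r" for n
      using s by (auto simp: graded_char_ring_eq assoc_graded_def)
    have "\<exists>h. (\<forall>m\<in>keys h. weight m = n) \<and> s n = EF (Suc n) +>\<^bsub>char_ring G\<^esub> ev h" for n
      using ex[of n] EF_homogeneous by metis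
    then obtain h where h: "\<And>n m. m \<in> keys (h n) \<Longrightarrow> weight m = n"
      "\<And>n. s n = EF (Suc n) +>\<^bsub>char_ring G\<^esub> ev (h n)" by metis
    have sum: "comp n (\<Sum>d\<in>D. h d) = (if n \<in> D then ev (h n) else (\<lambda>g\<in>carrier G. 0))" if "finite D" for n D
      using that
    proof (induction D rule: finite_induct)
      case empty
      show ?case by (simp add: comp_def graded_value_def)
    next
      case (insert d D)
      have "comp n (\<Sum>d\<in>insert d D. h d) = comp n (h d) \<oplus>\<^sub>c comp n (\<Sum>d\<in>D. h d)"
        using insert by (simp add: comp_add)
      also have "\<dots> = (if n = d then ev (h d) else \<zero>\<^bsub>char_ring G\<^esub>) \<oplus>\<^sub>c
          (if n \<in> D then ev (h n) else \<zero>\<^bsub>char_ring G\<^esub>)"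
        unfolding insert.IH char_ring_simps(2) by (subst comp_homogeneous[of "h d" d]) (erule h(1), rule
            HOL.refl)
      also have "\<dots> = (if n \<in> insert d D then ev (h n) else \<zero>\<^bsub>char_ring G\<^esub>)"
        using insert.hyps ev_closed by auto
      finally show ?case by (simp only: char_ring_simps(2))
    qed
    have "phi (\<Sum>d\<in>?D. h d) n = s n" for n
    proof (cases "n \<in> ?D")
      case True
      then show ?thesis unfolding phi_def sum[OF fin] by (simp add: h(2)[symmetric])
    next
      case False
      then have "s n = EF (Suc n)" by simp
      then show ?thesis unfolding phi_def sum[OF fin] using False EF_zero[of "Suc n"] char_ring_zero[of G]
        by (simp add: E.coset_eq_zero_iff del: restrict_apply)
    qed
    then have "s = phi (\<Sum>d\<in>?D. h d)" by auto
    then show "s \<in> phi ` UNIV" by blast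
  qed
qed

lemma ring_hom_cring_phi: "ring_hom_cring poly_ring_xyu (graded_char_ring G) phi"
proof -
  let ?P = "poly_ring_xyu" and ?S = "graded_char_ring G"
  have P: "cring ?P" unfolding poly_ring_xyu_def by (rule class_cring.cring_axioms)
  then interpret P: cring ?P .
  have hom: "phi \<in> Ring.ring_hom ?P ?S"
    by (rule ring_hom_memI) (simp_all add: poly_ring_xyu_def phi_closed phi_add phi_mult phi_one)
  have carr: "phi ` carrier ?P = carrier ?S" using phi_surj by (simp add: poly_ring_xyu_def)
  have "phi 0 = \<zero>\<^bsub>?S\<^esub>"
    unfolding phi_eq_zero_iff by (simp add: comp_def graded_value_def EF_zero)
  then have "phi \<zero>\<^bsub>?P\<^esub> = \<zero>\<^bsub>?S\<^esub>" by (simp add: poly_ring_xyu_def)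
  then have "?S\<lparr>carrier := phi ` carrier ?P, zero := phi \<zero>\<^bsub>?P\<^esub>\<rparr> = ?S" unfolding carr by simp
  then have S: "ring ?S" using P.ring_hom_imp_img_ring[OF hom] by simp
  then interpret S: ring ?S .
  have "cring ?S"
  proof (rule cring.intro[OF S], rule comm_monoid.intro[OF S.monoid_axioms], rule comm_monoid_axioms.intro)
    fix x y assume "x \<in> carrier ?S" "y \<in> carrier ?S"
    then obtain p q where "x = phi p" "y = phi q" unfolding phi_surj[symmetric] by blast
    then show "x \<otimes>\<^bsub>?S\<^esub> y = y \<otimes>\<^bsub>?S\<^esub> x" by (simp add: mult.commute flip: phi_mult)
  qed
  with P hom show ?thesis by (intro ring_hom_cring.intro ring_hom_cring_axioms.intro)
qed

end

abbreviation "pX \<equiv> poly_var Var_x"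
abbreviation "pY \<equiv> poly_var Var_y"
abbreviation "pU \<equiv> poly_var Var_u"

lemma order_ge_diff: "p \<in> order_ge n \<Longrightarrow> q \<in> order_ge n \<Longrightarrow> p - q \<in> order_ge n"
  using order_ge_add[OF _ order_ge_uminus, of p n q] by simp

lemma poly_eq_sum_single: "(p :: int_poly_xyu) = (\<Sum>m\<in>keys p. single m (lookup p m))"
  using poly_cut_UNIV[of p] by (simp add: poly_cut_def)

lemma graded_value_hom:
  "graded_value A B W (p + q) = graded_value A B W p + graded_value A B W q"
  "graded_value A B W (p - q) = graded_value A B W p - graded_value A B W q"
  "graded_value A B W (p * q) = graded_value A B W p * graded_value A B W q"
  "graded_value A B W (p ^ n) = graded_value A B W p ^ n"
  "graded_value A B W (numeral k) = numeral k"
  "graded_value A B W pX = fps_const A * fps_X"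
  "graded_value A B W pY = fps_const B * fps_X"
  "graded_value A B W pU = fps_const W * fps_X ^ 2"
  by (simp_all add: graded_value_def poly_value_add poly_value_diff poly_value_mult poly_value_power
      poly_value_numeral poly_value_var)

context quaternion_reps
begin

section \<open>A bound for the filtration\<close>

lemma a_power:
  assumes g: "g \<in> carrier G"
  shows "a g ^ Suc n = (-2) ^ n * a g"
proof (induction n)
  case (Suc n)
  have "a g ^ Suc (Suc n) = (-2) ^ n * (a g * a g)"
    using Suc by (simp only: power_Suc[of _ "Suc n"] mult.left_commute)
  then show ?case unfolding basis_relations(1)[OF g] by simp
qed simp

lemma b_power:
  assumes g: "g \<in> carrier G"
  shows "b g ^ Suc n = (-2) ^ n * b g"
proof (induction n)
  case (Suc n)
  have "b g ^ Suc (Suc n) = (-2) ^ n * (b g * b g)"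
    using Suc by (simp only: power_Suc[of _ "Suc n"] mult.left_commute)
  then show ?case unfolding basis_relations(2)[OF g] by simp
qed simp

lemma a_w_power:
  assumes g: "g \<in> carrier G"
  shows "a g * w g ^ n = 2 ^ n * a g"
proof (induction n)
  case (Suc n)
  have "a g * w g ^ Suc n = w g * (a g * w g ^ n)" by (simp add: mult.left_commute)
  also have "\<dots> = 2 ^ n * (w g * a g)" unfolding Suc by (simp add: mult.left_commute)
  also have "\<dots> = 2 ^ n * (2 * a g)" unfolding basis_relations(3)[OF g] ..
  finally show ?case by (simp only: power_Suc mult_ac)
qed simp

lemma b_w_power:
  assumes g: "g \<in> carrier G"
  shows "b g * w g ^ n = 2 ^ n * b g"
proof (induction n)
  case (Suc n)
  have "b g * w g ^ Suc n = w g * (b g * w g ^ n)" by (simp add: mult.left_commute)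
  also have "\<dots> = 2 ^ n * (w g * b g)" unfolding Suc by (simp add: mult.left_commute)
  also have "\<dots> = 2 ^ n * (2 * b g)" unfolding basis_relations(4)[OF g] ..
  finally show ?case by (simp only: power_Suc mult_ac)
qed simp

text \<open>The powers of 2 come from \<open>a\<^sup>i w\<^sup>k = \<plusminus> 2 ^ (i + k - 1) a\<close> and
  \<open>a\<^sup>i b\<^sup>j w\<^sup>k = \<plusminus> 2 ^ (i + j + k - 2) a b\<close>.\<close>

definition weight_bound :: "nat \<Rightarrow> ('a \<Rightarrow> complex) \<Rightarrow> bool" where
  "weight_bound n f \<longleftrightarrow> (\<exists>c1 c2 c3 c4 :: int. \<forall>g\<in>carrier G. f g =
     2 ^ (n div 2) * (of_int c1 * a g + of_int c2 * b g) + 2 ^ ((n - 1) div 2) * of_int c3 * (a g * b g)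
     + of_int c4 * w g ^ ((n + 1) div 2))"

lemma weight_bound_add:
  assumes "weight_bound n f" "weight_bound n f'"
  shows "weight_bound n (\<lambda>g. f g + f' g)"
proof -
  obtain c1 c2 c3 c4 d1 d2 d3 d4 :: int where
    f: "\<forall>g\<in>carrier G. f g = 2 ^ (n div 2) * (of_int c1 * a g + of_int c2 * b g)
      + 2 ^ ((n - 1) div 2) * of_int c3 * (a g * b g) + of_int c4 * w g ^ ((n + 1) div 2)" and
    f': "\<forall>g\<in>carrier G. f' g = 2 ^ (n div 2) * (of_int d1 * a g + of_int d2 * b g)
      + 2 ^ ((n - 1) div 2) * of_int d3 * (a g * b g) + of_int d4 * w g ^ ((n + 1) div 2)"
    using assms unfolding weight_bound_def by blast
  show ?thesis unfolding weight_bound_def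
    by (intro exI[of _ "c1 + d1"] exI[of _ "c2 + d2"] exI[of _ "c3 + d3"] exI[of _ "c4 + d4"])
      (simp add: f f' algebra_simps)
qed

lemma weight_bound_smult:
  assumes "weight_bound n f"
  shows "weight_bound n (\<lambda>g. of_int c * f g)"
proof -
  obtain c1 c2 c3 c4 :: int where
    f: "\<forall>g\<in>carrier G. f g = 2 ^ (n div 2) * (of_int c1 * a g + of_int c2 * b g)
      + 2 ^ ((n - 1) div 2) * of_int c3 * (a g * b g) + of_int c4 * w g ^ ((n + 1) div 2)"
    using assms unfolding weight_bound_def by blast
  show ?thesis unfolding weight_bound_def
    by (intro exI[of _ "c * c1"] exI[of _ "c * c2"] exI[of _ "c * c3"] exI[of _ "c * c4"])
      (simp add: f algebra_simps)
qed

lemma weight_bound_cong: "(\<And>g. g \<in> carrier G \<Longrightarrow> f g = f' g) \<Longrightarrow> weight_bound n f \<Longrightarrow> weight_bound n f'"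
  unfolding weight_bound_def by metis

lemma power_eq_mult: "m \<le> n \<Longrightarrow> (x :: complex) ^ n = x ^ m * x ^ (n - m)"
  by (simp flip: power_add)

lemma weight_bound_a: "n div 2 \<le> m \<Longrightarrow> weight_bound n (\<lambda>g. 2 ^ m * a g)"
  unfolding weight_bound_def
  by (rule exI[of _ "2 ^ (m - n div 2)"], rule exI[of _ 0], rule exI[of _ 0], rule exI[of _ 0])
    (simp add: power_eq_mult[of "n div 2" m])

lemma weight_bound_b: "n div 2 \<le> m \<Longrightarrow> weight_bound n (\<lambda>g. 2 ^ m * b g)"
  unfolding weight_bound_def
  by (rule exI[of _ 0], rule exI[of _ "2 ^ (m - n div 2)"], rule exI[of _ 0], rule exI[of _ 0])
    (simp add: power_eq_mult[of "n div 2" m])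

lemma weight_bound_ab: "(n - 1) div 2 \<le> m \<Longrightarrow> weight_bound n (\<lambda>g. 2 ^ m * (a g * b g))"
  unfolding weight_bound_def
  by (rule exI[of _ 0], rule exI[of _ 0], rule exI[of _ "2 ^ (m - (n - 1) div 2)"], rule exI[of _ 0])
    (simp add: power_eq_mult[of "(n - 1) div 2" m])

lemma weight_bound_w: "weight_bound n (\<lambda>g. w g ^ ((n + 1) div 2))"
  unfolding weight_bound_def
  by (rule exI[of _ 0], rule exI[of _ 0], rule exI[of _ 0], rule exI[of _ 1]) simp

lemma weight_bound_w_power:
  assumes n: "n \<ge> 1" and m: "(n + 1) div 2 \<le> m"
  shows "weight_bound n (\<lambda>g. w g ^ m)"
  using m
proof (induction m rule: dec_induct)
  case base
  show ?case by (rule weight_bound_w)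
next
  case (step m)
  then obtain l where l: "m = Suc l" using n by (cases m) auto
  have "weight_bound n (\<lambda>g. of_int 4 * w g ^ m + (2 ^ m * a g + (2 ^ m * b g + 2 ^ l * (a g * b g))))"
    using step l by (intro weight_bound_add weight_bound_smult weight_bound_a weight_bound_b
        weight_bound_ab) auto
  moreover have "of_int 4 * w g ^ m + (2 ^ m * a g + (2 ^ m * b g + 2 ^ l * (a g * b g))) = w g ^ Suc m"
    if g: "g \<in> carrier G" for g
  proof -
    have "w g ^ Suc m = w g ^ l * (w g * w g)" unfolding l by (simp add: mult_ac)
    also have "\<dots> = 4 * (w g ^ l * w g) + 2 * (a g * w g ^ l) + 2 * (b g * w g ^ l) + (a g * w g ^ l) * b g"
      unfolding basis_relations(5)[OF g] by (simp add: algebra_simps)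
    also have "\<dots> = of_int 4 * w g ^ m + (2 ^ m * a g + (2 ^ m * b g + 2 ^ l * (a g * b g)))"
      unfolding a_w_power[OF g] b_w_power[OF g] l by (simp add: mult_ac)
    finally show ?thesis by (rule HOL.sym)
  qed
  ultimately show ?case by (rule weight_bound_cong[rotated])
qed

lemma weight_bound_monomial:
  assumes n: "n \<ge> 1" and wt: "n \<le> weight m"
  shows "weight_bound n (\<lambda>g. mono_value (a g) (b g) (w g) m)"
proof -
  define di dj dk where "di = lookup m Var_x" and "dj = lookup m Var_y"
    and "dk = lookup m Var_u"
  have val: "mono_value A B W m = A ^ di * B ^ dj * W ^ dk" for A B W :: complex
    by (simp add: mono_value_def di_def dj_def dk_def)
  have wt': "n \<le> di + dj + 2 * dk" using wt by (simp add: weight_def di_def dj_def dk_def)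
  show ?thesis unfolding val
  proof (cases di; cases dj)
    assume ij: "di = 0" "dj = 0"
    have "weight_bound n (\<lambda>g. w g ^ dk)" by (rule weight_bound_w_power) (use n wt' ij in auto)
    then show "weight_bound n (\<lambda>g. a g ^ di * b g ^ dj * w g ^ dk)" by (simp add: ij)
  next
    fix di' assume ij: "di = Suc di'" "dj = 0"
    have "weight_bound n (\<lambda>g. of_int ((-1) ^ di') * (2 ^ (di' + dk) * a g))"
      by (intro weight_bound_smult weight_bound_a) (use wt' ij in auto)
    then show "weight_bound n (\<lambda>g. a g ^ di * b g ^ dj * w g ^ dk)"
    proof (rule weight_bound_cong[rotated])
      fix g assume g: "g \<in> carrier G"
      have "a g ^ di * b g ^ dj * w g ^ dk = (-2) ^ di' * (a g * w g ^ dk)"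
        unfolding ij a_power[OF g] by (simp add: mult_ac)
      then show "of_int ((-1) ^ di') * (2 ^ (di' + dk) * a g) = a g ^ di * b g ^ dj * w g ^ dk"
        unfolding a_w_power[OF g] by (simp add: power_add power_minus[of 2] mult_ac)
    qed
  next
    fix dj' assume ij: "di = 0" "dj = Suc dj'"
    have "weight_bound n (\<lambda>g. of_int ((-1) ^ dj') * (2 ^ (dj' + dk) * b g))"
      by (intro weight_bound_smult weight_bound_b) (use wt' ij in auto)
    then show "weight_bound n (\<lambda>g. a g ^ di * b g ^ dj * w g ^ dk)"
    proof (rule weight_bound_cong[rotated])
      fix g assume g: "g \<in> carrier G"
      have "a g ^ di * b g ^ dj * w g ^ dk = (-2) ^ dj' * (b g * w g ^ dk)"
        unfolding ij b_power[OF g] by (simp add: mult_ac)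
      then show "of_int ((-1) ^ dj') * (2 ^ (dj' + dk) * b g) = a g ^ di * b g ^ dj * w g ^ dk"
        unfolding b_w_power[OF g] by (simp add: power_add power_minus[of 2] mult_ac)
    qed
  next
    fix di' dj' assume ij: "di = Suc di'" "dj = Suc dj'"
    have "weight_bound n (\<lambda>g. of_int ((-1) ^ (di' + dj')) * (2 ^ (di' + dj' + dk) * (a g * b g)))"
      by (intro weight_bound_smult weight_bound_ab) (use wt' ij in auto)
    then show "weight_bound n (\<lambda>g. a g ^ di * b g ^ dj * w g ^ dk)"
    proof (rule weight_bound_cong[rotated])
      fix g assume g: "g \<in> carrier G"
      have "a g ^ di * b g ^ dj * w g ^ dk = (-2) ^ di' * (-2) ^ dj' * ((a g * w g ^ dk) * b g)"
        unfolding ij a_power[OF g] b_power[OF g] by (simp add: mult_ac)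
      then show "of_int ((-1) ^ (di' + dj')) * (2 ^ (di' + dj' + dk) * (a g * b g))
          = a g ^ di * b g ^ dj * w g ^ dk"
        unfolding a_w_power[OF g] by (simp add: power_add power_minus[of 2] mult_ac)
    qed
  qed
qed

lemma EF_weight_bound:
  assumes n: "n \<ge> 1" and x: "x \<in> EF n"
  shows "weight_bound n x"
proof -
  obtain p where p: "x = ev p" "p \<in> order_ge n" using x by (auto simp: EF_def)
  have "keys p \<subseteq> {m. n \<le> weight m}" using p(2) by (auto simp: order_ge_def)
  then have "weight_bound n (\<lambda>g. poly_value (a g) (b g) (w g) p)"
  proof (induction p rule: poly_mapping_add_induct)
    case zero
    show ?case using weight_bound_smult[OF weight_bound_w, of n 0] by simp
  next
    case (add m c q)
    have "weight_bound n (\<lambda>g. of_int c * mono_value (a g) (b g) (w g) m)"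
      using add(1) by (intro weight_bound_smult weight_bound_monomial[OF n]) simp
    from weight_bound_add[OF this add(3)] show ?case by (simp add: poly_value_add poly_value_single)
  qed
  then show ?thesis by (rule weight_bound_cong[rotated]) (simp add: p(1) ev_def)
qed

lemma even_coefficient:
  assumes mem: "(\<lambda>g\<in>carrier G. of_int c * w g ^ r) \<in> EF (2 * r + 1)"
  shows "if r = 0 then c = 0 else 8 dvd c"
proof -
  obtain c1 c2 c3 c4 :: int where f: "\<forall>g\<in>carrier G. (\<lambda>g\<in>carrier G. of_int c * w g ^ r) g =
     2 ^ r * (of_int c1 * a g + of_int c2 * b g) + 2 ^ r * of_int c3 * (a g * b g)
         + of_int c4 * w g ^ Suc r"
    using EF_weight_bound[OF _ mem] unfolding weight_bound_def by auto
  define T where "T = (2 :: complex) ^ r"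
  have T: "T \<noteq> 0" by (simp add: T_def)
  have at: "of_int c * w g ^ r = T * (of_int c1 * a g + of_int c2 * b g) + T * of_int c3 * (a g * b g)
      + of_int c4 * w g ^ Suc r" if "g \<in> carrier G" for g
    using f that by (simp add: T_def)
  show ?thesis
  proof (cases "r = 0")
    case True
    then show ?thesis using at[of \<one>] by (simp add: values_at)
  next
    case False
    have "4 ^ r * (of_int c - 4 * of_int c4) = (0 :: complex)"
      using at[of z] by (simp add: values_at algebra_simps)
    then have "(of_int c :: complex) = of_int (4 * c4)" by simp
    then have e4: "c = 4 * c4" by (simp only: of_int_eq_iff)
    have "of_int c * T = T * (of_int c2 * - 2) + of_int c4 * (2 * T)"
      using at[of i] by (simp add: values_at flip: T_def)
    then have "T * (of_int c - of_int (2 * c4 - 2 * c2)) = 0" by (simp add: algebra_simps)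
    then have "(of_int c :: complex) = of_int (2 * c4 - 2 * c2)" using T by simp
    then have e2: "c = 2 * c4 - 2 * c2" by (simp only: of_int_eq_iff)
    have "of_int c * T = T * (of_int c1 * - 2) + of_int c4 * (2 * T)"
      using at[of j] by (simp add: values_at flip: T_def)
    then have "T * (of_int c - of_int (2 * c4 - 2 * c1)) = 0" by (simp add: algebra_simps)
    then have "(of_int c :: complex) = of_int (2 * c4 - 2 * c1)" using T by simp
    then have e1: "c = 2 * c4 - 2 * c1" by (simp only: of_int_eq_iff)
    have "of_int c * T = T * (of_int c1 * - 2 + of_int c2 * - 2) + T * of_int c3 * 4 + of_int c4 * (2 * T)"
      using at[of k] by (simp add: values_at flip: T_def)
    then have "T * (of_int c - of_int (2 * c4 - 2 * c1 - 2 * c2 + 4 * c3)) = 0" by (simp add: algebra_simps)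
    then have "(of_int c :: complex) = of_int (2 * c4 - 2 * c1 - 2 * c2 + 4 * c3)" using T by simp
    then have "c = 2 * c4 - 2 * c1 - 2 * c2 + 4 * c3" by (simp only: of_int_eq_iff)
    then have "c = 8 * (- c3)" using e1 e2 e4 by linarith
    then show ?thesis using False by simp
  qed
qed

lemma odd_coefficients:
  assumes mem: "(\<lambda>g\<in>carrier G. of_int c * (a g * w g ^ r) + of_int d * (b g * w g ^ r)) \<in> EF (2 * r + 2)"
  shows "even c \<and> even d"
proof -
  obtain c1 c2 c3 c4 :: int where f: "\<forall>g\<in>carrier G.
      (\<lambda>g\<in>carrier G. of_int c * (a g * w g ^ r) + of_int d * (b g * w g ^ r)) g =
     2 ^ Suc r * (of_int c1 * a g + of_int c2 * b g) + 2 ^ r * of_int c3 * (a g * b g)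
         + of_int c4 * w g ^ Suc r"
    using EF_weight_bound[OF _ mem] unfolding weight_bound_def by auto
  define T where "T = (2 :: complex) ^ r"
  have T: "T \<noteq> 0" by (simp add: T_def)
  have at: "of_int c * (a g * w g ^ r) + of_int d * (b g * w g ^ r)
      = 2 * T * (of_int c1 * a g + of_int c2 * b g) + T * of_int c3 * (a g * b g)
      + of_int c4 * w g ^ Suc r" if "g \<in> carrier G" for g
    using f that by (simp add: T_def)
  have c4: "c4 = 0" using at[of z] by (simp add: values_at)
  have "of_int d * (- 2 * T) = 2 * T * (of_int c2 * - 2)"
    using at[of i] by (simp add: values_at c4 flip: T_def)
  then have "T * (of_int d - of_int (2 * c2)) = 0" by (simp add: algebra_simps)
  then have "(of_int d :: complex) = of_int (2 * c2)" using T by simp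
  then have d: "d = 2 * c2" by (simp only: of_int_eq_iff)
  have "of_int c * (- 2 * T) = 2 * T * (of_int c1 * - 2)"
    using at[of j] by (simp add: values_at c4 flip: T_def)
  then have "T * (of_int c - of_int (2 * c1)) = 0" by (simp add: algebra_simps)
  then have "(of_int c :: complex) = of_int (2 * c1)" using T by simp
  then have "c = 2 * c1" by (simp only: of_int_eq_iff)
  with d show ?thesis by simp
qed

end

section \<open>The relation ideal\<close>

definition quaternion_relations :: "int_poly_xyu set" where
  "quaternion_relations = {2 * pX, 2 * pY, 8 * pU, pX ^ 2, pY ^ 2, pX * pY - 4 * pU}"

definition relation_ideal :: "int_poly_xyu set" where
  "relation_ideal = Idl\<^bsub>poly_ring_xyu\<^esub> quaternion_relations"

lemma poly_ring_xyu_simps: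
  "carrier poly_ring_xyu = UNIV" "p \<otimes>\<^bsub>poly_ring_xyu\<^esub> q = p * q" "p \<oplus>\<^bsub>poly_ring_xyu\<^esub> q = p + q"
  "\<zero>\<^bsub>poly_ring_xyu\<^esub> = 0"
  by (simp_all add: poly_ring_xyu_def)

lemma cring_poly_ring_xyu: "cring poly_ring_xyu"
  unfolding poly_ring_xyu_def by (rule class_cring.cring_axioms)

lemma ideal_relation_ideal: "ideal relation_ideal poly_ring_xyu"
proof -
  interpret cring poly_ring_xyu by (rule cring_poly_ring_xyu)
  show ?thesis unfolding relation_ideal_def by (rule genideal_ideal) (simp add: poly_ring_xyu_simps)
qed

lemma relation_ideal_incl: "p \<in> quaternion_relations \<Longrightarrow> p \<in> relation_ideal"
proof -
  interpret cring poly_ring_xyu by (rule cring_poly_ring_xyu)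
  show "p \<in> quaternion_relations \<Longrightarrow> p \<in> relation_ideal"
    unfolding relation_ideal_def using genideal_self[of quaternion_relations] by
        (auto simp: poly_ring_xyu_simps)
qed

lemma relation_ideal_0: "0 \<in> relation_ideal"
  using additive_subgroup.zero_closed[OF ideal.axioms(1)[OF ideal_relation_ideal]]
  by (simp add: poly_ring_xyu_simps)

lemma relation_ideal_add: "p \<in> relation_ideal \<Longrightarrow> q \<in> relation_ideal \<Longrightarrow> p + q \<in> relation_ideal"
  using additive_subgroup.a_closed[OF ideal.axioms(1)[OF ideal_relation_ideal]]
  by (simp add: poly_ring_xyu_simps)

lemma relation_ideal_mult: "p \<in> relation_ideal \<Longrightarrow> p * q \<in> relation_ideal"
  using ideal.I_r_closed[OF ideal_relation_ideal] by (simp add: poly_ring_xyu_simps)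

lemma relation_ideal_sum: "finite S \<Longrightarrow> (\<And>m. m \<in> S \<Longrightarrow> f m \<in> relation_ideal) \<Longrightarrow> (\<Sum>m\<in>S. f m) \<in> relation_ideal"
  by (induction S rule: finite_induct) (simp_all add: relation_ideal_0 relation_ideal_add)

lemma poly_var_power2:
  "pX ^ 2 = single (xyu 2 0 0) 1" "pY ^ 2 = single (xyu 0 2 0) 1"
  by (simp_all add: poly_var_xyu power2_eq_square mult_single xyu_add flip: numeral_2_eq_2)

lemma numeral_single: "numeral n * single m c = single m (numeral n * c :: int)"
  unfolding single_numeral[symmetric] mult_single by simp

lemma single_in_relation_ideal:
  "2 \<le> i \<Longrightarrow> single (xyu i j k) c \<in> relation_ideal"
  "2 \<le> j \<Longrightarrow> single (xyu i j k) c \<in> relation_ideal"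
  "8 dvd c \<Longrightarrow> single (xyu 0 0 (Suc k)) c \<in> relation_ideal"
  "even c \<Longrightarrow> single (xyu 1 0 k) c \<in> relation_ideal"
  "even c \<Longrightarrow> single (xyu 0 1 k) c \<in> relation_ideal"
proof -
  have rel: "pX ^ 2 \<in> relation_ideal" "pY ^ 2 \<in> relation_ideal" "8 * pU \<in> relation_ideal"
    "2 * pX \<in> relation_ideal" "2 * pY \<in> relation_ideal"
    by (rule relation_ideal_incl, simp add: quaternion_relations_def)+
  show "single (xyu i j k) c \<in> relation_ideal" if "2 \<le> i"
  proof -
    from that obtain l where "i = 2 + l" using le_Suc_ex by blast
    then have "single (xyu i j k) c = pX ^ 2 * single (xyu l j k) c"
      by (simp add: poly_var_power2 mult_single xyu_add)
    then show ?thesis using relation_ideal_mult[OF rel(1)] by simp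
  qed
  show "single (xyu i j k) c \<in> relation_ideal" if "2 \<le> j"
  proof -
    from that obtain l where "j = 2 + l" using le_Suc_ex by blast
    then have "single (xyu i j k) c = pY ^ 2 * single (xyu i l k) c"
      by (simp add: poly_var_power2 mult_single xyu_add)
    then show ?thesis using relation_ideal_mult[OF rel(2)] by simp
  qed
  show "single (xyu 0 0 (Suc k)) c \<in> relation_ideal" if "8 dvd c"
  proof -
    from that obtain d where "c = 8 * d" by blast
    then have "single (xyu 0 0 (Suc k)) c = 8 * pU * single (xyu 0 0 k) d"
      by (simp add: poly_var_xyu numeral_single mult_single xyu_add)
    then show ?thesis using relation_ideal_mult[OF rel(3)] by simp
  qed
  show "single (xyu 1 0 k) c \<in> relation_ideal" if "even c"
  proof -
    from that obtain d where "c = 2 * d" by blast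
    then have "single (xyu 1 0 k) c = 2 * pX * single (xyu 0 0 k) d"
      by (simp add: poly_var_xyu numeral_single mult_single xyu_add)
    then show ?thesis using relation_ideal_mult[OF rel(4)] by simp
  qed
  show "single (xyu 0 1 k) c \<in> relation_ideal" if "even c"
  proof -
    from that obtain d where "c = 2 * d" by blast
    then have "single (xyu 0 1 k) c = 2 * pY * single (xyu 0 0 k) d"
      by (simp add: poly_var_xyu numeral_single mult_single xyu_add)
    then show ?thesis using relation_ideal_mult[OF rel(5)] by simp
  qed
qed

definition reduced_monomials :: "(variable \<Rightarrow>\<^sub>0 nat) set" where
  "reduced_monomials = {xyu i j k | i j k. i + j \<le> 1}"

lemma xyu_reduced_iff: "xyu i j k \<in> reduced_monomials \<longleftrightarrow> i + j \<le> 1"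
  unfolding reduced_monomials_def using xyu_eq_iff by fastforce

lemma reduction:
  "\<exists>q\<in>relation_ideal. \<exists>r. keys r \<subseteq> reduced_monomials \<and> p = q + r"
proof (induction p rule: poly_mapping_add_induct[OF subset_UNIV])
  case 1
  show ?case by (rule bexI[OF _ relation_ideal_0], rule exI[of _ 0]) simp
next
  case (2 m c p)
  have "\<exists>q\<in>relation_ideal. \<exists>r. keys r \<subseteq> reduced_monomials \<and> single m c = q + r"
  proof -
    obtain i j k where m: "m = xyu i j k" using eq_xyu by blast
    consider "2 \<le> i \<or> 2 \<le> j" | "i = 1" "j = 1" | "i + j \<le> 1" by linarith
    then show ?thesis
    proof cases
      case 1
      then have "single m c \<in> relation_ideal" unfolding m using single_in_relation_ideal(1,2) by blast
      then show ?thesis by (rule bexI[rotated], intro exI[of _ 0]) simp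
    next
      case 2
      let ?q = "(pX * pY - 4 * pU) * single (xyu 0 0 k) c"
      have "?q \<in> relation_ideal"
        by (intro relation_ideal_mult relation_ideal_incl) (simp add: quaternion_relations_def)
      moreover have "single m c = ?q + single (xyu 0 0 (Suc k)) (4 * c)"
        by (simp add: m 2 poly_var_xyu numeral_single mult_single xyu_add left_diff_distrib)
      moreover have "keys (single (xyu 0 0 (Suc k)) (4 * c)) \<subseteq> reduced_monomials"
        by (simp add: xyu_reduced_iff)
      ultimately show ?thesis by blast
    next
      case 3
      then have "keys (single m c) \<subseteq> reduced_monomials"
        by (simp add: xyu_reduced_iff m)
      then show ?thesis using relation_ideal_0 by (metis add_0)
    qed
  qed
  then obtain q r where qr: "q \<in> relation_ideal" "keys r \<subseteq> reduced_monomials" "single m c = q + r"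
    by blast
  obtain q' r' where qr': "q' \<in> relation_ideal" "keys r' \<subseteq> reduced_monomials" "p = q' + r'"
    using 2 by blast
  have "single m c + p = (q + q') + (r + r')" by (simp add: qr qr')
  moreover have "keys (r + r') \<subseteq> reduced_monomials" using keys_add[of r r'] qr qr' by blast
  ultimately show ?case using relation_ideal_add[OF qr(1) qr'(1)] by blast
qed

context quaternion_reps
begin

interpretation phi: ring_hom_cring poly_ring_xyu "graded_char_ring G" phi
  by (rule ring_hom_cring_phi)

lemma kernelI:
  assumes hom: "\<And>A B W. graded_value A B W p = fps_const (poly_value A B W p) * fps_X ^ d"
    and eq: "\<And>g. g \<in> carrier G \<Longrightarrow> poly_value (a g) (b g) (w g) p = poly_value (a g) (b g) (w g) q"
    and q: "q \<in> order_ge (Suc d)"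
  shows "phi p = \<zero>\<^bsub>graded_char_ring G\<^esub>"
  unfolding phi_eq_zero_iff
proof
  fix n
  have "ev p = ev q" unfolding ev_def using eq by (intro restrict_ext)
  then have mem: "ev p \<in> EF (Suc d)" using q by (auto simp: EF_def)
  have "comp n p = (if n = d then ev p else (\<lambda>g\<in>carrier G. 0))"
    unfolding comp_def ev_def hom by (auto intro!: restrict_ext simp: fps_X_power_nth)
  then show "comp n p \<in> EF (Suc n)" using mem EF_zero by (simp del: restrict_apply)
qed

lemma relations_in_kernel:
  assumes "p \<in> quaternion_relations"
  shows "phi p = \<zero>\<^bsub>graded_char_ring G\<^esub>"
proof -
  note pv = poly_value_add poly_value_diff poly_value_mult poly_value_uminus poly_value_power
    poly_value_numeral poly_value_var
  have XX: "pX * pX \<in> order_ge 2" and YY: "pY * pY \<in> order_ge 2" and UX: "pU * pX \<in> order_ge 3"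
    and UY: "pU * pY \<in> order_ge 3" and UU: "pU * pU \<in> order_ge 3" and XXY: "pX * pX * pY \<in> order_ge 3"
    using order_ge_mult[OF order_ge_var(1) order_ge_var(1)] order_ge_mult[OF order_ge_var(2)
        order_ge_var(2)]
      order_ge_mult[OF order_ge_var(3) order_ge_var(1)] order_ge_mult[OF order_ge_var(3) order_ge_var(2)]
      order_ge_mono[OF _ order_ge_mult[OF order_ge_var(3) order_ge_var(3)], of 3]
      order_ge_mult[OF order_ge_mult[OF order_ge_var(1) order_ge_var(1)] order_ge_var(2)]
    by (simp_all add: numeral_2_eq_2 numeral_3_eq_3)
  have 1: "phi (2 * pX) = \<zero>\<^bsub>graded_char_ring G\<^esub>"
    by (rule kernelI[of _ 1 "- (pX * pX)"])
      (auto simp: graded_value_hom pv basis_relations numeral_fps_const mult_ac XX order_ge_uminus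
          numeral_2_eq_2[symmetric] simp flip: fps_const_mult)
  have 2: "phi (2 * pY) = \<zero>\<^bsub>graded_char_ring G\<^esub>"
    by (rule kernelI[of _ 1 "- (pY * pY)"])
      (auto simp: graded_value_hom pv basis_relations numeral_fps_const mult_ac YY order_ge_uminus
          numeral_2_eq_2[symmetric] simp flip: fps_const_mult)
  have 3: "phi (8 * pU) = \<zero>\<^bsub>graded_char_ring G\<^esub>"
  proof (rule kernelI[of _ 2 "pU * pU + pU * pU - pU * pX - pU * pX - pU * pY - pU * pY + pX * pX * pY"])
    show "pU * pU + pU * pU - pU * pX - pU * pX - pU * pY - pU * pY + pX * pX * pY \<in> order_ge (Suc 2)"
      using UU UX UY XXY by (intro order_ge_add order_ge_diff) simp_all
    show "poly_value (a g) (b g) (w g) (8 * pU) = poly_value (a g) (b g) (w g)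
      (pU * pU + pU * pU - pU * pX - pU * pX - pU * pY - pU * pY + pX * pX * pY)" if "g \<in> carrier G" for g
      unfolding pv basis_relations[OF that] by (simp add: algebra_simps)
  qed (simp add: graded_value_hom pv numeral_fps_const mult_ac flip: fps_const_mult)
  have 4: "phi (pX ^ 2) = \<zero>\<^bsub>graded_char_ring G\<^esub>"
  proof (rule kernelI[of _ 2 "- (pU * pX)"])
    show "- (pU * pX) \<in> order_ge (Suc 2)" using UX by (intro order_ge_uminus) simp
    show "poly_value (a g) (b g) (w g) (pX ^ 2) = poly_value (a g) (b g) (w g) (- (pU * pX))" if "g
        \<in> carrier G" for g
      unfolding pv power2_eq_square basis_relations[OF that] by simp
  qed (simp add: graded_value_hom pv power_mult_distrib flip: fps_const_power)
  have 5: "phi (pY ^ 2) = \<zero>\<^bsub>graded_char_ring G\<^esub>"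
  proof (rule kernelI[of _ 2 "- (pU * pY)"])
    show "- (pU * pY) \<in> order_ge (Suc 2)" using UY by (intro order_ge_uminus) simp
    show "poly_value (a g) (b g) (w g) (pY ^ 2) = poly_value (a g) (b g) (w g) (- (pU * pY))" if "g
        \<in> carrier G" for g
      unfolding pv power2_eq_square basis_relations[OF that] by simp
  qed (simp add: graded_value_hom pv power_mult_distrib flip: fps_const_power)
  have 6: "phi (pX * pY - 4 * pU) = \<zero>\<^bsub>graded_char_ring G\<^esub>"
  proof (rule kernelI[of _ 2 "pU * pX + pU * pY - pU * pU - pX * pX * pY"])
    show "pU * pX + pU * pY - pU * pU - pX * pX * pY \<in> order_ge (Suc 2)"
      using UU UX UY XXY by (intro order_ge_add order_ge_diff) simp_all
    show "poly_value (a g) (b g) (w g) (pX * pY - 4 * pU) = poly_value (a g) (b g) (w g)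
      (pU * pX + pU * pY - pU * pU - pX * pX * pY)" if "g \<in> carrier G" for g
      unfolding pv basis_relations[OF that] by (simp add: algebra_simps)
  qed (simp add: graded_value_hom pv numeral_fps_const power2_eq_square algebra_simps flip:
      fps_const_mult fps_const_sub)
  show ?thesis using assms 1 2 3 4 5 6 unfolding quaternion_relations_def by blast
qed

lemma comp_sum:
  assumes "finite S" "{m \<in> keys r. weight m = n} \<subseteq> S" "\<And>m. m \<in> S \<Longrightarrow> weight m = n"
  shows "comp n r = (\<lambda>g\<in>carrier G. \<Sum>m\<in>S. of_int (lookup r m) * mono_value (a g) (b g) (w g) m)"
  unfolding comp_def graded_value_nth
proof (rule restrict_ext, rule sum.mono_neutral_left[OF assms(1,2)], rule ballI)
  fix g m assume "m \<in> S - {m \<in> keys r. weight m = n}"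
  then have "lookup r m = 0" using assms(3) by (auto simp: not_in_keys_iff_lookup_eq_zero)
  then show "of_int (lookup r m) * mono_value (a g) (b g) (w g) m = 0" by simp
qed

lemma reduced_kernel:
  assumes r: "keys r \<subseteq> reduced_monomials" and ker: "phi r = \<zero>\<^bsub>graded_char_ring G\<^esub>"
  shows "r \<in> relation_ideal"
proof -
  have comp: "comp n r \<in> EF (Suc n)" for n using ker by (simp add: phi_eq_zero_iff)
  have even_wt: "if l = 0 then lookup r (xyu 0 0 l) = 0 else 8 dvd lookup r (xyu 0 0 l)" for l
  proof (rule even_coefficient)
    have "comp (2 * l) r = (\<lambda>g\<in>carrier G. \<Sum>m\<in>{xyu 0 0 l}. of_int (lookup r m) * mono_value (a g) (b g)
        (w g) m)"
    proof (rule comp_sum)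
      show "{m \<in> keys r. weight m = 2 * l} \<subseteq> {xyu 0 0 l}"
      proof clarify
        fix m assume m: "m \<in> keys r" "weight m = 2 * l"
        then obtain x y u where xyu: "m = xyu x y u" "x + y \<le> 1" using r by
            (auto simp: reduced_monomials_def)
        with m(2) have "x + y + 2 * u = 2 * l" by (simp add: weight_xyu)
        then have "x = 0" "y = 0" "u = l" using xyu(2) by presburger+
        then show "m = xyu 0 0 l" by (simp add: xyu(1))
      qed
    qed (auto simp: weight_xyu)
    also have "\<dots> = (\<lambda>g\<in>carrier G. of_int (lookup r (xyu 0 0 l)) * w g ^ l)"
      by (rule restrict_ext) (simp add: mono_value_xyu)
    finally show "(\<lambda>g\<in>carrier G. of_int (lookup r (xyu 0 0 l)) * w g ^ l) \<in> EF (2 * l + 1)"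
      using comp[of "2 * l"] by (simp only: Suc_eq_plus1)
  qed
  have odd_wt: "even (lookup r (xyu 1 0 l)) \<and> even (lookup r (xyu 0 1 l))" for l
  proof (rule odd_coefficients)
    have "comp (2 * l + 1) r = (\<lambda>g\<in>carrier G. \<Sum>m\<in>{xyu 1 0 l, xyu 0 1 l}. of_int (lookup r m) *
        mono_value (a g) (b g) (w g) m)"
    proof (rule comp_sum)
      show "{m \<in> keys r. weight m = 2 * l + 1} \<subseteq> {xyu 1 0 l, xyu 0 1 l}"
      proof
        fix m assume m: "m \<in> {m \<in> keys r. weight m = 2 * l + 1}"
        then obtain x y u where xyu: "m = xyu x y u" "x + y \<le> 1" using r by
            (auto simp: reduced_monomials_def)
        with m have "x + y + 2 * u = 2 * l + 1" by (simp add: weight_xyu)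
        then have "u = l \<and> (x = 1 \<and> y = 0 \<or> x = 0 \<and> y = 1)" using xyu(2) by presburger
        then show "m \<in> {xyu 1 0 l, xyu 0 1 l}" by (auto simp: xyu(1))
      qed
    qed (auto simp: weight_xyu)
    also have "\<dots> = (\<lambda>g\<in>carrier G. of_int (lookup r (xyu 1 0 l)) * (a g * w g ^ l)
        + of_int (lookup r (xyu 0 1 l)) * (b g * w g ^ l))"
      by (rule restrict_ext) (simp add: mono_value_xyu xyu_eq_iff)
    finally show "(\<lambda>g\<in>carrier G. of_int (lookup r (xyu 1 0 l)) * (a g * w g ^ l)
        + of_int (lookup r (xyu 0 1 l)) * (b g * w g ^ l)) \<in> EF (2 * l + 2)"
      using comp[of "2 * l + 1"] by (simp only: Suc_eq_plus1 add.assoc one_add_one)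
  qed
  have "single m (lookup r m) \<in> relation_ideal" if m: "m \<in> keys r" for m
  proof -
    obtain x y u where xyu: "m = xyu x y u" "x + y \<le> 1" using m r by (auto simp: reduced_monomials_def)
    have "x = 0 \<and> y = 0 \<or> x = 1 \<and> y = 0 \<or> x = 0 \<and> y = 1" using xyu(2) by presburger
    then consider "x = 0" "y = 0" "u = 0" | l where "x = 0" "y = 0" "u = Suc l" | "x = 1" "y = 0" | "x
        = 0" "y = 1"
      by (cases u) blast+
    then show ?thesis
    proof cases
      case 1
      then show ?thesis using even_wt[of 0] relation_ideal_0 by (simp add: xyu(1))
    next
      case (2 l)
      then show ?thesis using even_wt[of "Suc l"] single_in_relation_ideal(3) by (simp add: xyu(1))
    next
      case 3
      then show ?thesis using odd_wt[of u] single_in_relation_ideal(4) by (simp add: xyu(1))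
    next
      case 4
      then show ?thesis using odd_wt[of u] single_in_relation_ideal(5) by (simp add: xyu(1))
    qed
  qed
  then show ?thesis by (subst poly_eq_sum_single) (rule relation_ideal_sum, simp_all)
qed

lemma kernel_phi: "a_kernel poly_ring_xyu (graded_char_ring G) phi = relation_ideal"
proof
  have kernel: "a_kernel poly_ring_xyu (graded_char_ring G) phi = {p. phi p = \<zero>\<^bsub>graded_char_ring G\<^esub>}"
    unfolding a_kernel_def' by (simp only: poly_ring_xyu_simps UNIV_I simp_thms)
  have ker_ideal: "ideal (a_kernel poly_ring_xyu (graded_char_ring G) phi) poly_ring_xyu"
    by (rule ring_hom_ring.kernel_is_ideal, rule ring_hom_ringI2)
      (rule phi.R.ring_axioms phi.S.ring_axioms phi.homh)+
  have rel: "phi p = \<zero>\<^bsub>graded_char_ring G\<^esub>" if "p \<in> relation_ideal" for p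
  proof -
    have "relation_ideal \<subseteq> a_kernel poly_ring_xyu (graded_char_ring G) phi"
      unfolding relation_ideal_def
      by (rule phi.R.genideal_minimal[OF ker_ideal]) (use relations_in_kernel in \<open>auto simp: kernel\<close>)
    then show ?thesis using that kernel by blast
  qed
  then show "relation_ideal \<subseteq> a_kernel poly_ring_xyu (graded_char_ring G) phi" unfolding kernel by blast
  show "a_kernel poly_ring_xyu (graded_char_ring G) phi \<subseteq> relation_ideal"
  proof
    fix p assume "p \<in> a_kernel poly_ring_xyu (graded_char_ring G) phi"
    then have p: "phi p = \<zero>\<^bsub>graded_char_ring G\<^esub>" by (simp add: kernel)
    obtain q r where q: "q \<in> relation_ideal" and r: "keys r \<subseteq> reduced_monomials" "p = q + r"
      using reduction by blast
    have "phi p = phi q \<oplus>\<^bsub>graded_char_ring G\<^esub> phi r" unfolding r(2) by (rule phi_add)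
    then have "phi r = \<zero>\<^bsub>graded_char_ring G\<^esub>" using p rel[OF q] phi_closed[of r] by simp
    then show "p \<in> relation_ideal" unfolding r(2) using q reduced_kernel[OF r(1)]
        by (intro relation_ideal_add)
  qed
qed

lemma gamma_op_shift:
  "gamma_op G 1 (ch 1 1 0 0 0 \<ominus>\<^sub>c add_pow (char_ring G) (1 :: int) \<one>\<^bsub>char_ring G\<^esub>) = ch 0 1 0 0 0"
  "gamma_op G 1 (ch 1 0 1 0 0 \<ominus>\<^sub>c add_pow (char_ring G) (1 :: int) \<one>\<^bsub>char_ring G\<^esub>) = ch 0 0 1 0 0"
  "gamma_op G 2 (ch 2 0 0 0 (-1) \<ominus>\<^sub>c add_pow (char_ring G) (2 :: int) \<one>\<^bsub>char_ring G\<^esub>) = ch 0 0 0 0 1"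
proof -
  have minus: "ch c0 c1 c2 c3 c4 \<ominus>\<^sub>c add_pow (char_ring G) (c0 :: int) \<one>\<^bsub>char_ring G\<^esub>
      = ch 0 c1 c2 c3 c4" for c0 c1 c2 c3 c4
  proof -
    have pow: "add_pow (char_ring G) c0 \<one>\<^bsub>char_ring G\<^esub> = ch c0 0 0 0 0"
      unfolding R_add_pow[OF R.one_closed] ch_def by (rule restrict_ext) (simp add: char_ring_simps(3))
    show ?thesis unfolding pow R_minus[OF ch_carrier ch_carrier]
      unfolding ch_def by (rule restrict_ext) simp
  qed
  show "gamma_op G 1 (ch 1 1 0 0 0 \<ominus>\<^sub>c add_pow (char_ring G) (1 :: int) \<one>\<^bsub>char_ring G\<^esub>) = ch 0 1 0 0 0"
    "gamma_op G 1 (ch 1 0 1 0 0 \<ominus>\<^sub>c add_pow (char_ring G) (1 :: int) \<one>\<^bsub>char_ring G\<^esub>) = ch 0 0 1 0 0"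
    "gamma_op G 2 (ch 2 0 0 0 (-1) \<ominus>\<^sub>c add_pow (char_ring G) (2 :: int) \<one>\<^bsub>char_ring G\<^esub>) = ch 0 0 0 0 1"
    unfolding minus using gamma_op_1 gamma_op_2 by auto
qed

lemma phi_var:
  "phi pX = chern_class G 1 (character G \<rho>1)" "phi pY = chern_class G 1 (character G \<rho>2)"
  "phi pU = chern_class G 2 (character G \<Delta>)"
proof -
  have filt: "gamma_filtration G = EF" by (rule ext) (rule gamma_filtration_eq)
  have "phi pX = homogeneous (char_ring G) EF 1 (ev pX)" "phi pY = homogeneous (char_ring G) EF 1 (ev pY)"
    "phi pU = homogeneous (char_ring G) EF 2 (ev pU)"
    by (rule phi_homogeneous, simp add: poly_var_xyu weight_xyu)+
  then show "phi pX = chern_class G 1 (character G \<rho>1)" "phi pY = chern_class G 1 (character G \<rho>2)"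
    "phi pU = chern_class G 2 (character G \<Delta>)"
    unfolding chern_class_def \<rho>1_ch \<rho>2_ch \<Delta>_ch augmentation_ch gamma_op_shift filt ev_var by simp_all
qed

end

theorem theorem6p4:
  fixes \<rho>1 \<rho>2 \<Delta> :: "quaternion_gen word set \<Rightarrow> complex mat"
    and x y u :: "nat \<Rightarrow> (quaternion_gen word set \<Rightarrow> complex) set"
    and X Y U :: int_poly_xyu
  assumes \<rho>1: "representation Q8 1 \<rho>1"
      "character Q8 \<rho>1 (Q8_gen Gen_i) = 1" "character Q8 \<rho>1 (Q8_gen Gen_j) = -1"
    and \<rho>2: "representation Q8 1 \<rho>2"
      "character Q8 \<rho>2 (Q8_gen Gen_i) = -1" "character Q8 \<rho>2 (Q8_gen Gen_j) = 1"
    and \<Delta>: "representation Q8 2 \<Delta>"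
      "\<Delta> (Q8_gen Gen_i) = mat_of_rows_list 2 [[\<i>, 0], [0, -\<i>]]"
      "\<Delta> (Q8_gen Gen_j) = mat_of_rows_list 2 [[0, -1], [1, 0]]"
      "\<Delta> (Q8_gen Gen_k) = mat_of_rows_list 2 [[0, -\<i>], [-\<i>, 0]]"
  defines "x \<equiv> chern_class Q8 1 (character Q8 \<rho>1)"
    and "y \<equiv> chern_class Q8 1 (character Q8 \<rho>2)"
    and "u \<equiv> chern_class Q8 2 (character Q8 \<Delta>)"
    and "X \<equiv> poly_var Var_x"
    and "Y \<equiv> poly_var Var_y"
    and "U \<equiv> poly_var Var_u"
  shows "\<exists>\<phi>. ring_hom_cring poly_ring_xyu (graded_char_ring Q8) \<phi> \<and>
           \<phi> X = x \<and> \<phi> Y = y \<and> \<phi> U = u \<and>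
           \<phi> ` carrier poly_ring_xyu = carrier (graded_char_ring Q8) \<and>
           a_kernel poly_ring_xyu (graded_char_ring Q8) \<phi> =
             Idl\<^bsub>poly_ring_xyu\<^esub> {2 * X, 2 * Y, 8 * U, X^2, Y^2, X * Y - 4 * U}"
proof -
  interpret quaternion_reps Q8 "Q8_gen Gen_i" "Q8_gen Gen_j" "Q8_gen Gen_k" \<rho>1 \<rho>2 \<Delta>
    by (intro quaternion_reps.intro quaternion_group_Q8 quaternion_reps_axioms.intro \<rho>1 \<rho>2 \<Delta>)
  show ?thesis
    unfolding x_def y_def u_def X_def Y_def U_def
    using ring_hom_cring_phi phi_var phi_surj kernel_phi
    unfolding relation_ideal_def quaternion_relations_def
    by (intro exI[of _ phi]) (simp add: poly_ring_xyu_simps)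
qed

end
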